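(* Consider the sequence of state-dependent queueing networks indexed by $n\in\mathbb N$ described in the context, with queue-length processes $Q^n$, and let $P=(p_{ij})_{1\le i,j\le K}$ be a substochastic matrix, $R=I-P^T$. Assume: (A0) for each $n$ and each $i\in\mathcal J$, $\limsup_{t\to\infty}N^{A,n}_i(t)/t<\infty$ a.s.; (A1) the spectral radius of $P$ is strictly less than $1$; (A2) for each $i$, $\sup_{n\in\mathbb N}\sup_{x\in S}\Bigl(\frac{\lambda^n_i(nx)}{n(1+|x|)}+\frac{\mu^n_i(nx)}{n(1+|x|)}\Bigr)<\infty$; (A3) there exist continuous functions $\lambda_i,\mu_i$ on $S$ such that $\lambda^n_i(nx)/n\to\lambda_i(x)$ and $\mu^n_i(nx)/n\to\mu_i(x)$ uniformly on compact subsets of $S$ as $n\to\infty$, for each $i$, and $\lambda(x)-R\mu(x)=0$ for all $x\in S$, where $\lambda=(\lambda_1,\dots,\lambda_K)$, $\mu=(\mu_1,\dots,\mu_K)$; (A4) there exists a Lipschitz-continuous function $a:S\to\mathbb R^K$ such that $\frac1{\sqrt n}\bigl(\lambda^n(\sqrt n x)-R\mu^n(\sqrt n x)\bigr)\to a(x)$ as $n\to\infty$ uniformly on compact subsets of $S$; (A5) as $n\to\infty$, $(\overline Q^n(0),\overline N^{A,n},\overline N^{D,n},\overline\Phi^n)\Rightarrow(X_0,W^A,W^D,W^\Phi)$ jointly, where $X_0$ is a random $K$-vector and $W^A,W^D,W^\Phi$ are continuous-path processes with trajectories in $\mathbb D([0,\infty),\mathbb R^K)$, $\mathbb D([0,\infty),\mathbb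 R^K)$ and $\mathbb D([0,\infty),\mathbb R^{K\times K})$, respectively. Let $X^n(t)=Q^n(t)/\sqrt n$, and let $X=(X(t),t\ge0)$ be the unique strong solution of $$X(t)=\Gamma\Bigl(X_0+\int_0^{\cdot}a(X(s))\,ds+M(\cdot)\Bigr)(t),\qquad t\ge0,$$ where $$M_i(t)=W^A_i(\lambda_i(0)t)+\sum_{j=1}^KW^\Phi_{ji}(\mu_j(0)t)-\sum_{j=1}^K(\delta_{ij}-p_{ji})W^D_j(\mu_j(0)t),\quad 1\le i\le K.$$ Then $X^n\Rightarrow X$ as $n\to\infty$.
   Context: Notation: $K\ge1$ is an integer, $S=\mathbb R_+^K$, $|\cdot|$ is the Euclidean norm, $\delta_{ij}$ is Kronecker's delta, $\lfloor\cdot\rfloor$ is the integer part, vectors are column vectors. $\mathbb D([0,\infty),E)$ is the Skorohod space of right-continuous functions with left limits; $\Rightarrow$ denotes convergence in distribution in the appropriate metric (Skorohod) space. All random objects are defined on a common probability space. Network. $\mathcal J\subseteq\{1,\dots,K\}$ is the set of stations with exogenous arrivals. For each $n\in\mathbb N$ and $1\le i\le K$: $\lambda^n_i,\mu^n_i:S\to\mathbb R_+$ are Borel functions, with $\lambda^n_i\equiv0$ if $i\notin\mathcal J$; $\lambda^n=(\lambda^n_1,\dots,\lambda^n_K)$, $\mu^n=(\mu^n_1,\dots,\mu^n_K)$. $N^{A,n}_i$ and $N^{D,n}_i$ are nondecreasing $\mathbb Z_+$-valued processes with trajectories in $\mathbb D([0,\infty),\mathbb R)$ starting at $0$, with $N^{A,n}_i(t)=\lfloor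 t\rfloor$ if $i\notin\mathcal J$. $\Phi^n_{ij}(m)$, $m=0,1,2,\dots$, is the cumulative number of customers, among the first $m$ customers departing station $i$, that go directly to station $j$; thus $\Phi^n_{ij}(0)=0$, each increment $\Phi^n_{ij}(m)-\Phi^n_{ij}(m-1)$ is in $\{0,1\}$, and $\sum_j(\Phi^n_{ij}(m)-\Phi^n_{ij}(m-1))\le1$. The initial queue length $Q^n(0)$ is $\mathbb Z_+^K$-valued. The queue-length process $Q^n=(Q^n_1,\dots,Q^n_K)$ is a $\mathbb Z_+^K$-valued process satisfying a.s., for all $t\ge0$ and all $i$, $$Q^n_i(t)=Q^n_i(0)+A^n_i(t)+B^n_i(t)-D^n_i(t),\quad A^n_i(t)=N^{A,n}_i\Bigl(\int_0^t\lambda^n_i(Q^n(s))\,ds\Bigr),$$ $$B^n_i(t)=\sum_{j=1}^K\Phi^n_{ji}(D^n_j(t)),\quad D^n_i(t)=N^{D,n}_i\Bigl(\int_0^t\mu^n_i(Q^n(s))1_{\{Q^n_i(s)>0\}}\,ds\Bigr).$$ Scaled primitives: $p_i=(p_{ij})_{j}$, $\overline Q^n(0)=Q^n(0)/\sqrt n$, $\overline N^{A,n}_i(t)=\frac{N^{A,n}_i(nt)-nt}{\sqrt n}$, $\overline N^{D,n}_i(t)=\frac{N^{D,n}_i(nt)-nt}{\sqrt n}$, $\overline\Phi^n_i(t)=\frac{\Phi^n_i(\lfloor nt\rfloor)-p_int}{\sqrt n}$ with $\Phi^n_i=(\Phi^n_{ij})_j$; $\overline N^{A,n}=(\overline N^{A,n}_i)_i$,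 $\overline N^{D,n}=(\overline N^{D,n}_i)_i$, $\overline\Phi^n=(\overline\Phi^n_i)_i$. Skorohod map. For $\psi\in\mathbb D([0,\infty),\mathbb R^K)$ with $\psi(0)\in S$, a pair $(\phi,\eta)$ of functions in $\mathbb D([0,\infty),\mathbb R^K)$ solves the Skorohod problem for $\psi$ with respect to $S$ and $R$ if $\phi(t)=\psi(t)+R\eta(t)\in S$ for all $t\ge0$ and, for each $i$, $\eta_i(0)=0$, $\eta_i$ is nondecreasing, and $\int_0^\infty1_{\{\phi_i(s)\ne0\}}\,d\eta_i(s)=0$. When the spectral radius of $P$ is less than $1$, it is known that a unique solution exists for every such $\psi$; put $\Gamma(\psi)=\phi$. It is also known that $\Gamma$ is Lipschitz continuous for the uniform norm on each $[0,T]$ with a constant not depending on $T$; together with Lipschitz continuity of $a$ this makes the equation for $X$ uniquely solvable. *)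

theory Defs
  imports "HOL-Probability.Probability"
begin

section \<open>The Skorohod space\<close>

definition cadlag :: "(real \<Rightarrow> 'a::topological_space) \<Rightarrow> bool" where
  "cadlag x \<longleftrightarrow>
     (\<forall>t\<ge>0. (x \<longlongrightarrow> x t) (at_right t)) \<and> (\<forall>t>0. \<exists>l. (x \<longlongrightarrow> l) (at_left t))"

text \<open>
  Functions on \<open>[0,\<infinity>)\<close> are represented by functions on the whole line that are constant on
  \<open>(-\<infinity>,0]\<close>, so that two elements of the type are equal iff they agree on \<open>[0,\<infinity>)\<close>.
\<close>

typedef (overloaded) 'a skorohod =
  "{x :: real \<Rightarrow> 'a::metric_space. cadlag x \<and> (\<forall>t\<le>0. x t = x 0)}"
  morphisms path_of Abs_skorohod
proof
  show "(\<lambda>_. undefined) \<in> {x :: real \<Rightarrow> 'a. cadlag x \<and> (\<forall>t\<le>0. x t = x 0)}"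
    by (auto simp: cadlag_def)
qed

definition to_skorohod :: "(real \<Rightarrow> 'a::metric_space) \<Rightarrow> 'a skorohod" where
  "to_skorohod x = Abs_skorohod (\<lambda>t. x (max 0 t))"

lemma path_of_to_skorohod:
  assumes "cadlag x" "t \<ge> 0"
  shows "path_of (to_skorohod x) t = x t"
proof -
  have r: "((\<lambda>t. x (max 0 t)) \<longlongrightarrow> x (max 0 s)) (at_right s)" if "s \<ge> 0" for s
  proof -
    have "(x \<longlongrightarrow> x s) (at_right s)" using assms(1) that by (auto simp: cadlag_def)
    moreover have "eventually (\<lambda>t. x t = x (max 0 t)) (at_right s)"
      using that by (auto simp: eventually_at_filter max_def)
    ultimately show ?thesis using that by (auto intro: Lim_transform_eventually)
  qed
  have l: "\<exists>l. ((\<lambda>t. x (max 0 t)) \<longlongrightarrow> l) (at_left s)" if s: "s > 0" for s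
  proof -
    obtain l where "(x \<longlongrightarrow> l) (at_left s)" using assms(1) s by (auto simp: cadlag_def)
    moreover have "eventually (\<lambda>t. x t = x (max 0 t)) (at_left s)"
      using eventually_at_left_real[OF s] by (rule eventually_mono) auto
    ultimately show ?thesis by (auto intro: Lim_transform_eventually)
  qed
  show ?thesis
    unfolding to_skorohod_def
    by (subst Abs_skorohod_inverse) (use r l assms(2) in \<open>auto simp: cadlag_def\<close>)
qed

lemma skorohod_eq_iff: "x = y \<longleftrightarrow> (\<forall>t\<ge>0. path_of x t = path_of y t)"
proof
  assume *: "\<forall>t\<ge>0. path_of x t = path_of y t"
  have "path_of x t = path_of y t" for t
  proof (cases "t \<ge> 0")
    case False
    then have "path_of x t = path_of x 0" "path_of y t = path_of y 0"
      using path_of[of x] path_of[of y] by (blast intro: less_imp_le not_le_imp_less)+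
    then show ?thesis using * by simp
  qed (use * in blast)
  then have "path_of x = path_of y" by (rule ext)
  then show "x = y" by (simp only: path_of_inject)
qed auto

text \<open>Strictly increasing bijections of \<open>[0,\<infinity>)\<close> (these are automatically continuous).\<close>

definition time_change :: "(real \<Rightarrow> real) \<Rightarrow> bool" where
  "time_change l \<longleftrightarrow> strict_mono_on {0..} l \<and> l ` {0..} = {0..}"

definition skorohod_nbhd :: "'a::metric_space skorohod \<Rightarrow> real \<Rightarrow> real \<Rightarrow> 'a skorohod set" where
  "skorohod_nbhd x T e = {y. \<exists>l. time_change l \<and> (\<forall>s\<ge>0. \<bar>l s - s\<bar> < e) \<and>
     (\<forall>s\<in>{0..T}. dist (path_of y (l s)) (path_of x s) < e)}"

lemma skorohod_nbhd_mono:
  assumes "S \<le> T" "d \<le> e"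
  shows "skorohod_nbhd x T d \<subseteq> skorohod_nbhd x S e"
proof
  fix y assume "y \<in> skorohod_nbhd x T d"
  then obtain l where l: "time_change l" "\<And>s. s \<ge> 0 \<Longrightarrow> \<bar>l s - s\<bar> < d"
    "\<And>s. s \<in> {0..T} \<Longrightarrow> dist (path_of y (l s)) (path_of x s) < d"
    by (auto simp: skorohod_nbhd_def)
  have "\<bar>l s - s\<bar> < e" if "s \<ge> 0" for s
    using l(2)[OF that] assms(2) by linarith
  moreover have "dist (path_of y (l s)) (path_of x s) < e" if "s \<in> {0..S}" for s
    using l(3)[of s] that assms by simp
  ultimately show "y \<in> skorohod_nbhd x S e"
    unfolding skorohod_nbhd_def using l(1) by blast
qed

text \<open>
  The Skorohod (J1) topology. Its convergent sequences are characterized in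
  \<open>LIMSEQ_skorohod_iff\<close> below (cf. Jacod and Shiryaev, Limit Theorems for Stochastic Processes,
  VI.1.14). The sets \<open>skorohod_nbhd x T e\<close> form a neighbourhood base at \<open>x\<close> for the topology of
  each of the usual Skorohod metrics on \<open>[0,\<infinity>)\<close>, so this is the topology they induce.
\<close>

instantiation skorohod :: (metric_space) topological_space
begin

definition open_skorohod :: "'a skorohod set \<Rightarrow> bool" where
  "open_skorohod U \<longleftrightarrow> (\<forall>x\<in>U. \<exists>T. \<exists>e>0. skorohod_nbhd x T e \<subseteq> U)"

instance
proof
  show "open (UNIV :: 'a skorohod set)"
    by (simp add: open_skorohod_def gt_ex)
next
  fix U V :: "'a skorohod set"
  assume U: "open U" and V: "open V"
  show "open (U \<inter> V)"
    unfolding open_skorohod_def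
  proof
    fix x assume x: "x \<in> U \<inter> V"
    from x U obtain S d where d: "d > 0" "skorohod_nbhd x S d \<subseteq> U"
      unfolding open_skorohod_def by blast
    from x V obtain T e where e: "e > 0" "skorohod_nbhd x T e \<subseteq> V"
      unfolding open_skorohod_def by blast
    have "skorohod_nbhd x (max S T) (min d e) \<subseteq> skorohod_nbhd x S d"
      "skorohod_nbhd x (max S T) (min d e) \<subseteq> skorohod_nbhd x T e"
      by (rule skorohod_nbhd_mono; simp)+
    then have "skorohod_nbhd x (max S T) (min d e) \<subseteq> U \<inter> V"
      using d(2) e(2) by blast
    moreover have "min d e > 0" using d(1) e(1) by simp
    ultimately show "\<exists>T. \<exists>e>0. skorohod_nbhd x T e \<subseteq> U \<inter> V" by blast
  qed
next
  fix K :: "'a skorohod set set"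
  assume K: "\<forall>S\<in>K. open S"
  show "open (\<Union> K)"
    unfolding open_skorohod_def
  proof
    fix x assume "x \<in> \<Union> K"
    then obtain S where S: "S \<in> K" "x \<in> S" by blast
    then obtain T e where "e > 0" "skorohod_nbhd x T e \<subseteq> S"
      using K unfolding open_skorohod_def by metis
    then show "\<exists>T. \<exists>e>0. skorohod_nbhd x T e \<subseteq> \<Union> K"
      using S(1) by (meson Union_upper order_trans)
  qed
qed

end

lemma time_change_id: "time_change (\<lambda>s. s)"
  by (auto simp: time_change_def strict_mono_on_def)

lemma skorohod_nbhd_self: "e > 0 \<Longrightarrow> x \<in> skorohod_nbhd x T e"
  unfolding skorohod_nbhd_def using time_change_id by (simp add: exI[of _ "\<lambda>s. s"])

lemma time_change_comp:
  assumes "time_change l" "time_change m"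
  shows "time_change (m \<circ> l)"
proof -
  have l: "strict_mono_on {0..} l" "l ` {0..} = {0..}" and m: "strict_mono_on {0..} m" "m ` {0..} = {0..}"
    using assms by (simp_all add: time_change_def)
  have "strict_mono_on {0..} (m \<circ> l)"
  proof (rule strict_mono_onI)
    fix r s :: real
    assume rs: "r \<in> {0..}" "s \<in> {0..}" "r < s"
    then have "l r \<in> {0..}" "l s \<in> {0..}"
      using imageI[of r "{0..}" l] imageI[of s "{0..}" l] unfolding l(2) by simp_all
    moreover have "l r < l s" using l(1) rs by (rule strict_mono_onD)
    ultimately show "(m \<circ> l) r < (m \<circ> l) s"
      unfolding o_def by (rule strict_mono_onD[OF m(1)])
  qed
  moreover have "(m \<circ> l) ` {0..} = {0..}"
    by (simp only: image_comp[symmetric] l(2) m(2))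
  ultimately show ?thesis by (simp add: time_change_def)
qed

lemma skorohod_nbhd_triangle:
  assumes z: "z \<in> skorohod_nbhd y T d" and w: "w \<in> skorohod_nbhd z (T + d) e"
  shows "w \<in> skorohod_nbhd y T (d + e)"
proof -
  obtain l where l: "time_change l" "\<And>s. s \<ge> 0 \<Longrightarrow> \<bar>l s - s\<bar> < d"
    "\<And>s. s \<in> {0..T} \<Longrightarrow> dist (path_of z (l s)) (path_of y s) < d"
    using z by (auto simp: skorohod_nbhd_def)
  obtain m where m: "time_change m" "\<And>s. s \<ge> 0 \<Longrightarrow> \<bar>m s - s\<bar> < e"
    "\<And>s. s \<in> {0..T + d} \<Longrightarrow> dist (path_of w (m s)) (path_of z s) < e"
    using w by (auto simp: skorohod_nbhd_def)
  have pos: "l s \<ge> 0" if "s \<ge> 0" for s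
    using l(1) that by (auto simp: time_change_def)
  show ?thesis
    unfolding skorohod_nbhd_def
  proof (intro CollectI exI[of _ "m \<circ> l"] conjI allI ballI impI)
    show "time_change (m \<circ> l)" using l(1) m(1) by (rule time_change_comp)
  next
    fix s :: real assume s: "0 \<le> s"
    show "\<bar>(m \<circ> l) s - s\<bar> < d + e"
      using l(2)[OF s] m(2)[OF pos[OF s]] by (auto simp: o_def)
  next
    fix s assume s: "s \<in> {0..T}"
    have "l s \<in> {0..T + d}" using s l(2)[of s] pos[of s] by auto
    from m(3)[OF this] l(3)[OF s]
    have "dist (path_of w (m (l s))) (path_of z (l s)) < e" "dist (path_of z (l s)) (path_of y s) < d" .
    then show "dist (path_of w ((m \<circ> l) s)) (path_of y s) < d + e"
      unfolding o_def by (smt (verit) dist_triangle)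
  qed
qed

lemma skorohod_nbhd_contains_open:
  assumes "e > 0"
  shows "\<exists>U. open U \<and> x \<in> U \<and> U \<subseteq> skorohod_nbhd x T e"
proof -
  define U where "U = {y. \<exists>S. \<exists>d>0. skorohod_nbhd y S d \<subseteq> skorohod_nbhd x T e}"
  have "open U"
    unfolding open_skorohod_def
  proof
    fix y assume "y \<in> U"
    then obtain S d where d: "d > 0" "skorohod_nbhd y S d \<subseteq> skorohod_nbhd x T e"
      by (auto simp: U_def)
    have "z \<in> U" if z: "z \<in> skorohod_nbhd y S (d/2)" for z
    proof -
      have "skorohod_nbhd z (S + d/2) (d/2) \<subseteq> skorohod_nbhd x T e"
        using skorohod_nbhd_triangle[OF z] d(2) by fastforce
      then show ?thesis using d(1) half_gt_zero unfolding U_def by blast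
    qed
    then show "\<exists>T. \<exists>e>0. skorohod_nbhd y T e \<subseteq> U"
      using d(1) by (intro exI[of _ S] exI[of _ "d/2"]) auto
  qed
  moreover have "x \<in> U" using assms unfolding U_def by auto
  moreover have "U \<subseteq> skorohod_nbhd x T e" unfolding U_def using skorohod_nbhd_self by blast
  ultimately show ?thesis by blast
qed

lemma tendsto_skorohod_iff:
  "(f \<longlongrightarrow> x) F \<longleftrightarrow> (\<forall>T. \<forall>e>0. eventually (\<lambda>n. f n \<in> skorohod_nbhd x T e) F)"
proof
  assume *: "(f \<longlongrightarrow> x) F"
  show "\<forall>T. \<forall>e>0. eventually (\<lambda>n. f n \<in> skorohod_nbhd x T e) F"
  proof (intro allI impI)
    fix T e :: real assume "e > 0"
    then obtain U where "open U" "x \<in> U" "U \<subseteq> skorohod_nbhd x T e"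
      using skorohod_nbhd_contains_open by blast
    then show "eventually (\<lambda>n. f n \<in> skorohod_nbhd x T e) F"
      using topological_tendstoD[OF *, of U]
        eventually_mono[of "\<lambda>n. f n \<in> U" F "\<lambda>n. f n \<in> skorohod_nbhd x T e"] by blast
  qed
next
  assume *: "\<forall>T. \<forall>e>0. eventually (\<lambda>n. f n \<in> skorohod_nbhd x T e) F"
  show "(f \<longlongrightarrow> x) F"
  proof (rule topological_tendstoI)
    fix U assume "open U" "x \<in> U"
    then obtain T e where "e > 0" "skorohod_nbhd x T e \<subseteq> U"
      unfolding open_skorohod_def by blast
    then show "eventually (\<lambda>n. f n \<in> U) F"
      using eventually_mono[of "\<lambda>n. f n \<in> skorohod_nbhd x T e" F "\<lambda>n. f n \<in> U"] * by blast
  qed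
qed

lemma LIMSEQ_skorohod_iff:
  "f \<longlonglongrightarrow> x \<longleftrightarrow>
     (\<exists>l. (\<forall>n. time_change (l n)) \<and> uniform_limit {0..} l (\<lambda>s. s) sequentially \<and>
        (\<forall>T. uniform_limit {0..T} (\<lambda>n s. path_of (f n) (l n s)) (path_of x) sequentially))"
proof
  assume "\<exists>l. (\<forall>n. time_change (l n)) \<and> uniform_limit {0..} l (\<lambda>s. s) sequentially \<and>
        (\<forall>T. uniform_limit {0..T} (\<lambda>n s. path_of (f n) (l n s)) (path_of x) sequentially)"
  then obtain l where l: "\<And>n. time_change (l n)" "uniform_limit {0..} l (\<lambda>s. s) sequentially"
    "\<And>T. uniform_limit {0..T} (\<lambda>n s. path_of (f n) (l n s)) (path_of x) sequentially" by blast
  show "f \<longlonglongrightarrow> x"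
    unfolding tendsto_skorohod_iff
  proof (intro allI impI)
    fix T e :: real assume e: "e > 0"
    have "eventually (\<lambda>n. \<forall>s\<in>{0..}. dist (l n s) s < e) sequentially"
      using l(2) e by (simp add: uniform_limit_iff)
    moreover have "eventually (\<lambda>n. \<forall>s\<in>{0..T}. dist (path_of (f n) (l n s)) (path_of x s) < e) sequentially"
      using l(3)[of T] e by (simp add: uniform_limit_iff)
    ultimately show "eventually (\<lambda>n. f n \<in> skorohod_nbhd x T e) sequentially"
      by eventually_elim (use l(1) in \<open>auto simp: skorohod_nbhd_def dist_real_def\<close>)
  qed
next
  assume lim: "f \<longlonglongrightarrow> x"
  define good where "good k l n \<longleftrightarrow> time_change l \<and> (\<forall>s\<ge>0. \<bar>l s - s\<bar> < 1 / real (Suc k)) \<and>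
     (\<forall>s\<in>{0..real k}. dist (path_of (f n) (l s)) (path_of x s) < 1 / real (Suc k))"
    for k n :: nat and l
  define A where "A n = {k. k \<le> n \<and> (\<exists>l. good k l n)}" for n
  have fin: "finite (A n)" for n unfolding A_def by simp
  have "\<exists>l. time_change l \<and> (A n \<noteq> {} \<longrightarrow> good (Max (A n)) l n)" for n
  proof (cases "A n = {}")
    case True then show ?thesis using time_change_id by blast
  next
    case False
    then have "Max (A n) \<in> A n" using fin by (rule Max_in[rotated])
    then show ?thesis unfolding A_def good_def by blast
  qed
  then obtain l where l: "\<And>n. time_change (l n)" "\<And>n. A n \<noteq> {} \<Longrightarrow> good (Max (A n)) (l n) n"
    by metis
  have key: "eventually (\<lambda>n. (\<forall>s\<ge>0. \<bar>l n s - s\<bar> < e) \<and>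
      (\<forall>s\<in>{0..T}. dist (path_of (f n) (l n s)) (path_of x s) < e)) sequentially"
    if e: "e > 0" for T e :: real
  proof -
    obtain k1 where k1: "1 / real (Suc k1) < e" using e nat_approx_posE by blast
    obtain k2 where k2: "T \<le> real k2" using real_arch_simple by blast
    define k where "k = max k1 k2"
    have "eventually (\<lambda>n. f n \<in> skorohod_nbhd x (real k) (1 / real (Suc k))) sequentially"
      using lim unfolding tendsto_skorohod_iff by simp
    then show ?thesis using eventually_ge_at_top[of k]
    proof eventually_elim
      case (elim n)
      have "k \<in> A n" using elim by (auto simp: A_def good_def skorohod_nbhd_def)
      then have ge: "k \<le> Max (A n)" and g: "good (Max (A n)) (l n) n"
        using fin[of n] l(2)[of n] by auto
      have "1 / real (Suc (Max (A n))) \<le> 1 / real (Suc k1)"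
        using ge unfolding k_def by (intro divide_left_mono) auto
      then have "1 / real (Suc (Max (A n))) < e" using k1 by linarith
      moreover have "T \<le> real (Max (A n))" using ge k2 unfolding k_def by linarith
      ultimately show ?case using g unfolding good_def
        by (meson atLeastAtMost_iff order_trans less_trans)
    qed
  qed
  show "\<exists>l. (\<forall>n. time_change (l n)) \<and> uniform_limit {0..} l (\<lambda>s. s) sequentially \<and>
        (\<forall>T. uniform_limit {0..T} (\<lambda>n s. path_of (f n) (l n s)) (path_of x) sequentially)"
  proof (intro exI[of _ l] conjI allI)
    show "time_change (l n)" for n by (rule l(1))
    show "uniform_limit {0..} l (\<lambda>s. s) sequentially"
      unfolding uniform_limit_iff
    proof (intro allI impI)
      fix e :: real assume "e > 0"
      from key[OF this, of 0] show "eventually (\<lambda>n. \<forall>s\<in>{0..}. dist (l n s) s < e) sequentially"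
        by eventually_elim (auto simp: dist_real_def)
    qed
    show "uniform_limit {0..T} (\<lambda>n s. path_of (f n) (l n s)) (path_of x) sequentially" for T
      unfolding uniform_limit_iff
    proof (intro allI impI)
      fix e :: real assume "e > 0"
      from key[OF this, of T]
      show "eventually (\<lambda>n. \<forall>s\<in>{0..T}. dist (path_of (f n) (l n s)) (path_of x s) < e) sequentially"
        by eventually_elim auto
    qed
  qed
qed

text \<open>
  Convergence in distribution for random elements, i.e. Borel measurable maps, of a topological
  space. The Borel sigma-algebra of a Skorohod space over a Euclidean space is generated by the
  evaluations, so a random element of such a space is the same as a process with trajectories in it.
\<close>

definition converges_in_distribution ::
    "'w measure \<Rightarrow> (nat \<Rightarrow> 'w \<Rightarrow> 'b::topological_space) \<Rightarrow> ('w \<Rightarrow> 'b) \<Rightarrow> bool" where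
  "converges_in_distribution M X Y \<longleftrightarrow>
     (\<forall>n. X n \<in> borel_measurable M) \<and> Y \<in> borel_measurable M \<and>
     (\<forall>f :: 'b \<Rightarrow> real. continuous_on UNIV f \<and> bounded (range f) \<longrightarrow>
        (\<lambda>n. \<integral>\<omega>. f (X n \<omega>) \<partial>M) \<longlonglongrightarrow> (\<integral>\<omega>. f (Y \<omega>) \<partial>M))"


section \<open>Matrices and the Skorohod problem in the orthant\<close>

definition orthant :: "(real^'k::finite) set" where
  "orthant = {x. \<forall>i. 0 \<le> x $ i}"

definition substochastic :: "real^'k^'k::finite \<Rightarrow> bool" where
  "substochastic P \<longleftrightarrow> (\<forall>i j. 0 \<le> P $ i $ j) \<and> (\<forall>i. (\<Sum>j\<in>UNIV. P $ i $ j) \<le> 1)"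

definition spectral_radius :: "real^'k^'k::finite \<Rightarrow> real" where
  "spectral_radius A = Sup {cmod z | z. \<exists>v :: complex^'k. v \<noteq> 0 \<and>
     (\<chi> i j. complex_of_real (A $ i $ j)) *v v = z *s v}"

definition reflection_matrix :: "real^'k^'k::finite \<Rightarrow> real^'k^'k" where
  "reflection_matrix P = mat 1 - transpose P"

text \<open>
  In the last condition, \<open>interval_measure\<close> is the Lebesgue-Stieltjes measure; \<open>path_of \<eta>\<close> is
  constant on \<open>(-\<infinity>,0]\<close>, so there is no mass at 0.
\<close>

definition skorohod_problem ::
    "real^'k^'k \<Rightarrow> (real^'k::finite) skorohod \<Rightarrow> (real^'k) skorohod \<Rightarrow> (real^'k) skorohod \<Rightarrow> bool" where
  "skorohod_problem R \<psi> \<phi> \<eta> \<longleftrightarrow>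
     (\<forall>t\<ge>0. path_of \<phi> t = path_of \<psi> t + R *v path_of \<eta> t \<and> path_of \<phi> t \<in> orthant) \<and>
     (\<forall>i. path_of \<eta> 0 $ i = 0 \<and> mono_on {0..} (\<lambda>t. path_of \<eta> t $ i) \<and>
        (\<integral>\<^sup>+s\<in>{0..}. indicator {s. path_of \<phi> s $ i \<noteq> 0} s
            \<partial>interval_measure (\<lambda>t. path_of \<eta> t $ i)) = 0)"

definition skorohod_map ::
    "real^'k^'k \<Rightarrow> (real^'k::finite) skorohod \<Rightarrow> (real^'k) skorohod" where
  "skorohod_map R \<psi> = (THE \<phi>. \<exists>\<eta>. skorohod_problem R \<psi> \<phi> \<eta>)"


section \<open>The queueing network\<close>

text \<open>
  In the next four definitions the arguments are trajectories, for one fixed \<open>n\<close> and one fixed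
  outcome.
\<close>

definition arrivals ::
    "(real^'k \<Rightarrow> real^'k) \<Rightarrow> ('k \<Rightarrow> real skorohod) \<Rightarrow> (real^'k::finite) skorohod \<Rightarrow> 'k \<Rightarrow> real \<Rightarrow> real" where
  "arrivals lam NA Q i t = path_of (NA i) (LBINT s:{0..t}. lam (path_of Q s) $ i)"

definition departures ::
    "(real^'k \<Rightarrow> real^'k) \<Rightarrow> ('k \<Rightarrow> real skorohod) \<Rightarrow> (real^'k::finite) skorohod \<Rightarrow> 'k \<Rightarrow> real \<Rightarrow> real" where
  "departures mu ND Q i t = path_of (ND i)
     (LBINT s:{0..t}. mu (path_of Q s) $ i * indicator {s. path_of Q s $ i > 0} s)"

definition internal_arrivals ::
    "(real^'k \<Rightarrow> real^'k) \<Rightarrow> ('k \<Rightarrow> real skorohod) \<Rightarrow> ('k \<Rightarrow> 'k \<Rightarrow> nat \<Rightarrow> nat) \<Rightarrow>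
      (real^'k::finite) skorohod \<Rightarrow> 'k \<Rightarrow> real \<Rightarrow> real" where
  "internal_arrivals mu ND Phi Q i t =
     (\<Sum>j\<in>UNIV. real (Phi j i (nat \<lfloor>departures mu ND Q j t\<rfloor>)))"

definition queue_equation ::
    "(real^'k \<Rightarrow> real^'k) \<Rightarrow> (real^'k \<Rightarrow> real^'k) \<Rightarrow> ('k \<Rightarrow> real skorohod) \<Rightarrow> ('k \<Rightarrow> real skorohod) \<Rightarrow>
      ('k \<Rightarrow> 'k \<Rightarrow> nat \<Rightarrow> nat) \<Rightarrow> (real^'k::finite) skorohod \<Rightarrow> bool" where
  "queue_equation lam mu NA ND Phi Q \<longleftrightarrow> (\<forall>t\<ge>0. \<forall>i.
     path_of Q t $ i = path_of Q 0 $ i + arrivals lam NA Q i t + internal_arrivals mu ND Phi Q i t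
       - departures mu ND Q i t)"

definition counting_process :: "'w measure \<Rightarrow> ('w \<Rightarrow> real skorohod) \<Rightarrow> bool" where
  "counting_process M N \<longleftrightarrow> N \<in> borel_measurable M \<and>
     (\<forall>\<omega>\<in>space M. path_of (N \<omega>) 0 = 0 \<and> mono_on {0..} (path_of (N \<omega>)) \<and>
        (\<forall>t\<ge>0. path_of (N \<omega>) t \<in> \<nat>))"

definition routing_process :: "'w measure \<Rightarrow> ('k::finite \<Rightarrow> 'k \<Rightarrow> 'w \<Rightarrow> nat \<Rightarrow> nat) \<Rightarrow> bool" where
  "routing_process M Phi \<longleftrightarrow>
     (\<forall>i j m. (\<lambda>\<omega>. Phi i j \<omega> m) \<in> measurable M (count_space UNIV)) \<and>
     (\<forall>\<omega>\<in>space M. \<forall>i.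
        (\<forall>j. Phi i j \<omega> 0 = 0 \<and> (\<forall>m. int (Phi i j \<omega> (Suc m)) - int (Phi i j \<omega> m) \<in> {0, 1})) \<and>
        (\<forall>m. (\<Sum>j\<in>UNIV. int (Phi i j \<omega> (Suc m)) - int (Phi i j \<omega> m)) \<le> 1))"

definition scaled_counting :: "nat \<Rightarrow> ('k \<Rightarrow> real skorohod) \<Rightarrow> (real^'k::finite) skorohod" where
  "scaled_counting n N =
     to_skorohod (\<lambda>t. \<chi> i. (path_of (N i) (real n * t) - real n * t) / sqrt (real n))"

definition scaled_routing ::
    "nat \<Rightarrow> real^'k^'k \<Rightarrow> ('k \<Rightarrow> 'k \<Rightarrow> nat \<Rightarrow> nat) \<Rightarrow> (real^'k^'k::finite) skorohod" where
  "scaled_routing n P Phi =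
     to_skorohod (\<lambda>t. \<chi> i j. (real (Phi i j (nat \<lfloor>real n * t\<rfloor>)) - P $ i $ j * real n * t) / sqrt (real n))"

definition scaled_queue :: "nat \<Rightarrow> (real^'k::finite) skorohod \<Rightarrow> (real^'k) skorohod" where
  "scaled_queue n Q = to_skorohod (\<lambda>t. path_of Q t /\<^sub>R sqrt (real n))"

text \<open>The process driving the limit equation; \<open>l0\<close> and \<open>m0\<close> are the limiting rates at the origin.\<close>

definition limit_noise ::
    "real^'k^'k \<Rightarrow> real^'k \<Rightarrow> real^'k \<Rightarrow> (real^'k) skorohod \<Rightarrow> (real^'k) skorohod \<Rightarrow>
      (real^'k^'k) skorohod \<Rightarrow> real \<Rightarrow> real^'k::finite" where
  "limit_noise P l0 m0 WA WD WPhi t = (\<chi> i.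
     path_of WA (l0 $ i * t) $ i
     + (\<Sum>j\<in>UNIV. path_of WPhi (m0 $ j * t) $ j $ i)
     - (\<Sum>j\<in>UNIV. ((if i = j then 1 else 0) - P $ j $ i) * path_of WD (m0 $ j * t) $ j))"

end

theory Submission
  imports Defs
begin

text \<open>
  On the diffusion scale the queue lengths solve a Skorohod problem: with \<open>R = I - P\<^sup>T\<close>,
  \<open>Q\<^sup>n / \<surd>n = Q\<^sup>n(0) / \<surd>n + M\<^sup>n + \<integral> (\<lambda>\<^sup>n - R \<mu>\<^sup>n)(Q\<^sup>n) / \<surd>n + R Y\<^sup>n\<close>, where \<open>Y\<^sup>n\<close> collects the service
  lost while queues are empty and \<open>M\<^sup>n\<close> is made of the scaled primitives, evaluated at random times. A
  bound on the total arrivals and the linear growth of the rates make these times bounded; on the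
  fluid scale the noise is then negligible and the traffic equation cancels the drift, so that
  \<open>Q\<^sup>n / n\<close> and \<open>Y\<^sup>n / \<surd>n\<close> vanish by the Lipschitz continuity of the Skorohod map. Hence the random
  times become linear, \<open>M\<^sup>n\<close> converges, and Gronwall's inequality compares \<open>Q\<^sup>n / \<surd>n\<close> with \<open>X\<close>.
  All of this is pathwise: whenever primitives of networks with indices \<open>n\<^sub>k \<rightarrow> \<infinity>\<close> converge, so do
  the queues. A version of the continuous mapping theorem for such relations (in place of a Skorohod
  representation) turns it into convergence in distribution.
\<close>

section \<open>Convergence in distribution\<close>

lemma closed_limsup_measure:
  fixes Z :: "nat \<Rightarrow> 'w \<Rightarrow> 'b::topological_space"
  assumes "prob_space M" and conv: "converges_in_distribution M Z W"
    and met: "metrizable_space (euclidean :: 'b topology)" and C: "closed C" and "e > 0"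
  shows "\<forall>\<^sub>F n in sequentially. measure M {\<omega>\<in>space M. Z n \<omega> \<in> C} \<le> measure M {\<omega>\<in>space M. W \<omega> \<in> C} + e"
proof -
  interpret prob_space M by fact
  obtain S d where d: "Metric_space S d" "Metric_space.mtopology S d = (euclidean :: 'b topology)"
    using met unfolding metrizable_space_def by metis
  interpret D: Metric_space S d by fact
  have S: "S = UNIV" using d(2) D.topspace_mtopology by simp
  have [measurable]: "Z n \<in> borel_measurable M" "W \<in> borel_measurable M" for n
    using conv by (auto simp: converges_in_distribution_def)
  define U where "U j = (\<Union>x\<in>C. D.mball x (1 / real (Suc j)))" for j
  have oU: "open (U j)" for j
    unfolding U_def using D.openin_mball d(2) by (intro open_UN) auto
  have CU: "C \<subseteq> U j" for j
    unfolding U_def using S D.centre_in_mball_iff[of _ "1 / real (Suc j)"] by (intro subsetI UN_I) auto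
  have U_dec: "decseq U"
  proof (rule decseq_SucI)
    show "U (Suc n) \<le> U n" for n
      unfolding U_def by (intro UN_mono order_refl D.mball_subset_concentric) (simp add: field_simps)
  qed
  have U_Int: "(\<Inter>j. U j) = C"
  proof
    show "(\<Inter>j. U j) \<subseteq> C"
    proof
      fix y assume y: "y \<in> (\<Inter>j. U j)"
      have "y \<in> D.mtopology closure_of C"
        unfolding D.metric_closure_of
      proof (intro CollectI conjI allI impI)
        show "y \<in> S" using S by simp
        fix r :: real assume "r > 0"
        then obtain j where "1 / real (Suc j) < r" using nat_approx_posE by blast
        moreover obtain x where "x \<in> C" "d x y < 1 / real (Suc j)" using y unfolding U_def by auto
        ultimately have "d y x < r" using D.commute[of y x] by linarith
        moreover have "x \<in> S" "y \<in> S" by (simp_all add: S)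
        ultimately show "\<exists>x\<in>C. x \<in> D.mball y r" using \<open>x \<in> C\<close> D.in_mball by blast
      qed
      then show "y \<in> C" using C d(2) by (simp add: closure_of_closedin closed_closedin[symmetric])
    qed
  qed (use CU in blast)
  have meas: "{\<omega>\<in>space M. W \<omega> \<in> A} \<in> sets M" "{\<omega>\<in>space M. Z n \<omega> \<in> A} \<in> sets M" if "A \<in> sets borel" for A n
    using that by measurable
  have mU: "{\<omega>\<in>space M. W \<omega> \<in> U j} \<in> sets M" and mC: "{\<omega>\<in>space M. Z n \<omega> \<in> C} \<in> sets M" for n j
    by (intro meas borel_open oU borel_closed C)+
  have "(\<lambda>j. measure M {\<omega>\<in>space M. W \<omega> \<in> U j}) \<longlonglongrightarrow> measure M (\<Inter>j. {\<omega>\<in>space M. W \<omega> \<in> U j})"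
    using U_dec oU by (intro finite_Lim_measure_decseq) (auto simp: decseq_def intro!: meas)
  also have "(\<Inter>j. {\<omega>\<in>space M. W \<omega> \<in> U j}) = {\<omega>\<in>space M. W \<omega> \<in> C}" using U_Int by auto
  finally have "\<forall>\<^sub>F j in sequentially. measure M {\<omega>\<in>space M. W \<omega> \<in> U j} < measure M {\<omega>\<in>space M. W \<omega> \<in> C} + e"
    by (rule order_tendstoD(2)) (use \<open>e > 0\<close> in simp)
  then obtain j where j: "measure M {\<omega>\<in>space M. W \<omega> \<in> U j} < measure M {\<omega>\<in>space M. W \<omega> \<in> C} + e"
    using eventually_happens'[OF sequentially_bot] by blast
  have "normal_space (euclidean :: 'b topology)" using met by (rule metrizable_imp_normal_space)
  moreover have "closed (- U j)" "- U j \<inter> C = {}" using oU[of j] CU[of j] by auto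
  ultimately obtain f where f: "continuous_map (euclidean :: 'b topology) (top_of_set {0..1::real}) f"
      "f ` (- U j) \<subseteq> {0}" "f ` C \<subseteq> {1}"
    using Urysohn_lemma[of "euclidean :: 'b topology" "- U j" C 0 1] C
    by (auto simp: disjnt_def closed_closedin[symmetric])
  have fc: "continuous_on UNIV f" and fr: "\<And>x. f x \<in> {0..1}"
    using f(1) by (auto simp: continuous_map_in_subtopology Pi_iff)
  have [measurable]: "f \<in> borel_measurable borel" using fc by (rule borel_measurable_continuous_onI)
  have "bounded (range f)" using fr by (intro boundedI[where B=1]) auto
  then have "(\<lambda>n. \<integral>\<omega>. f (Z n \<omega>) \<partial>M) \<longlonglongrightarrow> (\<integral>\<omega>. f (W \<omega>) \<partial>M)"
    using conv fc unfolding converges_in_distribution_def by blast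
  moreover have int: "integrable M (\<lambda>\<omega>. f (g \<omega>))" if "g \<in> borel_measurable M" for g
    using fr that by (intro integrable_const_bound[where B=1]) auto
  have "(\<integral>\<omega>. f (W \<omega>) \<partial>M) \<le> (\<integral>\<omega>. indicator {\<omega>\<in>space M. W \<omega> \<in> U j} \<omega> \<partial>M)"
  proof (rule integral_mono)
    show "f (W \<omega>) \<le> indicator {\<omega>\<in>space M. W \<omega> \<in> U j} \<omega>" if "\<omega> \<in> space M" for \<omega>
      using f(2) fr[of "W \<omega>"] that by (auto simp: indicator_def)
  qed (use int mU in \<open>auto intro!: integrable_real_indicator simp: less_top[symmetric]\<close>)
  then have "(\<integral>\<omega>. f (W \<omega>) \<partial>M) < measure M {\<omega>\<in>space M. W \<omega> \<in> C} + e"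
    using j by (simp add: Int_def cong: conj_cong)
  ultimately have "\<forall>\<^sub>F n in sequentially. (\<integral>\<omega>. f (Z n \<omega>) \<partial>M) < measure M {\<omega>\<in>space M. W \<omega> \<in> C} + e"
    by (rule order_tendstoD(2))
  then show ?thesis
  proof eventually_elim
    case (elim n)
    have "(\<integral>\<omega>. indicator {\<omega>\<in>space M. Z n \<omega> \<in> C} \<omega> \<partial>M) \<le> (\<integral>\<omega>. f (Z n \<omega>) \<partial>M)"
    proof (rule integral_mono)
      show "indicator {\<omega>\<in>space M. Z n \<omega> \<in> C} \<omega> \<le> f (Z n \<omega>)" if "\<omega> \<in> space M" for \<omega>
        using f(3) fr[of "Z n \<omega>"] that by (auto simp: indicator_def)
    qed (use int mC in \<open>auto intro!: integrable_real_indicator simp: less_top[symmetric]\<close>)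
    then show ?case using elim by (simp add: Int_def cong: conj_cong)
  qed
qed

lemma real_convergence_of_closed_limsup:
  fixes Y :: "'w \<Rightarrow> real"
  assumes "prob_space M" and [measurable]: "\<And>n. Yn n \<in> borel_measurable M" "Y \<in> borel_measurable M"
    and bnd: "\<And>n \<omega>. \<omega> \<in> space M \<Longrightarrow> \<bar>Yn n \<omega>\<bar> \<le> B" "\<And>\<omega>. \<omega> \<in> space M \<Longrightarrow> \<bar>Y \<omega>\<bar> \<le> B"
    and lim: "\<And>C e. closed C \<Longrightarrow> e > 0 \<Longrightarrow> \<forall>\<^sub>F n in sequentially.
      measure M {\<omega>\<in>space M. Yn n \<omega> \<in> C} \<le> measure M {\<omega>\<in>space M. Y \<omega> \<in> C} + e"
  shows "(\<lambda>n. \<integral>\<omega>. Yn n \<omega> \<partial>M) \<longlonglongrightarrow> (\<integral>\<omega>. Y \<omega> \<partial>M)"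
proof -
  interpret prob_space M by fact
  define \<mu> where "\<mu> n = distr M borel (Yn n)" for n
  define \<nu> where "\<nu> = distr M borel Y"
  have rd: "real_distribution (\<mu> n)" for n unfolding \<mu>_def by (rule real_distribution_distr) simp
  have rd': "real_distribution \<nu>" unfolding \<nu>_def by (rule real_distribution_distr) simp
  interpret N: real_distribution \<nu> by (rule rd')
  have mm: "measure (\<mu> n) A = measure M {\<omega>\<in>space M. Yn n \<omega> \<in> A}"
     "measure \<nu> A = measure M {\<omega>\<in>space M. Y \<omega> \<in> A}" if "A \<in> sets borel" for n A
    using that by (auto simp: \<mu>_def \<nu>_def measure_distr intro!: arg_cong[where f="measure M"])
  have "weak_conv_m \<mu> \<nu>"
    unfolding weak_conv_m_def weak_conv_def
  proof (intro allI impI)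
    fix x assume "isCont (cdf \<nu>) x"
    then have x: "measure \<nu> {x} = 0" by (simp add: N.isCont_cdf)
    show "(\<lambda>n. cdf (\<mu> n) x) \<longlonglongrightarrow> cdf \<nu> x"
      unfolding LIMSEQ_def dist_real_def
    proof (intro allI impI)
      fix e :: real assume "e > 0"
      then have e2: "e/2 > 0" by simp
      have "\<forall>\<^sub>F n in sequentially. measure (\<mu> n) {..x} \<le> measure \<nu> {..x} + e/2"
        using lim[of "{..x}" "e/2"] e2 by (simp add: mm)
      moreover have "\<forall>\<^sub>F n in sequentially. measure (\<mu> n) {x..} \<le> measure \<nu> {x..} + e/2"
        using lim[of "{x..}" "e/2"] e2 by (simp add: mm)
      moreover have n1: "measure (\<mu> n) {x..} \<ge> 1 - measure (\<mu> n) {..x}" for n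
      proof -
        interpret R: real_distribution "\<mu> n" by (rule rd)
        have "1 = measure (\<mu> n) ({x..} \<union> {..x})"
          using R.prob_space by (simp add: ivl_disj_un_two_touch Un_commute) (metis R.space_eq_univ UNIV_I UNIV_eq_I Un_iff atLeast_iff atMost_iff linear)
        also have "\<dots> \<le> measure (\<mu> n) {x..} + measure (\<mu> n) {..x}" by (rule measure_subadditive) (auto simp: less_top[symmetric])
        finally show ?thesis by simp
      qed
      moreover have "measure \<nu> {x..} = 1 - measure \<nu> {..x}"
      proof -
        have "measure \<nu> {x..} = measure \<nu> ({x<..} \<union> {x})" by (intro arg_cong[where f="measure \<nu>"]) auto
        also have "\<dots> = measure \<nu> {x<..}" using x by (subst N.finite_measure_Union) auto
        also have "{x<..} = space \<nu> - {..x}" by auto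
        finally show ?thesis by (subst (asm) N.prob_compl) auto
      qed
      ultimately have "\<forall>\<^sub>F n in sequentially. \<bar>cdf (\<mu> n) x - cdf \<nu> x\<bar> < e"
        unfolding cdf_def by (smt (verit, best) \<open>e > 0\<close> eventually_elim2 field_sum_of_halves)
      then show "\<exists>no. \<forall>n\<ge>no. \<bar>cdf (\<mu> n) x - cdf \<nu> x\<bar> < e" by (simp add: eventually_sequentially)
    qed
  qed
  define g where "g y = max (- \<bar>B\<bar>) (min \<bar>B\<bar> y)" for y :: real
  have gc: "isCont g y" for y unfolding g_def by (intro continuous_intros)
  have [measurable]: "g \<in> borel_measurable borel"
    using gc by (intro borel_measurable_continuous_onI continuous_at_imp_continuous_on) auto
  have "norm (g y) \<le> \<bar>B\<bar>" for y unfolding g_def by auto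
  from weak_conv_imp_integral_bdd_continuous_conv[OF rd rd' \<open>weak_conv_m \<mu> \<nu>\<close> gc this]
  have "(\<lambda>n. \<integral>\<omega>. g (Yn n \<omega>) \<partial>M) \<longlonglongrightarrow> (\<integral>\<omega>. g (Y \<omega>) \<partial>M)"
    unfolding \<mu>_def \<nu>_def by (simp add: integral_distr)
  moreover have "(\<integral>\<omega>. g (Yn n \<omega>) \<partial>M) = (\<integral>\<omega>. Yn n \<omega> \<partial>M)" for n
    using bnd(1)[of _ n] by (intro Bochner_Integration.integral_cong) (force simp: g_def)+
  moreover have "(\<integral>\<omega>. g (Y \<omega>) \<partial>M) = (\<integral>\<omega>. Y \<omega> \<partial>M)"
    using bnd(2) by (intro Bochner_Integration.integral_cong) (force simp: g_def)+
  ultimately show ?thesis by simp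
qed

text \<open>
  No limit map is needed. For closed \<open>C\<close>, if \<open>K m\<close> is the closure of the values of \<open>Z n\<close>, \<open>n \<ge> m\<close>, at
  outcomes with \<open>f (Xn n) \<in> C\<close>, then \<open>W \<in> K m\<close> for all \<open>m\<close> forces \<open>f X \<in> C\<close>.
\<close>

lemma extended_continuous_mapping:
  fixes Z :: "nat \<Rightarrow> 'w \<Rightarrow> 'b::topological_space" and Xn :: "nat \<Rightarrow> 'w \<Rightarrow> 'c::topological_space"
  assumes "prob_space M" and conv: "converges_in_distribution M Z W"
    and met: "metrizable_space (euclidean :: 'b topology)"
    and Xn: "\<And>n. Xn n \<in> borel_measurable M" and X: "X \<in> borel_measurable M"
    and good: "\<And>n. n \<ge> 1 \<Longrightarrow> AE \<omega> in M. good n \<omega>"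
    and key: "AE \<omega> in M. \<forall>r \<omega>'. filterlim r at_top sequentially \<longrightarrow>
       (\<forall>k. r k \<ge> 1 \<and> \<omega>' k \<in> space M \<and> good (r k) (\<omega>' k)) \<longrightarrow>
       (\<lambda>k. Z (r k) (\<omega>' k)) \<longlonglongrightarrow> W \<omega> \<longrightarrow> (\<lambda>k. Xn (r k) (\<omega>' k)) \<longlonglongrightarrow> X \<omega>"
  shows "converges_in_distribution M Xn X"
  unfolding converges_in_distribution_def
proof (intro conjI allI impI Xn X)
  interpret prob_space M by fact
  fix f :: "'c \<Rightarrow> real" assume f: "continuous_on UNIV f \<and> bounded (range f)"
  then have [measurable]: "f \<in> borel_measurable borel" by (auto intro: borel_measurable_continuous_onI)
  note [measurable] = Xn X
  have [measurable]: "Z n \<in> borel_measurable M" "W \<in> borel_measurable M" for n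
    using conv by (auto simp: converges_in_distribution_def)
  obtain B where B: "\<And>x. \<bar>f x\<bar> \<le> B" using f by (auto simp: bounded_iff)
  show "(\<lambda>n. \<integral>\<omega>. f (Xn n \<omega>) \<partial>M) \<longlonglongrightarrow> (\<integral>\<omega>. f (X \<omega>) \<partial>M)"
  proof (rule real_convergence_of_closed_limsup[OF \<open>prob_space M\<close>, where B=B])
    fix C :: "real set" and e :: real assume C: "closed C" and e: "e > 0"
    have C' [measurable]: "C \<in> sets borel" using C by simp
    obtain S d where d: "Metric_space S d" "Metric_space.mtopology S d = (euclidean :: 'b topology)"
      using met unfolding metrizable_space_def by metis
    interpret D: Metric_space S d by fact
    have S: "S = UNIV" using d(2) D.topspace_mtopology by simp
    have inS: "z \<in> S" for z by (simp add: S)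
    define Bm where "Bm m = {Z n \<omega> |n \<omega>. n \<ge> m \<and> n \<ge> 1 \<and> \<omega> \<in> space M \<and> good n \<omega> \<and> f (Xn n \<omega>) \<in> C}" for m :: nat
    define K where "K m = closure (Bm m)" for m
    have clK: "closed (K m)" for m unfolding K_def by simp
    have K_dec: "decseq K" unfolding K_def decseq_def Bm_def by (intro allI impI closure_mono) (clarsimp, metis order_trans)
    have meas: "{\<omega>\<in>space M. W \<omega> \<in> K m} \<in> sets M" for m
      using borel_closed[OF clK[of m]] by measurable
    have "AE \<omega> in M. W \<omega> \<in> (\<Inter>m. K m) \<longrightarrow> f (X \<omega>) \<in> C"
      using key
    proof eventually_elim
      case (elim \<omega>)
      show ?case
      proof
        assume W: "W \<omega> \<in> (\<Inter>m. K m)"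
        have "\<exists>n \<omega>'. n \<ge> m \<and> n \<ge> 1 \<and> \<omega>' \<in> space M \<and> good n \<omega>' \<and> f (Xn n \<omega>') \<in> C
            \<and> d (Z n \<omega>') (W \<omega>) < 1 / real (Suc m)" for m
        proof -
          have pos: "0 < 1 / real (Suc m)" by simp
          have "W \<omega> \<in> D.mtopology closure_of (Bm m)"
            using W d(2) unfolding K_def by auto
          then obtain y where "y \<in> Bm m" "y \<in> D.mball (W \<omega>) (1 / real (Suc m))"
            unfolding D.metric_closure_of using pos by blast
          then have "y \<in> Bm m" "d y (W \<omega>) < 1 / real (Suc m)"
            using D.commute[of y "W \<omega>"] D.in_mball[of y "W \<omega>" "1 / real (Suc m)"] by auto
          then show ?thesis unfolding Bm_def by blast
        qed
        then obtain r \<omega>' where r: "\<And>m. r m \<ge> m \<and> r m \<ge> 1 \<and> \<omega>' m \<in> space M \<and> good (r m) (\<omega>' m) \<and>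
           f (Xn (r m) (\<omega>' m)) \<in> C \<and> d (Z (r m) (\<omega>' m)) (W \<omega>) < 1 / real (Suc m)" by metis
        have "filterlim r at_top sequentially"
          by (rule filterlim_at_top_mono[OF filterlim_ident]) (use r in simp)
        moreover have "(\<lambda>k. Z (r k) (\<omega>' k)) \<longlonglongrightarrow> W \<omega>"
        proof -
          have "\<exists>N. \<forall>n\<ge>N. d (Z (r n) (\<omega>' n)) (W \<omega>) < \<epsilon>" if "\<epsilon> > 0" for \<epsilon>
          proof -
            obtain N where N: "1 / real (Suc N) < \<epsilon>" using nat_approx_posE[OF \<open>\<epsilon> > 0\<close>] by blast
            have "d (Z (r n) (\<omega>' n)) (W \<omega>) < \<epsilon>" if "n \<ge> N" for n
            proof -
              have "1 / real (Suc n) \<le> 1 / real (Suc N)" using that by (simp add: field_simps)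
              then show ?thesis using r[of n] N by linarith
            qed
            then show ?thesis by blast
          qed
          then have "limitin D.mtopology (\<lambda>k. Z (r k) (\<omega>' k)) (W \<omega>) sequentially"
            unfolding D.limit_metric_sequentially using inS by blast
          then show ?thesis by (simp add: d(2))
        qed
        ultimately have lim: "(\<lambda>k. Xn (r k) (\<omega>' k)) \<longlonglongrightarrow> X \<omega>" using elim[rule_format, of r \<omega>'] r by blast
        have "(\<lambda>k. f (Xn (r k) (\<omega>' k))) \<longlonglongrightarrow> f (X \<omega>)"
          by (rule continuous_on_tendsto_compose[OF conjunct1[OF f] lim]) auto
        then show "f (X \<omega>) \<in> C" by (rule closed_sequentially[OF C, rotated]) (use r in blast)
      qed
    qed
    then have le: "measure M {\<omega>\<in>space M. W \<omega> \<in> (\<Inter>m. K m)} \<le> measure M {\<omega>\<in>space M. f (X \<omega>) \<in> C}"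
      by (intro finite_measure_mono_AE) (auto intro!: measurable)
    have "(\<lambda>m. measure M {\<omega>\<in>space M. W \<omega> \<in> K m}) \<longlonglongrightarrow> measure M (\<Inter>m. {\<omega>\<in>space M. W \<omega> \<in> K m})"
      using K_dec meas by (intro finite_Lim_measure_decseq) (auto simp: decseq_def)
    also have "(\<Inter>m. {\<omega>\<in>space M. W \<omega> \<in> K m}) = {\<omega>\<in>space M. W \<omega> \<in> (\<Inter>m. K m)}" by auto
    finally have "\<forall>\<^sub>F m in sequentially. measure M {\<omega>\<in>space M. W \<omega> \<in> K m} < measure M {\<omega>\<in>space M. W \<omega> \<in> (\<Inter>m. K m)} + e/2"
      by (rule order_tendstoD(2)) (use e in simp)
    then obtain m where m: "measure M {\<omega>\<in>space M. W \<omega> \<in> K m} < measure M {\<omega>\<in>space M. W \<omega> \<in> (\<Inter>m. K m)} + e/2"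
      using eventually_happens'[OF sequentially_bot] by blast
    have "\<forall>\<^sub>F n in sequentially. measure M {\<omega>\<in>space M. Z n \<omega> \<in> K m} \<le> measure M {\<omega>\<in>space M. W \<omega> \<in> K m} + e/2"
      using closed_limsup_measure[OF \<open>prob_space M\<close> conv met clK] e by simp
    then show "\<forall>\<^sub>F n in sequentially.
      measure M {\<omega>\<in>space M. f (Xn n \<omega>) \<in> C} \<le> measure M {\<omega>\<in>space M. f (X \<omega>) \<in> C} + e"
      using eventually_ge_at_top[of "max m 1"]
    proof eventually_elim
      case (elim n)
      have "AE \<omega> in M. good n \<omega>" using good elim by simp
      then have "AE \<omega> in M. f (Xn n \<omega>) \<in> C \<longrightarrow> Z n \<omega> \<in> K m"
        using AE_space
      proof eventually_elim
        case (elim \<omega>')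
        then show ?case using closure_subset[of "Bm m"] \<open>n \<ge> max m 1\<close> unfolding K_def Bm_def by auto
      qed
      moreover have "{\<omega>\<in>space M. Z n \<omega> \<in> K m} \<in> sets M" using borel_closed[OF clK[of m]] by measurable
      ultimately have "measure M {\<omega>\<in>space M. f (Xn n \<omega>) \<in> C} \<le> measure M {\<omega>\<in>space M. Z n \<omega> \<in> K m}"
        by (intro finite_measure_mono_AE) auto
      then show ?case using elim m le by linarith
    qed
  qed (use B in auto)
qed

section \<open>Paths in the Skorohod space\<close>

lemma time_change_inv:
  assumes l: "time_change l" and m_def: "m = inv_into {0..} l"
  shows "time_change m" "\<And>s. s \<ge> 0 \<Longrightarrow> m s \<ge> 0 \<and> l (m s) = s"
proof -
  have mono: "strict_mono_on {0..} l" and img: "l ` {0..} = {0..}" using l by (auto simp: time_change_def)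
  have 1: "m s \<ge> 0 \<and> l (m s) = s" if "s \<ge> 0" for s
    unfolding m_def using that img inv_into_into[of s l "{0..}"] f_inv_into_f[of s l "{0..}"] by auto
  have 2: "m (l s) = s" if "s \<ge> 0" for s
    unfolding m_def using that mono by (intro inv_into_f_f) (auto dest: strict_mono_on_imp_inj_on)
  show "\<And>s. s \<ge> 0 \<Longrightarrow> m s \<ge> 0 \<and> l (m s) = s" by (rule 1)
  show "time_change m"
    unfolding time_change_def
  proof
    show "strict_mono_on {0..} m"
    proof (rule strict_mono_onI, rule ccontr)
      fix r s :: real assume rs: "r \<in> {0..}" "s \<in> {0..}" "r < s" "\<not> m r < m s"
      then have "l (m s) \<le> l (m r)"
        using 1[of r] 1[of s] strict_mono_onD[OF mono, of "m s" "m r"] by (cases "m s = m r") auto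
      then show False using 1[of r] 1[of s] rs by auto
    qed
    have "x \<in> m ` {0..}" if "x \<ge> 0" for x
    proof -
      have "l x \<ge> 0" using img that by auto
      then show ?thesis using 2[OF that] by (metis atLeast_iff imageI)
    qed
    then show "m ` {0..} = {0..}" using 1 by auto
  qed
qed

lemma skorohod_nbhd_sym:
  assumes "y \<in> skorohod_nbhd x T e"
  shows "x \<in> skorohod_nbhd y (T - e) e"
proof -
  obtain l where l: "time_change l" "\<And>s. s \<ge> 0 \<Longrightarrow> \<bar>l s - s\<bar> < e"
    "\<And>s. s \<in> {0..T} \<Longrightarrow> dist (path_of y (l s)) (path_of x s) < e"
    using assms by (auto simp: skorohod_nbhd_def)
  define m where "m = inv_into {0..} l"
  note m = time_change_inv[OF l(1) m_def]
  have 1: "\<bar>m s - s\<bar> < e" if "s \<ge> 0" for s using m(2)[OF that] l(2)[of "m s"] by auto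
  have "dist (path_of x (m s)) (path_of y s) < e" if "s \<in> {0..T - e}" for s
    using m(2)[of s] l(3)[of "m s"] 1[of s] that by (auto simp: dist_commute)
  then show ?thesis using m(1) 1 unfolding skorohod_nbhd_def by blast
qed

lemma path_of_cadlag: "cadlag (path_of x)" and path_of_nonpos: "t \<le> 0 \<Longrightarrow> path_of x t = path_of x 0"
  using path_of[of x] by blast+

lemma cadlag_at_right: "cadlag x \<Longrightarrow> t \<ge> 0 \<Longrightarrow> (x \<longlongrightarrow> x t) (at_right t)"
  by (simp add: cadlag_def)

lemma skorohod_const_limit_unique:
  assumes "(\<lambda>n. y) \<longlonglongrightarrow> (x :: 'a::metric_space skorohod)"
  shows "x = y"
proof -
  obtain l where l: "\<And>n. time_change (l n)" "uniform_limit {0..} l (\<lambda>s. s) sequentially"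
    "\<And>T. uniform_limit {0..T} (\<lambda>n s. path_of y (l n s)) (path_of x) sequentially"
    using assms unfolding LIMSEQ_skorohod_iff by blast
  have ls: "(\<lambda>n. l n s) \<longlonglongrightarrow> s" if "s \<ge> 0" for s
    using tendsto_uniform_limitI[OF l(2)] that by auto
  have ys: "(\<lambda>n. path_of y (l n s)) \<longlonglongrightarrow> path_of x s" if "s \<ge> 0" for s
    using tendsto_uniform_limitI[OF l(3)[of s]] that by auto
  have "path_of x t = path_of y t" if t: "t \<ge> 0" for t
  proof -
    have "dist (path_of x t) (path_of y t) \<le> e" if e: "e > 0" for e
    proof -
      have "eventually (\<lambda>s. dist (path_of y s) (path_of y t) < e) (at_right t)"
        using tendstoD[OF cadlag_at_right[OF path_of_cadlag t] e] .
      then obtain b where b: "b > t" "\<And>s. t < s \<Longrightarrow> s < b \<Longrightarrow> dist (path_of y s) (path_of y t) < e"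
        by (auto simp: eventually_at_right_field)
      have "dist (path_of x s) (path_of y t) \<le> e" if s: "t < s" "s < b" for s
      proof -
        have "s \<ge> 0" using s t by simp
        have "eventually (\<lambda>n. l n s \<in> {t<..<b}) sequentially"
          using topological_tendstoD[OF ls[OF \<open>s \<ge> 0\<close>], of "{t<..<b}"] s by simp
        then have "eventually (\<lambda>n. dist (path_of y (l n s)) (path_of y t) \<le> e) sequentially"
          by eventually_elim (use b(2) in \<open>auto intro: less_imp_le\<close>)
        moreover have "(\<lambda>n. dist (path_of y (l n s)) (path_of y t)) \<longlonglongrightarrow> dist (path_of x s) (path_of y t)"
          by (intro tendsto_intros ys \<open>s \<ge> 0\<close>)
        ultimately show ?thesis by (intro tendsto_upperbound) auto
      qed
      then have "eventually (\<lambda>s. dist (path_of x s) (path_of y t) \<le> e) (at_right t)"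
        using b(1) by (auto simp: eventually_at_right_field)
      moreover have "((\<lambda>s. dist (path_of x s) (path_of y t)) \<longlongrightarrow> dist (path_of x t) (path_of y t)) (at_right t)"
        by (intro tendsto_intros cadlag_at_right[OF path_of_cadlag] t)
      ultimately show ?thesis by (intro tendsto_upperbound) auto
    qed
    then have "dist (path_of x t) (path_of y t) \<le> 0" by (rule dense_ge)
    then show ?thesis by simp
  qed
  then show ?thesis by (simp add: skorohod_eq_iff)
qed

text \<open>
  Not symmetric, but it satisfies the triangle inequality because the time horizon \<open>1 / e\<close> is long
  compared with \<open>e\<close> when \<open>e \<le> 1\<close>.
\<close>

definition skorohod_qdist :: "'a::metric_space skorohod \<Rightarrow> 'a skorohod \<Rightarrow> real" where
  "skorohod_qdist x y = Inf (insert 1 {e. 0 < e \<and> y \<in> skorohod_nbhd x (1 / e) e})"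

lemma skorohod_qdist_nonneg: "0 \<le> skorohod_qdist x y"
  unfolding skorohod_qdist_def by (intro cInf_greatest) auto

lemma skorohod_qdist_le: "0 < e \<Longrightarrow> y \<in> skorohod_nbhd x (1 / e) e \<Longrightarrow> skorohod_qdist x y \<le> e"
  unfolding skorohod_qdist_def by (intro cInf_lower bdd_belowI[where m=0]) auto

lemma skorohod_qdist_le_1: "skorohod_qdist x y \<le> 1"
  unfolding skorohod_qdist_def by (intro cInf_lower bdd_belowI[where m=0]) auto

lemma skorohod_qdist_less:
  assumes "skorohod_qdist x y < e" "e \<le> 1"
  shows "\<exists>d. 0 < d \<and> d < e \<and> y \<in> skorohod_nbhd x (1 / d) d"
  using assms cInf_lessD[of "insert 1 {e. 0 < e \<and> y \<in> skorohod_nbhd x (1 / e) e}" e]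
  unfolding skorohod_qdist_def by auto

lemma skorohod_qdist_triangle:
  "skorohod_qdist x z \<le> skorohod_qdist x y + skorohod_qdist y z"
proof (rule field_le_epsilon)
  fix \<epsilon> :: real assume \<epsilon>: "\<epsilon> > 0"
  show "skorohod_qdist x z \<le> skorohod_qdist x y + skorohod_qdist y z + \<epsilon>"
  proof (cases "skorohod_qdist x y + skorohod_qdist y z + \<epsilon> < 1")
    case False
    then show ?thesis using skorohod_qdist_le_1[of x z] by simp
  next
    case True
    have nn: "0 \<le> skorohod_qdist x y" "0 \<le> skorohod_qdist y z" by (rule skorohod_qdist_nonneg)+
    obtain d where d: "0 < d" "d < skorohod_qdist x y + \<epsilon>/2" "y \<in> skorohod_nbhd x (1 / d) d"
      using skorohod_qdist_less[of x y "skorohod_qdist x y + \<epsilon>/2"] True \<epsilon> nn by auto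
    obtain e where e: "0 < e" "e < skorohod_qdist y z + \<epsilon>/2" "z \<in> skorohod_nbhd y (1 / e) e"
      using skorohod_qdist_less[of y z "skorohod_qdist y z + \<epsilon>/2"] True \<epsilon> nn by auto
    have de: "d + e \<le> 1" using d e True by linarith
    have "y \<in> skorohod_nbhd x (1 / (d + e)) d"
      using d e skorohod_nbhd_mono[of "1 / (d + e)" "1 / d" d d x] by (auto simp: frac_le)
    moreover have "z \<in> skorohod_nbhd y (1 / (d + e) + d) e"
    proof -
      have "e * (d + e) \<le> 1" using mult_mono[of e 1 "d + e" 1] d e de by simp
      then have "d * (e * (d + e)) \<le> d * 1" using d(1) by (intro mult_left_mono) auto
      then have "1 / (d + e) + d \<le> 1 / e" using d(1) e(1) by (simp add: field_simps)
      then show ?thesis using e skorohod_nbhd_mono[of "1 / (d + e) + d" "1 / e" e e y] by auto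
    qed
    ultimately have "z \<in> skorohod_nbhd x (1 / (d + e)) (d + e)" by (rule skorohod_nbhd_triangle)
    then have "skorohod_qdist x z \<le> d + e" using d e by (intro skorohod_qdist_le) auto
    then show ?thesis using d e by linarith
  qed
qed

lemma skorohod_qdist_nbhd:
  assumes "e > 0" "skorohod_qdist x y < min 1 (min e (1 / (1 + \<bar>T\<bar>)))"
  shows "y \<in> skorohod_nbhd x T e"
proof -
  obtain d where d: "0 < d" "d < min 1 (min e (1 / (1 + \<bar>T\<bar>)))" "y \<in> skorohod_nbhd x (1 / d) d"
    using skorohod_qdist_less[OF assms(2)] by auto
  have "d * (1 + \<bar>T\<bar>) < 1" using d(2) by (simp add: pos_less_divide_eq)
  then have "1 + \<bar>T\<bar> \<le> 1 / d" using d(1) by (simp add: pos_le_divide_eq mult.commute)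
  then have "T \<le> 1 / d" by linarith
  then show ?thesis using skorohod_nbhd_mono[of T "1 / d" d e x] d by auto
qed

lemma metrizable_skorohod: "metrizable_space (euclidean :: 'a::metric_space skorohod topology)"
proof -
  define D where "D x y = skorohod_qdist x y + skorohod_qdist y x" for x y :: "'a skorohod"
  have self: "skorohod_qdist x x = 0" for x :: "'a skorohod"
  proof -
    have "skorohod_qdist x x \<le> e" if "e > 0" for e
      using that skorohod_nbhd_self by (intro skorohod_qdist_le) auto
    then have "skorohod_qdist x x \<le> 0" by (rule dense_ge)
    then show ?thesis using skorohod_qdist_nonneg[of x x] by simp
  qed
  have eq: "x = y" if "D x y = 0" for x y
  proof (rule skorohod_const_limit_unique)
    have "skorohod_qdist x y = 0" using that skorohod_qdist_nonneg[of x y] skorohod_qdist_nonneg[of y x]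
      by (simp add: D_def)
    then have "y \<in> skorohod_nbhd x T e" if "e > 0" for T e
      using that by (intro skorohod_qdist_nbhd) auto
    then show "(\<lambda>n. y) \<longlonglongrightarrow> x" by (simp add: tendsto_skorohod_iff)
  qed
  interpret D: Metric_space UNIV D
  proof
    show "D x y = 0 \<longleftrightarrow> x = y" for x y using eq self by (auto simp: D_def)
    show "D x z \<le> D x y + D y z" for x y z
      using skorohod_qdist_triangle[of x z y] skorohod_qdist_triangle[of z x y] by (simp add: D_def)
  qed (auto simp: D_def skorohod_qdist_nonneg add.commute)
  have "open U \<longleftrightarrow> (\<forall>x\<in>U. \<exists>r>0. D.mball x r \<subseteq> U)" for U
  proof
    assume "open U"
    show "\<forall>x\<in>U. \<exists>r>0. D.mball x r \<subseteq> U"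
    proof
      fix x assume "x \<in> U"
      then obtain T e where e: "e > 0" "skorohod_nbhd x T e \<subseteq> U"
        using \<open>open U\<close> unfolding open_skorohod_def by blast
      define r where "r = min 1 (min e (1 / (1 + \<bar>T\<bar>)))"
      have "y \<in> U" if "D x y < r" for y
      proof -
        have "skorohod_qdist x y < r" using that skorohod_qdist_nonneg[of y x] by (simp add: D_def)
        then show ?thesis using e skorohod_qdist_nbhd unfolding r_def by blast
      qed
      moreover have "r > 0" using e unfolding r_def by auto
      ultimately show "\<exists>r>0. D.mball x r \<subseteq> U" by (intro exI[of _ r]) auto
    qed
  next
    assume *: "\<forall>x\<in>U. \<exists>r>0. D.mball x r \<subseteq> U"
    show "open U"
      unfolding open_skorohod_def
    proof
      fix x assume "x \<in> U"
      then obtain r where r: "r > 0" "D.mball x r \<subseteq> U" using * by blast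
      define e where "e = r / 3"
      have e: "e > 0" using r by (simp add: e_def)
      have "y \<in> U" if y: "y \<in> skorohod_nbhd x (1 / e + e) e" for y
      proof -
        have "skorohod_qdist x y \<le> e"
          using y e skorohod_nbhd_mono[of "1 / e" "1 / e + e" e e x] by (intro skorohod_qdist_le) auto
        moreover have "skorohod_qdist y x \<le> e"
          using skorohod_nbhd_sym[OF y] e by (intro skorohod_qdist_le) auto
        ultimately have "D x y < r" using r unfolding D_def e_def by simp
        then show ?thesis using r(2) by auto
      qed
      then show "\<exists>T. \<exists>e>0. skorohod_nbhd x T e \<subseteq> U" using e by blast
    qed
  qed
  then have "D.mtopology = euclidean"
    by (intro topology_eq[THEN iffD2]) (auto simp: D.openin_mtopology)
  then show ?thesis using D.metrizable_space_mtopology by simp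
qed

lemma skorohod_limit_imp_uniform_limit:
  fixes x :: "'a::metric_space skorohod"
  assumes "f \<longlonglongrightarrow> x" and cont: "continuous_on {0..} (path_of x)"
  shows "uniform_limit {0..T} (\<lambda>n. path_of (f n)) (path_of x) sequentially"
  unfolding uniform_limit_iff
proof (intro allI impI)
  fix e :: real assume e: "e > 0"
  have "uniformly_continuous_on {0..T+1} (path_of x)"
    using cont by (intro compact_uniformly_continuous continuous_on_subset[OF cont]) auto
  then obtain d where d: "d > 0" "\<And>s t. s \<in> {0..T+1} \<Longrightarrow> t \<in> {0..T+1} \<Longrightarrow> dist s t < d \<Longrightarrow> dist (path_of x s) (path_of x t) < e/2"
    unfolding uniformly_continuous_on_def using e by (metis half_gt_zero dist_commute)
  define h where "h = min 1 (min d (e/2))"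
  have h: "h > 0" using d e by (simp add: h_def)
  have "\<forall>\<^sub>F n in sequentially. f n \<in> skorohod_nbhd x (T+1) h"
    using assms(1) h unfolding tendsto_skorohod_iff by blast
  then show "\<forall>\<^sub>F n in sequentially. \<forall>s\<in>{0..T}. dist (path_of (f n) s) (path_of x s) < e"
  proof eventually_elim
    case (elim n)
    obtain l where l: "time_change l" "\<And>s. s \<ge> 0 \<Longrightarrow> \<bar>l s - s\<bar> < h"
      "\<And>s. s \<in> {0..T+1} \<Longrightarrow> dist (path_of (f n) (l s)) (path_of x s) < h"
      using elim by (auto simp: skorohod_nbhd_def)
    define m where "m = inv_into {0..} l"
    note m = time_change_inv[OF l(1) m_def]
    show ?case
    proof
      fix s assume s: "s \<in> {0..T}"
      have ms: "m s \<ge> 0" "l (m s) = s" "\<bar>m s - s\<bar> < h" using m(2)[of s] s l(2)[of "m s"] by auto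
      then have "m s \<in> {0..T+1}" using s by (auto simp: h_def)
      from l(3)[OF this] have "dist (path_of (f n) s) (path_of x (m s)) < e/2" using ms by (simp add: h_def)
      moreover have "dist (path_of x (m s)) (path_of x s) < e/2"
        using d(2)[of "m s" s] \<open>m s \<in> _\<close> s ms by (auto simp: dist_real_def h_def)
      ultimately show "dist (path_of (f n) s) (path_of x s) < e"
        using dist_triangle_half_r[of "path_of x (m s)"] by (metis dist_commute)
    qed
  qed
qed

lemma uniform_limit_imp_skorohod_limit:
  fixes x :: "'a::metric_space skorohod"
  assumes "\<And>T. T \<ge> 0 \<Longrightarrow> uniform_limit {0..T} (\<lambda>n. path_of (f n)) (path_of x) sequentially"
  shows "f \<longlonglongrightarrow> x"
  unfolding tendsto_skorohod_iff
proof (intro allI impI)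
  fix T e :: real assume e: "e > 0"
  have "\<forall>\<^sub>F n in sequentially. \<forall>s\<in>{0..\<bar>T\<bar>}. dist (path_of (f n) s) (path_of x s) < e"
    using assms[of "\<bar>T\<bar>"] e by (simp add: uniform_limit_iff)
  then show "\<forall>\<^sub>F n in sequentially. f n \<in> skorohod_nbhd x T e"
    by eventually_elim (use e time_change_id in \<open>auto simp: skorohod_nbhd_def intro!: exI[of _ "\<lambda>s. s"]\<close>)
qed

lemma cadlag_continuous:
  assumes "continuous_on {0..} f" shows "cadlag f"
  unfolding cadlag_def
proof (intro conjI allI impI)
  fix t :: real assume "t \<ge> 0"
  then have "(f \<longlongrightarrow> f t) (at t within {0..})" using assms by (auto simp: continuous_on_def)
  then show "(f \<longlongrightarrow> f t) (at_right t)" by (rule tendsto_within_subset) (use \<open>t \<ge> 0\<close> in auto)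
next
  fix t :: real assume "t > 0"
  then have "(f \<longlongrightarrow> f t) (at t within {0..})" using assms by (auto simp: continuous_on_def)
  moreover have "at t within {0..} = at t"
    using \<open>t > 0\<close> by (intro at_within_interior) (simp add: interior_real_atLeast)
  ultimately have "(f \<longlongrightarrow> f t) (at t)" by simp
  then have "(f \<longlongrightarrow> f t) (at_left t)" by (rule tendsto_within_subset) simp
  then show "\<exists>l. (f \<longlongrightarrow> l) (at_left t)" by blast
qed

lemma cadlag_time_scale:
  assumes "cadlag x" "(c::real) > 0" shows "cadlag (\<lambda>t. x (c * t))"
  unfolding cadlag_def
proof (intro conjI allI impI)
  fix t :: real assume "t \<ge> 0"
  have "filterlim (\<lambda>t. c * t) (at_right (c * t)) (at_right t)"
    unfolding filterlim_at using assms(2) by (auto intro!: tendsto_intros simp: eventually_at_filter)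
  then show "((\<lambda>t. x (c * t)) \<longlongrightarrow> x (c * t)) (at_right t)"
    using assms \<open>t \<ge> 0\<close> by (intro filterlim_compose[OF cadlag_at_right]) auto
next
  fix t :: real assume "t > 0"
  then obtain l where "(x \<longlongrightarrow> l) (at_left (c * t))" using assms mult_pos_pos[of c t] unfolding cadlag_def by blast
  moreover have "filterlim (\<lambda>t. c * t) (at_left (c * t)) (at_left t)"
    unfolding filterlim_at using assms(2) by (auto intro!: tendsto_intros simp: eventually_at_filter)
  ultimately show "\<exists>l. ((\<lambda>t. x (c * t)) \<longlongrightarrow> l) (at_left t)"
    using filterlim_compose by blast
qed

lemma cadlag_compose2:
  assumes "cadlag x" "cadlag y" "\<And>a b. isCont (\<lambda>p. g (fst p) (snd p)) (a, b)"
  shows "cadlag (\<lambda>t. g (x t) (y t))"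
proof -
  have *: "((\<lambda>t. g (x t) (y t)) \<longlongrightarrow> g a b) F" if "(x \<longlongrightarrow> a) F" "(y \<longlongrightarrow> b) F" for a b and F :: "real filter"
    using isCont_tendsto_compose[OF assms(3) tendsto_Pair[OF that]] by simp
  show ?thesis
    unfolding cadlag_def
  proof (intro conjI allI impI)
    show "((\<lambda>t. g (x t) (y t)) \<longlongrightarrow> g (x t) (y t)) (at_right t)" if "t \<ge> 0" for t
      using assms(1,2) that by (intro *) (auto simp: cadlag_def)
  next
    fix t :: real assume "t > 0"
    then obtain l m where "(x \<longlongrightarrow> l) (at_left t)" "(y \<longlongrightarrow> m) (at_left t)"
      using assms(1,2) unfolding cadlag_def by blast
    then show "\<exists>l. ((\<lambda>t. g (x t) (y t)) \<longlongrightarrow> l) (at_left t)" using * by blast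
  qed
qed

lemma cadlag_vec:
  assumes "\<And>i. cadlag (\<lambda>t. x t $ i)" shows "cadlag (x :: real \<Rightarrow> 'a::topological_space^'k)"
  unfolding cadlag_def
proof (intro conjI allI impI)
  show "(x \<longlongrightarrow> x t) (at_right t)" if "t \<ge> 0" for t
    using assms that by (intro vec_tendstoI) (auto simp: cadlag_def)
next
  fix t :: real assume "t > 0"
  then have "\<forall>i. \<exists>l. ((\<lambda>t. x t $ i) \<longlongrightarrow> l) (at_left t)" using assms unfolding cadlag_def by blast
  then obtain l where "\<And>i. ((\<lambda>t. x t $ i) \<longlongrightarrow> l i) (at_left t)" using choice[of "\<lambda>i l. ((\<lambda>t. x t $ i) \<longlongrightarrow> l) (at_left t)"] by blast
  then have "(x \<longlongrightarrow> (\<chi> i. l i)) (at_left t)" by (intro vec_tendstoI) auto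
  then show "\<exists>l. (x \<longlongrightarrow> l) (at_left t)" by blast
qed

lemma cadlag_floor: "cadlag (\<lambda>t. f \<lfloor>t\<rfloor>)"
  unfolding cadlag_def
proof (intro conjI allI impI)
  fix t :: real
  have "eventually (\<lambda>s. s \<in> {t<..<of_int (\<lfloor>t\<rfloor> + 1)}) (at_right t)"
    by (intro eventually_at_right_real) linarith
  then have "eventually (\<lambda>s. f \<lfloor>s\<rfloor> = f \<lfloor>t\<rfloor>) (at_right t)"
  proof eventually_elim
    case (elim s)
    then have "\<lfloor>s\<rfloor> = \<lfloor>t\<rfloor>" by (intro floor_unique) (auto, linarith)
    then show ?case by simp
  qed
  then show "((\<lambda>t. f \<lfloor>t\<rfloor>) \<longlongrightarrow> f \<lfloor>t\<rfloor>) (at_right t)" by (rule tendsto_eventually)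
next
  fix t :: real
  have "eventually (\<lambda>s. s \<in> {of_int (\<lceil>t\<rceil> - 1)<..<t}) (at_left t)"
    by (intro eventually_at_left_real) linarith
  then have "eventually (\<lambda>s. f \<lfloor>s\<rfloor> = f (\<lceil>t\<rceil> - 1)) (at_left t)"
  proof eventually_elim
    case (elim s)
    then have "\<lfloor>s\<rfloor> = \<lceil>t\<rceil> - 1" by (intro floor_unique) (auto, linarith)
    then show ?case by simp
  qed
  then have "((\<lambda>t. f \<lfloor>t\<rfloor>) \<longlongrightarrow> f (\<lceil>t\<rceil> - 1)) (at_left t)" by (rule tendsto_eventually)
  then show "\<exists>l. ((\<lambda>t. f \<lfloor>t\<rfloor>) \<longlongrightarrow> l) (at_left t)" by blast
qed

lemma cadlag_bounded:
  fixes x :: "real \<Rightarrow> 'a::metric_space"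
  assumes "cadlag x" shows "bounded (x ` {0..T})"
proof -
  have "\<exists>d>0. bounded (x ` ({0..T} \<inter> ball t d))" if t: "t \<in> {0..T}" for t
  proof -
    obtain b where b: "b > t" "\<And>s. t < s \<Longrightarrow> s < b \<Longrightarrow> dist (x s) (x t) < 1"
      using tendstoD[OF cadlag_at_right[OF assms], of t 1] t by (auto simp: eventually_at_right_field)
    have "\<exists>c<t. \<exists>y. \<forall>s\<in>{0..T}. c < s \<longrightarrow> s < t \<longrightarrow> dist (x s) y < 1"
    proof (cases "t = 0")
      case True then show ?thesis by (intro exI[of _ "-1"]) auto
    next
      case False
      then obtain y where "(x \<longlongrightarrow> y) (at_left t)" using assms t unfolding cadlag_def by (metis atLeastAtMost_iff order_le_less)
      from tendstoD[OF this, of 1] obtain c where "c < t" "\<And>s. c < s \<Longrightarrow> s < t \<Longrightarrow> dist (x s) y < 1"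
        by (auto simp: eventually_at_left_field)
      then show ?thesis by blast
    qed
    then obtain c y where c: "c < t" "\<And>s. s \<in> {0..T} \<Longrightarrow> c < s \<Longrightarrow> s < t \<Longrightarrow> dist (x s) y < 1" by blast
    define d where "d = min (b - t) (t - c)"
    have "x ` ({0..T} \<inter> ball t d) \<subseteq> ball (x t) 1 \<union> ball y 1"
    proof clarify
      fix s assume s: "s \<in> {0..T}" "s \<in> ball t d" "x s \<notin> ball y 1"
      then have "c < s" "s < b" by (auto simp: d_def dist_real_def)
      then show "x s \<in> ball (x t) 1"
        using b(2)[of s] c(2)[of s] s by (cases "s = t"; cases "s < t") (auto simp: dist_commute)
    qed
    then have "bounded (x ` ({0..T} \<inter> ball t d))" by (rule bounded_subset[rotated]) simp
    moreover have "d > 0" using b c by (simp add: d_def)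
    ultimately show ?thesis by blast
  qed
  then have "\<forall>t\<in>{0..T}. \<exists>d. d > 0 \<and> bounded (x ` ({0..T} \<inter> ball t d))" by blast
  from bchoice[OF this] obtain d where d: "\<forall>t\<in>{0..T}. d t > 0 \<and> bounded (x ` ({0..T} \<inter> ball t (d t)))" by blast
  obtain F where F: "F \<subseteq> {0..T}" "finite F" "{0..T} \<subseteq> (\<Union>t\<in>F. ball t (d t))"
    using compactE_image[of "{0..T}" "{0..T}" "\<lambda>t. ball t (d t)"] d
    by (metis (no_types, lifting) UN_I centre_in_ball compact_Icc open_ball subsetI)
  have "x ` {0..T} \<subseteq> (\<Union>t\<in>F. x ` ({0..T} \<inter> ball t (d t)))" using F(3) by blast
  moreover have "bounded \<dots>" using F d by (intro bounded_UN) auto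
  ultimately show ?thesis by (rule bounded_subset[rotated])
qed

lemma path_of_borel: "path_of (x :: 'a::metric_space skorohod) \<in> borel_measurable borel"
proof (rule borel_measurable_LIMSEQ_metric)
  define f where "f n s = (of_int (\<lfloor>real (Suc n) * s\<rfloor> + 1)) / real (Suc n)" for n and s :: real
  show "(\<lambda>s. path_of x (f n s)) \<in> borel_measurable borel" for n
  proof -
    have 1: "(\<lambda>s::real. \<lfloor>real (Suc n) * s\<rfloor>) \<in> measurable borel (count_space UNIV)" by measurable
    have "(\<lambda>k::int. path_of x ((of_int (k + 1)) / real (Suc n))) \<in> measurable (count_space UNIV) borel" by simp
    from measurable_compose[OF 1 this] show ?thesis by (simp add: f_def)
  qed
  fix s :: real
  have fs: "s < f n s \<and> f n s \<le> s + 1 / real (Suc n)" for n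
  proof -
    define k where "k = real (Suc n)"
    define a where "a = (of_int (\<lfloor>k * s\<rfloor> + 1) :: real)"
    have k: "k > 0" by (simp add: k_def)
    have "k * s < a" "a \<le> k * s + 1" unfolding a_def by linarith+
    then have "s < a / k" "a / k \<le> s + 1 / k" using k by (simp_all add: field_simps)
    then show ?thesis unfolding f_def k_def[symmetric] a_def[symmetric] by simp
  qed
  have "(\<lambda>n. s + 1 / real (Suc n)) \<longlonglongrightarrow> s + 0" by (intro tendsto_intros LIMSEQ_Suc[OF lim_1_over_n])
  then have "(\<lambda>n. f n s) \<longlonglongrightarrow> s"
    using fs by (intro tendsto_sandwich[of "\<lambda>_. s" "\<lambda>n. f n s" sequentially "\<lambda>n. s + 1 / real (Suc n)"]) (simp_all add: less_imp_le)
  then have "filterlim (\<lambda>n. f n s) (at_right s) sequentially"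
    unfolding filterlim_at using fs by (simp add: less_imp_neq[symmetric])
  moreover have "(path_of x \<longlongrightarrow> path_of x s) (at_right s)"
  proof (cases "s \<ge> 0")
    case True then show ?thesis by (rule cadlag_at_right[OF path_of_cadlag])
  next
    case False
    then have "eventually (\<lambda>u. u \<in> {s<..<0}) (at_right s)" by (intro eventually_at_right_real) auto
    then have "eventually (\<lambda>u. path_of x u = path_of x s) (at_right s)"
    proof eventually_elim
      case (elim u)
      then show ?case using False path_of_nonpos[of u x] path_of_nonpos[of s x] by simp
    qed
    then show ?thesis by (rule tendsto_eventually)
  qed
  ultimately show "(\<lambda>n. path_of x (f n s)) \<longlonglongrightarrow> path_of x s" by (rule filterlim_compose[rotated])
qed

lemma path_of_scaled_counting:
  assumes "n \<ge> 1" "t \<ge> 0"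
  shows "path_of (scaled_counting n N) t $ i = (path_of (N i) (real n * t) - real n * t) / sqrt (real n)"
proof -
  have "cadlag (\<lambda>t. path_of (N i) (real n * t))" "cadlag (\<lambda>t. real n * t)" for i
    using assms by (auto intro!: cadlag_time_scale path_of_cadlag cadlag_continuous[of "\<lambda>t. real n * t"] continuous_intros)
  from cadlag_compose2[OF this, of "\<lambda>a b. (a - b) / sqrt (real n)"]
  have "cadlag (\<lambda>t. (path_of (N i) (real n * t) - real n * t) / sqrt (real n))" for i
    using assms by (auto intro!: continuous_intros)
  then have "cadlag (\<lambda>t. \<chi> i. (path_of (N i) (real n * t) - real n * t) / sqrt (real n))"
    by (intro cadlag_vec) simp
  then show ?thesis unfolding scaled_counting_def using assms by (simp add: path_of_to_skorohod)
qed

lemma path_of_scaled_routing: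
  assumes "n \<ge> 1" "t \<ge> 0"
  shows "path_of (scaled_routing n P Phi) t $ i $ j =
    (real (Phi i j (nat \<lfloor>real n * t\<rfloor>)) - P $ i $ j * real n * t) / sqrt (real n)"
proof -
  have "cadlag (\<lambda>t. real (Phi i j (nat \<lfloor>real n * t\<rfloor>)))" "cadlag (\<lambda>t. P $ i $ j * real n * t)" for i j
    using assms by (auto intro!: cadlag_time_scale[of "\<lambda>t. real (Phi i j (nat \<lfloor>t\<rfloor>))"] cadlag_floor
      cadlag_continuous[of "\<lambda>t. P $ i $ j * real n * t"] continuous_intros)
  from cadlag_compose2[OF this, of "\<lambda>a b. (a - b) / sqrt (real n)"]
  have "cadlag (\<lambda>t. (real (Phi i j (nat \<lfloor>real n * t\<rfloor>)) - P $ i $ j * real n * t) / sqrt (real n))" for i j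
    using assms by (auto intro!: continuous_intros)
  then have "cadlag (\<lambda>t. \<chi> i j. (real (Phi i j (nat \<lfloor>real n * t\<rfloor>)) - P $ i $ j * real n * t) / sqrt (real n))"
    by (intro cadlag_vec) simp
  then show ?thesis unfolding scaled_routing_def using assms by (simp add: path_of_to_skorohod)
qed

lemma path_of_scaled_queue:
  assumes "t \<ge> 0"
  shows "path_of (scaled_queue n Q) t = path_of Q t /\<^sub>R sqrt (real n)"
proof -
  have "cadlag (\<lambda>t. path_of Q t /\<^sub>R sqrt (real n))"
    using cadlag_compose2[OF path_of_cadlag[of Q] path_of_cadlag[of Q], of "\<lambda>a b. a /\<^sub>R sqrt (real n)"]
    by (auto intro!: continuous_intros)
  then show ?thesis unfolding scaled_queue_def using assms by (simp add: path_of_to_skorohod)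
qed

lemma continuous_scaled_queue: "continuous_on UNIV (scaled_queue n :: (real^'k::finite) skorohod \<Rightarrow> _)"
proof -
  have "(scaled_queue n \<longlongrightarrow> scaled_queue n x) (at x)" for x :: "(real^'k) skorohod"
    unfolding tendsto_skorohod_iff
  proof (intro allI impI)
    fix T e :: real assume e: "e > 0"
    define c where "c = inverse (sqrt (real n))"
    have c: "c \<ge> 0" by (simp add: c_def)
    define d where "d = min e (e / (c + 1))"
    have d: "d > 0" "d \<le> e" "c * d \<le> e"
    proof -
      show "d > 0" "d \<le> e" using e c by (auto simp: d_def)
      have "c * d \<le> c * (e / (c + 1))" using c by (intro mult_left_mono) (auto simp: d_def)
      also have "\<dots> \<le> e" using c e by (simp add: field_simps)
      finally show "c * d \<le> e" .
    qed
    have "eventually (\<lambda>y. y \<in> skorohod_nbhd x T d) (at x)"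
      using tendsto_ident_at[of x UNIV] d unfolding tendsto_skorohod_iff by blast
    then show "eventually (\<lambda>y. scaled_queue n y \<in> skorohod_nbhd (scaled_queue n x) T e) (at x)"
    proof eventually_elim
      case (elim y)
      then obtain l where l: "time_change l" "\<And>s. s \<ge> 0 \<Longrightarrow> \<bar>l s - s\<bar> < d"
        "\<And>s. s \<in> {0..T} \<Longrightarrow> dist (path_of y (l s)) (path_of x s) < d" by (auto simp: skorohod_nbhd_def)
      have "dist (path_of (scaled_queue n y) (l s)) (path_of (scaled_queue n x) s) < e" if s: "s \<in> {0..T}" for s
      proof -
        have "l s \<ge> 0" using l(1) s by (auto simp: time_change_def)
        then have "dist (path_of (scaled_queue n y) (l s)) (path_of (scaled_queue n x) s)
          = c * dist (path_of y (l s)) (path_of x s)"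
          using s by (simp add: path_of_scaled_queue c_def dist_norm scaleR_diff_right[symmetric])
        also have "\<dots> < e"
        proof (cases "c = 0")
          case False
          then have "c * dist (path_of y (l s)) (path_of x s) < c * d" using c l(3)[OF s] by simp
          then show ?thesis using d by simp
        qed (use e in simp)
        finally show ?thesis .
      qed
      moreover have "\<bar>l s - s\<bar> < e" if "s \<ge> 0" for s using l(2)[OF that] d by linarith
      ultimately show ?case unfolding skorohod_nbhd_def using l(1) by blast
    qed
  qed
  then show ?thesis by (simp add: continuous_on_def)
qed

section \<open>The Skorohod problem\<close>

lemma sum_reflection_coeff:
  fixes P :: "real^'k^'k::finite"
  shows "(\<Sum>j\<in>UNIV. ((if i = j then 1 else 0) - P $ j $ i) * x j) = x i - (\<Sum>j\<in>UNIV. P $ j $ i * x j)"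
proof -
  have "(\<Sum>j\<in>UNIV. ((if i = j then 1 else 0) - P $ j $ i) * x j) = (\<Sum>j\<in>UNIV. (if i = j then x j else 0) - P $ j $ i * x j)"
    by (intro sum.cong) (auto simp: left_diff_distrib)
  then show ?thesis by (simp add: sum_subtractf)
qed

lemma reflection_matrix_nth:
  "(reflection_matrix P *v x) $ i = x $ i - (\<Sum>j\<in>UNIV. P $ j $ i * x $ j)"
  unfolding sum_reflection_coeff[of i P "\<lambda>j. x $ j", symmetric]
  by (simp add: reflection_matrix_def matrix_vector_mult_def transpose_def mat_def)

lemma substochastic_entry_le_1:
  assumes "substochastic P"
  shows "P $ j $ i \<le> 1"
proof -
  have "P $ j $ i \<le> (\<Sum>l\<in>UNIV. P $ j $ l)" using assms by (intro member_le_sum) (auto simp: substochastic_def)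
  also have "\<dots> \<le> 1" using assms by (simp add: substochastic_def)
  finally show ?thesis .
qed

lemma substochastic_eigenvalue_le_1:
  assumes "substochastic P" "v \<noteq> 0" and eig: "(\<chi> i j. complex_of_real (P $ i $ j)) *v v = z *s v"
  shows "cmod z \<le> 1"
proof -
  have "Max (range (\<lambda>j. cmod (v $ j))) \<in> range (\<lambda>j. cmod (v $ j))" by (intro Max_in) auto
  then obtain i where "Max (range (\<lambda>j. cmod (v $ j))) = cmod (v $ i)" by blast
  then have i: "cmod (v $ j) \<le> cmod (v $ i)" for j
    using Max_ge[of "range (\<lambda>j. cmod (v $ j))" "cmod (v $ j)"] by simp
  have "v $ i \<noteq> 0"
  proof
    assume "v $ i = 0"
    then have "v $ j = 0" for j using i[of j] by simp
    then show False using \<open>v \<noteq> 0\<close> by (simp add: vec_eq_iff)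
  qed
  have "z * v $ i = (\<Sum>j\<in>UNIV. complex_of_real (P $ i $ j) * v $ j)"
    using arg_cong[OF eig, of "\<lambda>w. w $ i"] by (simp add: matrix_vector_mult_def)
  then have "cmod z * cmod (v $ i) \<le> (\<Sum>j\<in>UNIV. cmod (complex_of_real (P $ i $ j) * v $ j))"
    by (metis norm_mult norm_sum)
  also have "\<dots> \<le> (\<Sum>j\<in>UNIV. P $ i $ j * cmod (v $ i))"
    using assms(1) i by (intro sum_mono) (auto simp: norm_mult substochastic_def intro!: mult_left_mono)
  also have "\<dots> \<le> 1 * cmod (v $ i)"
    unfolding sum_distrib_right[symmetric] using assms(1) by (intro mult_right_mono) (auto simp: substochastic_def)
  finally show ?thesis using \<open>v $ i \<noteq> 0\<close> by simp
qed

lemma substochastic_contraction_weight: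
  assumes P: "substochastic P" and "spectral_radius P < 1"
  obtains u :: "'k::finite \<Rightarrow> real" and g where "0 \<le> g" "g < 1" "\<And>i. 1 \<le> u i"
    "\<And>i. (\<Sum>j\<in>UNIV. P $ i $ j * u j) \<le> g * u i"
proof -
  have Pn: "0 \<le> P $ i $ j" "(\<Sum>j\<in>UNIV. P $ i $ j) \<le> 1" for i j using P by (auto simp: substochastic_def)
  define r where "r = rec_nat (\<lambda>_. 1) (\<lambda>_ f i. \<Sum>j\<in>UNIV. P $ i $ j * f j)"
  have r0: "r 0 i = 1" and rS: "r (Suc k) i = (\<Sum>j\<in>UNIV. P $ i $ j * r k j)" for i k
    by (simp_all add: r_def)
  have rn: "0 \<le> r k i" for k i by (induction k arbitrary: i) (auto simp: r0 rS Pn intro!: sum_nonneg mult_nonneg_nonneg)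
  have rdec: "r (Suc k) i \<le> r k i" for k i
  proof (induction k arbitrary: i)
    case 0 then show ?case using Pn by (simp add: rS r0)
  next
    case (Suc k)
    have "(\<Sum>j\<in>UNIV. P $ i $ j * r (Suc k) j) \<le> (\<Sum>j\<in>UNIV. P $ i $ j * r k j)"
      by (intro sum_mono mult_left_mono Suc Pn)
    then show ?case by (simp only: rS[symmetric])
  qed
  have dec: "decseq (\<lambda>k. r k i)" for i by (intro decseq_SucI rdec)
  have "\<exists>l. (\<lambda>k. r k i) \<longlonglongrightarrow> l" for i using decseq_convergent[OF dec, of 0 i] rn by metis
  then obtain l where l: "\<And>i. (\<lambda>k. r k i) \<longlonglongrightarrow> l i" by metis
  have eq: "(\<Sum>j\<in>UNIV. P $ i $ j * l j) = l i" for i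
  proof (rule LIMSEQ_unique)
    show "(\<lambda>k. r (Suc k) i) \<longlonglongrightarrow> (\<Sum>j\<in>UNIV. P $ i $ j * l j)" unfolding rS by (intro tendsto_intros l)
    show "(\<lambda>k. r (Suc k) i) \<longlonglongrightarrow> l i" by (rule LIMSEQ_Suc[OF l])
  qed
  have "l = (\<lambda>_. 0)"
  proof (rule ccontr)
    assume "l \<noteq> (\<lambda>_. 0)"
    define v where "v = (\<chi> i. complex_of_real (l i))"
    have "v \<noteq> 0" using \<open>l \<noteq> _\<close> by (auto simp: v_def vec_eq_iff)
    moreover have "(\<chi> i j. complex_of_real (P $ i $ j)) *v v = 1 *s v"
      by (simp add: v_def vec_eq_iff matrix_vector_mult_def eq of_real_mult[symmetric] of_real_sum[symmetric] del: of_real_mult of_real_sum)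
    ultimately have "cmod 1 \<in> {cmod z | z. \<exists>v :: complex^'k. v \<noteq> 0 \<and> (\<chi> i j. complex_of_real (P $ i $ j)) *v v = z *s v}"
      by blast
    then have "cmod 1 \<le> spectral_radius P"
      unfolding spectral_radius_def using substochastic_eigenvalue_le_1[OF P]
      by (intro cSup_upper bdd_aboveI[where M=1]) blast+
    then show False using assms(2) by simp
  qed
  then have "\<forall>\<^sub>F k in sequentially. \<forall>i. r k i < 1/2"
    by (intro eventually_all_finite order_tendstoD(2)[OF l]) simp
  then obtain k where k: "\<And>i. r k i < 1/2" using eventually_happens'[OF sequentially_bot] by blast
  have "k > 0" using k[of undefined] by (cases k) (auto simp: r0)
  \<comment> \<open>a truncated Neumann series, so that \<open>P u = u - 1 + P\<^sup>k 1\<close>\<close>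
  define u where "u i = (\<Sum>m<k. r m i)" for i
  have u1: "1 \<le> u i" for i
    using \<open>k > 0\<close> rn r0[of i] member_le_sum[of 0 "{..<k}" "\<lambda>m. r m i"] by (simp add: u_def)
  have uk: "u i \<le> real k" for i
  proof -
    have "r m i \<le> 1" for m using decseqD[OF dec, of 0 m i] by (simp add: r0)
    then show ?thesis unfolding u_def using sum_bounded_above[of "{..<k}" "\<lambda>m. r m i" 1] by simp
  qed
  have "(\<Sum>j\<in>UNIV. P $ i $ j * u j) \<le> (1 - 1 / (2 * real k)) * u i" for i
  proof -
    have "(\<Sum>j\<in>UNIV. P $ i $ j * u j) = (\<Sum>m<k. r (Suc m) i)"
      unfolding u_def rS sum_distrib_left by (rule sum.swap)
    also have "\<dots> = u i - 1 + r k i"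
      using sum.lessThan_Suc_shift[of "\<lambda>m. r m i" k] by (simp add: u_def r0)
    also have "\<dots> \<le> u i - 1/2" using k[of i] by simp
    also have "\<dots> \<le> (1 - 1 / (2 * real k)) * u i" using uk[of i] \<open>k > 0\<close> by (simp add: field_simps)
    finally show ?thesis .
  qed
  then show thesis using u1 \<open>k > 0\<close> by (intro that[of "1 - 1 / (2 * real k)" u]) (auto simp: field_simps)
qed

definition push_level :: "real^'k^'k \<Rightarrow> (real \<Rightarrow> real^'k) \<Rightarrow> (real \<Rightarrow> real^'k) \<Rightarrow> 'k::finite \<Rightarrow> real \<Rightarrow> real" where
  "push_level P \<psi> \<eta> i s = (\<Sum>j\<in>UNIV. P $ j $ i * \<eta> s $ j) - \<psi> s $ i"

text \<open>
  The last condition says that the regulator is the running supremum of the positive part of its push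
  level, which need not be attained when the paths jump.
\<close>

definition reflected :: "real^'k^'k \<Rightarrow> real \<Rightarrow> (real \<Rightarrow> real^'k) \<Rightarrow> (real \<Rightarrow> real^'k::finite) \<Rightarrow> bool" where
  "reflected P T \<psi> \<eta> \<longleftrightarrow> (\<forall>i. 0 \<le> \<eta> 0 $ i \<and> mono_on {0..T} (\<lambda>t. \<eta> t $ i) \<and>
     (\<forall>t\<in>{0..T}. push_level P \<psi> \<eta> i t \<le> \<eta> t $ i \<and>
        (\<forall>e>0. \<exists>s\<in>{0..t}. \<eta> t $ i \<le> max 0 (push_level P \<psi> \<eta> i s) + e)))"

lemma reflected_compare:
  assumes P: "substochastic P" and r: "reflected P T \<psi> \<eta>" "reflected P T \<psi>' \<eta>'"
    and \<psi>: "\<And>s. s \<in> {0..T} \<Longrightarrow> \<bar>\<psi> s $ i - \<psi>' s $ i\<bar> \<le> d"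
    and \<eta>: "\<And>s j. s \<in> {0..T} \<Longrightarrow> \<bar>\<eta> s $ j - \<eta>' s $ j\<bar> \<le> \<delta> j"
    and t: "t \<in> {0..T}"
  shows "\<eta> t $ i - \<eta>' t $ i \<le> (\<Sum>j\<in>UNIV. P $ j $ i * \<delta> j) + d"
proof (rule field_le_epsilon)
  fix e :: real assume "e > 0"
  then obtain s where s: "s \<in> {0..t}" "\<eta> t $ i \<le> max 0 (push_level P \<psi> \<eta> i s) + e"
    using r(1) t unfolding reflected_def by blast
  have Pn: "0 \<le> P $ i $ j" for i j using P by (auto simp: substochastic_def)
  have sT: "s \<in> {0..T}" "0 \<in> {0..T}" "s \<le> t" "0 \<le> t" using s t by auto
  have d0: "0 \<le> d" "0 \<le> \<delta> j" for j using \<psi>[OF sT(1)] \<eta>[OF sT(1), of j] by linarith+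
  have mono: "\<eta>' s $ i \<le> \<eta>' t $ i" "0 \<le> \<eta>' t $ i"
    using r(2) sT t unfolding reflected_def mono_on_def by (blast, meson order_trans)
  have "push_level P \<psi> \<eta> i s - push_level P \<psi>' \<eta>' i s
      = (\<Sum>j\<in>UNIV. P $ j $ i * (\<eta> s $ j - \<eta>' s $ j)) - (\<psi> s $ i - \<psi>' s $ i)"
    by (simp add: push_level_def sum_subtractf right_diff_distrib)
  also have "\<dots> \<le> (\<Sum>j\<in>UNIV. P $ j $ i * \<delta> j) + d"
  proof -
    have "(\<Sum>j\<in>UNIV. P $ j $ i * (\<eta> s $ j - \<eta>' s $ j)) \<le> (\<Sum>j\<in>UNIV. P $ j $ i * \<delta> j)"
      using \<eta>[OF sT(1)] Pn by (intro sum_mono mult_left_mono) (auto simp: abs_le_iff)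
    then show ?thesis using \<psi>[OF sT(1)] by linarith
  qed
  finally have "push_level P \<psi> \<eta> i s \<le> push_level P \<psi>' \<eta>' i s + ((\<Sum>j\<in>UNIV. P $ j $ i * \<delta> j) + d)" by simp
  moreover have "push_level P \<psi>' \<eta>' i s \<le> \<eta>' s $ i" using r(2) sT(1) unfolding reflected_def by blast
  moreover have "0 \<le> (\<Sum>j\<in>UNIV. P $ j $ i * \<delta> j) + d" using d0 Pn by (intro add_nonneg_nonneg sum_nonneg) auto
  ultimately show "\<eta> t $ i - \<eta>' t $ i \<le> (\<Sum>j\<in>UNIV. P $ j $ i * \<delta> j) + d + e"
    using s(2) mono by (simp add: max_def split: if_splits)
qed

lemma contraction_weight_sum_bound:
  fixes u \<delta> :: "'k::finite \<Rightarrow> real"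
  assumes "\<And>i. 0 \<le> \<delta> i" "\<And>i. 1 \<le> u i"
    and g: "\<And>i. (\<Sum>j\<in>UNIV. P $ i $ j * u j) \<le> g * u i"
    and le: "\<And>i. \<epsilon> i \<le> (\<Sum>j\<in>UNIV. P $ j $ i * \<delta> j) + d"
  shows "(\<Sum>i\<in>UNIV. u i * \<epsilon> i) \<le> g * (\<Sum>i\<in>UNIV. u i * \<delta> i) + d * (\<Sum>i\<in>UNIV. u i)"
proof -
  have "(\<Sum>i\<in>UNIV. u i * \<epsilon> i) \<le> (\<Sum>i\<in>UNIV. u i * ((\<Sum>j\<in>UNIV. P $ j $ i * \<delta> j) + d))"
    using assms(2) le by (intro sum_mono mult_left_mono) (auto intro: order_trans[of 0 1])
  also have "\<dots> = (\<Sum>i\<in>UNIV. \<Sum>j\<in>UNIV. P $ j $ i * u i * \<delta> j) + d * (\<Sum>i\<in>UNIV. u i)"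
    by (simp add: distrib_left sum.distrib sum_distrib_left mult_ac)
  also have "(\<Sum>i\<in>UNIV. \<Sum>j\<in>UNIV. P $ j $ i * u i * \<delta> j) = (\<Sum>j\<in>UNIV. (\<Sum>i\<in>UNIV. P $ j $ i * u i) * \<delta> j)"
    by (subst sum.swap) (simp add: sum_distrib_right)
  also have "\<dots> \<le> (\<Sum>j\<in>UNIV. g * u j * \<delta> j)" using assms by (intro sum_mono mult_right_mono) auto
  finally show ?thesis by (simp add: sum_distrib_left mult_ac)
qed

lemma reflected_lipschitz:
  assumes P: "substochastic P" and "0 \<le> g" "g < 1" and u: "\<And>i. 1 \<le> u i"
    and g: "\<And>i. (\<Sum>j\<in>UNIV. P $ i $ j * u j) \<le> g * u i"
    and r: "reflected P T \<psi> \<eta>" "reflected P T \<psi>' \<eta>'"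
    and \<psi>: "\<And>s i. s \<in> {0..T} \<Longrightarrow> \<bar>\<psi> s $ i - \<psi>' s $ i\<bar> \<le> d"
    and t: "t \<in> {0..T}"
  shows "\<bar>\<eta> t $ i - \<eta>' t $ i\<bar> \<le> (\<Sum>j\<in>UNIV. u j) / (1 - g) * d"
proof -
  define \<delta> where "\<delta> i = Sup ((\<lambda>t. \<bar>\<eta> t $ i - \<eta>' t $ i\<bar>) ` {0..T})" for i
  have T: "T \<ge> 0" using t by simp
  have bdd: "bdd_above ((\<lambda>t. \<bar>\<eta> t $ i - \<eta>' t $ i\<bar>) ` {0..T})" for i
  proof (intro bdd_aboveI2)
    fix t assume t: "t \<in> {0..T}"
    have "0 \<le> \<eta> t $ i \<and> \<eta> t $ i \<le> \<eta> T $ i" if "reflected P T \<psi> \<eta>" for \<psi> \<eta>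
    proof -
      have "0 \<le> \<eta> 0 $ i" "mono_on {0..T} (\<lambda>t. \<eta> t $ i)" using that unfolding reflected_def by blast+
      then show ?thesis using t T mono_onD[of "{0..T}" "\<lambda>t. \<eta> t $ i" 0 t] mono_onD[of "{0..T}" "\<lambda>t. \<eta> t $ i" t T] by auto
    qed
    from this[OF r(1)] this[OF r(2)] show "\<bar>\<eta> t $ i - \<eta>' t $ i\<bar> \<le> \<eta> T $ i + \<eta>' T $ i" by linarith
  qed
  have \<delta>: "\<bar>\<eta> t $ i - \<eta>' t $ i\<bar> \<le> \<delta> i" if "t \<in> {0..T}" for t i
    unfolding \<delta>_def using that bdd by (intro cSup_upper) auto
  have \<delta>0: "0 \<le> \<delta> i" for i using order_trans[OF abs_ge_zero \<delta>[OF t]] .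
  have \<delta>le: "\<delta> i \<le> (\<Sum>j\<in>UNIV. P $ j $ i * \<delta> j) + d" for i
    unfolding \<delta>_def[of i]
  proof (intro cSup_least)
    fix x assume "x \<in> (\<lambda>t. \<bar>\<eta> t $ i - \<eta>' t $ i\<bar>) ` {0..T}"
    then obtain s where s: "s \<in> {0..T}" "x = \<bar>\<eta> s $ i - \<eta>' s $ i\<bar>" by blast
    have "\<eta> s $ i - \<eta>' s $ i \<le> (\<Sum>j\<in>UNIV. P $ j $ i * \<delta> j) + d"
      by (rule reflected_compare[OF P r \<psi> \<delta> s(1)])
    moreover have "\<eta>' s $ i - \<eta> s $ i \<le> (\<Sum>j\<in>UNIV. P $ j $ i * \<delta> j) + d"
      by (rule reflected_compare[OF P r(2,1) _ _ s(1)]) (use \<psi> \<delta> in \<open>auto simp: abs_minus_commute\<close>)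
    ultimately show "x \<le> (\<Sum>j\<in>UNIV. P $ j $ i * \<delta> j) + d" using s(2) by linarith
  qed (use T in auto)
  from contraction_weight_sum_bound[of \<delta> u P g \<delta> d, OF \<delta>0 u g \<delta>le]
  have "(1 - g) * (\<Sum>i\<in>UNIV. u i * \<delta> i) \<le> d * (\<Sum>i\<in>UNIV. u i)" by (simp add: algebra_simps)
  then have S: "(\<Sum>i\<in>UNIV. u i * \<delta> i) \<le> (\<Sum>j\<in>UNIV. u j) / (1 - g) * d"
    using \<open>g < 1\<close> by (simp add: field_simps)
  have "\<delta> i \<le> u i * \<delta> i" using mult_right_mono[OF u \<delta>0, of i i] by simp
  also have "\<dots> \<le> (\<Sum>i\<in>UNIV. u i * \<delta> i)"
    using \<delta>0 u by (intro member_le_sum) (auto intro!: mult_nonneg_nonneg intro: order_trans[of 0 1])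
  finally show ?thesis using S \<delta>[OF t, of i] by linarith
qed

lemma reflectedI:
  assumes "\<And>i. \<eta> 0 $ i = 0" and mono: "\<And>i. mono_on {0..T} (\<lambda>t. \<eta> t $ i)"
    and level: "\<And>t i. t \<in> {0..T} \<Longrightarrow> push_level P \<psi> \<eta> i t \<le> \<eta> t $ i"
    and const: "\<And>i a t. 0 \<le> a \<Longrightarrow> a \<le> t \<Longrightarrow> t \<le> T \<Longrightarrow> \<forall>s\<in>{a<..t}. push_level P \<psi> \<eta> i s \<noteq> \<eta> s $ i \<Longrightarrow> \<eta> t $ i \<le> \<eta> a $ i"
    and jump: "\<And>i b t e. 0 < b \<Longrightarrow> b \<le> t \<Longrightarrow> t \<le> T \<Longrightarrow> \<forall>s\<in>{b..t}. push_level P \<psi> \<eta> i s \<noteq> \<eta> s $ i \<Longrightarrow> e > 0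
       \<Longrightarrow> \<exists>a\<in>{0..<b}. \<eta> t $ i \<le> \<eta> a $ i + e"
  shows "reflected P T \<psi> \<eta>"
  unfolding reflected_def
proof (intro allI conjI ballI impI)
  fix i t and e :: real assume t: "t \<in> {0..T}" and e: "e > 0"
  define Z where "Z = {s\<in>{0..t}. push_level P \<psi> \<eta> i s = \<eta> s $ i}"
  show "\<exists>s\<in>{0..t}. \<eta> t $ i \<le> max 0 (push_level P \<psi> \<eta> i s) + e"
  proof (cases "Z = {}")
    case True
    then have "\<eta> t $ i \<le> \<eta> 0 $ i" using t by (intro const) (auto simp: Z_def)
    then show ?thesis using assms(1)[of i] t e by (intro bexI[of _ 0]) auto
  next
    case False
    have bdd: "bdd_above Z" by (auto simp: Z_def)
    define b where "b = Sup Z"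
    have Zb: "z \<le> b" if "z \<in> Z" for z unfolding b_def using that bdd by (rule cSup_upper)
    have bt: "b \<le> t" unfolding b_def using False by (intro cSup_least) (auto simp: Z_def)
    have b0: "0 \<le> b" using False Zb by (force simp: Z_def)
    show ?thesis
    proof (cases "b \<in> Z")
      case True
      have "s \<notin> Z" if "s \<in> {b<..t}" for s using Zb[of s] that by auto
      then have "\<eta> t $ i \<le> \<eta> b $ i" using t bt b0 by (intro const) (auto simp: Z_def)
      then show ?thesis using True e by (intro bexI[of _ b]) (auto simp: Z_def)
    next
      case nZ: False
      have "s \<notin> Z" if "s \<in> {b..t}" for s using Zb[of s] that nZ by (cases "s = b") auto
      moreover obtain z0 where "z0 \<in> Z" using False by blast
      then have "0 < b" using Zb[of z0] nZ by (cases "z0 = b") (auto simp: Z_def)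
      ultimately obtain a where a: "a \<in> {0..<b}" "\<eta> t $ i \<le> \<eta> a $ i + e"
        using jump[of b t i e] bt t e by (auto simp: Z_def)
      obtain z where z: "z \<in> Z" "a < z" using less_cSupD[of Z a] False a(1) by (auto simp: b_def)
      have "\<eta> a $ i \<le> \<eta> z $ i" using z a t by (intro mono_onD[OF mono]) (auto simp: Z_def)
      then show ?thesis using z a by (intro bexI[of _ z]) (auto simp: Z_def)
    qed
  qed
qed (use assms(1) mono level in auto)

lemma push_level_reflection:
  "\<psi> s $ i + (reflection_matrix P *v \<eta> s) $ i = \<eta> s $ i - push_level P \<psi> \<eta> i s"
  by (simp add: reflection_matrix_nth push_level_def)

lemma skorohod_problem_reflected:
  assumes sp: "skorohod_problem (reflection_matrix P) \<psi> \<phi> \<eta>"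
  shows "reflected P T (path_of \<psi>) (path_of \<eta>)"
proof -
  have eq: "path_of \<phi> t $ i = path_of \<eta> t $ i - push_level P (path_of \<psi>) (path_of \<eta>) i t" if "t \<ge> 0" for t i
    using sp that unfolding skorohod_problem_def push_level_reflection[symmetric] by simp
  have eta0: "path_of \<eta> 0 $ i = 0" and mono: "mono_on {0..} (\<lambda>t. path_of \<eta> t $ i)"
    and null: "(\<integral>\<^sup>+s\<in>{0..}. indicator {s. path_of \<phi> s $ i \<noteq> 0} s
            \<partial>interval_measure (\<lambda>t. path_of \<eta> t $ i)) = 0" for i
    using sp unfolding skorohod_problem_def by blast+
  have nn: "path_of \<phi> t $ i \<ge> 0" if "t \<ge> 0" for t i
    using sp that unfolding skorohod_problem_def orthant_def by blast
  define F where "F i t = path_of \<eta> t $ i" for i t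
  define \<mu> where "\<mu> i = interval_measure (F i)" for i
  have Fmono: "F i s \<le> F i t" if "s \<le> t" for i s t
  proof (cases "s \<ge> 0")
    case True then show ?thesis using mono_onD[OF mono, of s t i] that by (simp add: F_def)
  next
    case False
    then have "F i s = F i 0" using path_of_nonpos[of s \<eta>] by (simp add: F_def)
    also have "\<dots> \<le> F i t"
    proof (cases "t \<ge> 0")
      case True then show ?thesis using mono_onD[OF mono, of 0 t i] by (simp add: F_def)
    next
      case False then show ?thesis using path_of_nonpos[of t \<eta>] by (simp add: F_def)
    qed
    finally show ?thesis .
  qed
  have Frc: "continuous (at_right a) (F i)" for a i
  proof (cases "a \<ge> 0")
    case True
    then show ?thesis unfolding continuous_within F_def
      by (intro tendsto_intros cadlag_at_right[OF path_of_cadlag])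
  next
    case False
    then have "eventually (\<lambda>u. u \<in> {a<..<0}) (at_right a)" by (intro eventually_at_right_real) auto
    then have "eventually (\<lambda>u. F i u = F i a) (at_right a)"
    proof eventually_elim
      case (elim u)
      then show ?case using False path_of_nonpos[of u \<eta>] path_of_nonpos[of a \<eta>] by (simp add: F_def)
    qed
    then show ?thesis unfolding continuous_within by (rule tendsto_eventually)
  qed
  have Ioc: "emeasure (\<mu> i) {a<..b} = ennreal (F i b - F i a)" if "a \<le> b" for i a b
    unfolding \<mu>_def using that Fmono Frc by (intro emeasure_interval_measure_Ioc) auto
  have sets_mu [measurable_cong]: "sets (\<mu> i) = sets borel" for i by (simp add: \<mu>_def)
  have meas: "{0..} \<inter> {s. path_of \<phi> s $ i \<noteq> 0} \<in> sets borel" for i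
  proof -
    have [measurable]: "(\<lambda>s. path_of \<phi> s $ i) \<in> borel_measurable borel"
      by (rule measurable_compose[OF path_of_borel]) simp
    have "{0..} \<inter> {s. path_of \<phi> s $ i \<noteq> 0} = {s\<in>space borel. s \<in> {0..} \<and> path_of \<phi> s $ i \<noteq> 0}" by auto
    also have "\<dots> \<in> sets borel" by measurable
    finally show ?thesis .
  qed
  have null': "emeasure (\<mu> i) ({0..} \<inter> {s. path_of \<phi> s $ i \<noteq> 0}) = 0" for i
  proof -
    have "(\<integral>\<^sup>+s. indicator ({0..} \<inter> {s. path_of \<phi> s $ i \<noteq> 0}) s \<partial>\<mu> i) = 0"
      using null[of i] unfolding \<mu>_def F_def by (simp add: indicator_inter_arith mult.commute)
    then show ?thesis using meas by (simp add: sets_mu)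
  qed
  have zero: "emeasure (\<mu> i) A = 0" if "A \<subseteq> {0..} \<inter> {s. path_of \<phi> s $ i \<noteq> 0}" for A i
    using emeasure_mono[OF that, of "\<mu> i"] null'[of i] meas[of i] by (simp add: sets_mu)
  show ?thesis
  proof (rule reflectedI)
    show "path_of \<eta> 0 $ i = 0" for i by (rule eta0)
    show "mono_on {0..T} (\<lambda>t. path_of \<eta> t $ i)" for i using mono by (rule mono_on_subset) auto
    show "push_level P (path_of \<psi>) (path_of \<eta>) i t \<le> path_of \<eta> t $ i" if "t \<in> {0..T}" for i t
      using eq[of t i] nn[of t i] that by simp
  next
    fix i a t assume a: "0 \<le> a" "a \<le> t" "\<forall>s\<in>{a<..t}. push_level P (path_of \<psi>) (path_of \<eta>) i s \<noteq> path_of \<eta> s $ i"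
    have "emeasure (\<mu> i) {a<..t} = 0"
      by (rule zero) (use a eq in auto)
    then show "path_of \<eta> t $ i \<le> path_of \<eta> a $ i" using Ioc[of a t i] a(2) by (simp add: F_def ennreal_eq_0_iff)
  next
    fix i b t and e :: real assume b: "0 < b" "b \<le> t" "\<forall>s\<in>{b..t}. push_level P (path_of \<psi>) (path_of \<eta>) i s \<noteq> path_of \<eta> s $ i" "e > 0"
    define A where "A n = {b - b / real (Suc n)<..t}" for n
    have bn: "0 \<le> b - b / real (Suc n)" "b - b / real (Suc n) < b" for n using b(1) by (auto simp: field_simps)
    have le: "b - b / real (Suc n) \<le> t" for n using bn(2)[of n] b by linarith
    have "decseq A"
    proof (rule decseq_SucI)
      show "A (Suc n) \<subseteq> A n" for n
        unfolding A_def using b(1) frac_le[of b b "real (Suc n)" "real (Suc (Suc n))"] by auto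
    qed
    then have "(\<lambda>n. emeasure (\<mu> i) (A n)) \<longlonglongrightarrow> emeasure (\<mu> i) (\<Inter>n. A n)"
    proof (rule Lim_emeasure_decseq[rotated])
      show "range A \<subseteq> sets (\<mu> i)" by (auto simp: A_def sets_mu)
      show "emeasure (\<mu> i) (A n) \<noteq> \<infinity>" for n unfolding A_def using Ioc[OF le] by simp
    qed
    note lim = this
    have "(\<Inter>n. A n) \<subseteq> {b..t}"
    proof
      fix x assume "x \<in> (\<Inter>n. A n)"
      then have x: "b - b / real (Suc n) < x" "x \<le> t" for n by (auto simp: A_def)
      have "(\<lambda>n. b - b * (1 / real (Suc n))) \<longlonglongrightarrow> b - b * 0" by (intro tendsto_intros LIMSEQ_Suc[OF lim_1_over_n])
      then have "b \<le> x" using x by (intro LIMSEQ_le_const2[of _ b x]) (auto intro: less_imp_le)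
      then show "x \<in> {b..t}" using x by simp
    qed
    moreover have "{b..t} \<subseteq> {0..} \<inter> {s. path_of \<phi> s $ i \<noteq> 0}"
    proof
      fix s assume "s \<in> {b..t}"
      then have "s \<ge> 0" "push_level P (path_of \<psi>) (path_of \<eta>) i s \<noteq> path_of \<eta> s $ i" using b(1,3) by auto
      then show "s \<in> {0..} \<inter> {s. path_of \<phi> s $ i \<noteq> 0}" using eq[of s i] by simp
    qed
    ultimately have "emeasure (\<mu> i) (\<Inter>n. A n) = 0"
      by (rule zero[OF order_trans])
    with lim have "(\<lambda>n. ennreal (F i t - F i (b - b / real (Suc n)))) \<longlonglongrightarrow> 0"
      unfolding A_def using Ioc[OF le] by simp
    then have "\<forall>\<^sub>F n in sequentially. ennreal (F i t - F i (b - b / real (Suc n))) < ennreal e"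
      by (rule order_tendstoD(2)) (use b(4) in simp)
    then obtain n where "ennreal (F i t - F i (b - b / real (Suc n))) < ennreal e"
      using eventually_happens'[OF sequentially_bot] by blast
    then have "F i t - F i (b - b / real (Suc n)) < e"
      using Fmono[OF le] by (simp add: ennreal_less_iff)
    then show "\<exists>a\<in>{0..<b}. path_of \<eta> t $ i \<le> path_of \<eta> a $ i + e"
      using bn[of n] unfolding F_def by (intro bexI[of _ "b - b / real (Suc n)"]) auto
  qed
qed

definition running_max :: "(real \<Rightarrow> real) \<Rightarrow> real \<Rightarrow> real" where
  "running_max h t = Sup ((\<lambda>s. max 0 (h s)) ` {0..t})"

lemma running_max_props:
  assumes h: "continuous_on {0..} h" and t: "0 \<le> t"
  shows running_max_upper: "s \<in> {0..t} \<Longrightarrow> max 0 (h s) \<le> running_max h t"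
    and running_max_attained: "\<exists>s\<in>{0..t}. running_max h t = max 0 (h s)"
proof -
  have "continuous_on {0..t} (\<lambda>s. max 0 (h s))"
    by (intro continuous_intros continuous_on_subset[OF h]) auto
  then obtain s where s: "s \<in> {0..t}" "\<And>r. r \<in> {0..t} \<Longrightarrow> max 0 (h r) \<le> max 0 (h s)"
    using continuous_attains_sup[of "{0..t}" "\<lambda>s. max 0 (h s)"] t by auto
  have "running_max h t = max 0 (h s)" unfolding running_max_def using s by (intro cSup_eq_maximum) auto
  then show "s \<in> {0..t} \<Longrightarrow> max 0 (h s) \<le> running_max h t" for s using s by simp
  show "\<exists>s\<in>{0..t}. running_max h t = max 0 (h s)" using s \<open>running_max h t = _\<close> by blast
qed

lemma running_max_mono:
  assumes h: "continuous_on {0..} h" and "0 \<le> s" "s \<le> t"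
  shows "running_max h s \<le> running_max h t"
  using running_max_attained[OF h \<open>0 \<le> s\<close>] running_max_upper[OF h order_trans[OF assms(2,3)]] assms(3)
  by (metis atLeastAtMost_iff order_trans)

lemma running_max_lipschitz:
  assumes h: "continuous_on {0..} h" "continuous_on {0..} h'" and t: "0 \<le> t"
    and d: "\<And>s. s \<in> {0..t} \<Longrightarrow> \<bar>h s - h' s\<bar> \<le> d"
  shows "\<bar>running_max h t - running_max h' t\<bar> \<le> d"
proof -
  have "running_max h t \<le> running_max h' t + d"
    if h: "continuous_on {0..} h" "continuous_on {0..} h'" and d: "\<And>s. s \<in> {0..t} \<Longrightarrow> \<bar>h s - h' s\<bar> \<le> d" for h h'
  proof -
    obtain s where s: "s \<in> {0..t}" "running_max h t = max 0 (h s)" using running_max_attained[OF h(1) t] by blast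
    have "max 0 (h s) \<le> max 0 (h' s) + d" using d[OF s(1)] by (auto simp: max_def)
    then show ?thesis using running_max_upper[OF h(2) t s(1)] s(2) by linarith
  qed
  from this[OF h d] this[OF h(2,1)] d show ?thesis by (force simp: abs_le_iff abs_minus_commute)
qed

lemma running_max_continuous:
  assumes h: "continuous_on {0..} h"
  shows "continuous_on {0..} (running_max h)"
  unfolding continuous_on_iff
proof (intro ballI allI impI)
  fix t e :: real assume t: "t \<in> {0..}" and e: "e > 0"
  then obtain d where d: "d > 0" "\<And>s. s \<in> {0..} \<Longrightarrow> dist s t < d \<Longrightarrow> dist (h s) (h t) < e/3"
    using h unfolding continuous_on_iff by (metis divide_pos_pos zero_less_numeral)
  have "\<bar>running_max h s - running_max h t\<bar> < e" if s: "s \<in> {0..}" "dist s t < d" for s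
  proof -
    define a b where "a = min s t" and "b = max s t"
    have ab: "0 \<le> a" "a \<le> b" using s t by (auto simp: a_def b_def)
    obtain r where r: "r \<in> {0..b}" "running_max h b = max 0 (h r)" using running_max_attained[OF h, of b] ab by auto
    have "running_max h b \<le> running_max h a + 2 * e / 3"
    proof (cases "r \<le> a")
      case True
      then show ?thesis using running_max_upper[OF h ab(1), of r] r e by simp
    next
      case False
      have "dist r t < d" "dist a t < d" using r False s by (auto simp: a_def b_def dist_real_def)
      then have "dist (h r) (h t) < e/3" "dist (h a) (h t) < e/3" using d(2) r ab by auto
      then have "h r \<le> h a + 2 * e / 3" unfolding dist_real_def by linarith
      then show ?thesis using running_max_upper[OF h ab(1), of a] ab r e by auto
    qed
    moreover have "running_max h a \<le> running_max h b" by (rule running_max_mono[OF h ab])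
    ultimately show ?thesis using e unfolding a_def b_def by (cases "s \<le> t") (auto simp: min_def max_def)
  qed
  then show "\<exists>d>0. \<forall>s\<in>{0..}. dist s t < d \<longrightarrow> dist (running_max h s) (running_max h t) < e"
    using d(1) unfolding dist_real_def by blast
qed

definition reflection_step :: "real^'k^'k \<Rightarrow> (real \<Rightarrow> real^'k) \<Rightarrow> (real \<Rightarrow> real^'k) \<Rightarrow> real \<Rightarrow> real^'k::finite" where
  "reflection_step P \<psi> \<eta> t = (\<chi> i. running_max (push_level P \<psi> \<eta> i) t)"

lemma continuous_push_level:
  assumes "continuous_on {0..} \<psi>" "continuous_on {0..} \<eta>"
  shows "continuous_on {0..} (push_level P \<psi> \<eta> i)"
  unfolding push_level_def using assms by (intro continuous_intros)

lemma continuous_reflection_step: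
  assumes "continuous_on {0..} \<psi>" "continuous_on {0..} \<eta>"
  shows "continuous_on {0..} (reflection_step P \<psi> \<eta>)"
  unfolding reflection_step_def
  by (intro continuous_on_vec_lambda running_max_continuous continuous_push_level assms)

lemma reflection_step_lipschitz:
  assumes P: "substochastic P" and \<psi>: "continuous_on {0..} \<psi>"
    and c: "continuous_on {0..} \<eta>" "continuous_on {0..} \<eta>'"
    and \<delta>: "\<And>s j. s \<in> {0..t} \<Longrightarrow> \<bar>\<eta> s $ j - \<eta>' s $ j\<bar> \<le> \<delta> j" and t: "0 \<le> t"
  shows "\<bar>reflection_step P \<psi> \<eta> t $ i - reflection_step P \<psi> \<eta>' t $ i\<bar> \<le> (\<Sum>j\<in>UNIV. P $ j $ i * \<delta> j)"
proof -
  have "\<bar>push_level P \<psi> \<eta> i s - push_level P \<psi> \<eta>' i s\<bar> \<le> (\<Sum>j\<in>UNIV. P $ j $ i * \<delta> j)" if s: "s \<in> {0..t}" for s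
  proof -
    have "push_level P \<psi> \<eta> i s - push_level P \<psi> \<eta>' i s = (\<Sum>j\<in>UNIV. P $ j $ i * (\<eta> s $ j - \<eta>' s $ j))"
      by (simp add: push_level_def sum_subtractf right_diff_distrib)
    also have "\<bar>\<dots>\<bar> \<le> (\<Sum>j\<in>UNIV. \<bar>P $ j $ i * (\<eta> s $ j - \<eta>' s $ j)\<bar>)" by (rule sum_abs)
    also have "\<dots> \<le> (\<Sum>j\<in>UNIV. P $ j $ i * \<delta> j)"
      using P \<delta>[OF s] by (intro sum_mono) (auto simp: abs_mult substochastic_def intro!: mult_left_mono)
    finally show ?thesis .
  qed
  then show ?thesis
    unfolding reflection_step_def vec_lambda_beta
    by (intro running_max_lipschitz continuous_push_level \<psi> c t)
qed

lemma continuous_on_atLeast_0: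
  fixes f :: "real \<Rightarrow> 'a::topological_space"
  assumes "\<And>T. T \<ge> 0 \<Longrightarrow> continuous_on {0..T} f"
  shows "continuous_on {0..} f"
  unfolding continuous_on_eq_continuous_within
proof
  fix t :: real assume t: "t \<in> {0..}"
  have "continuous (at t within {0..t+1}) f" using assms[of "t+1"] t by (simp add: continuous_on_eq_continuous_within)
  moreover have "at t within {0..t+1} = at t within {0..}"
    by (rule at_within_nhd[where S="{..<t+1}"]) auto
  ultimately show "continuous (at t within {0..}) f" by simp
qed

lemma reflection_fixpoint_exists:
  fixes P :: "real^'k^'k::finite"
  assumes P: "substochastic P" "spectral_radius P < 1" and \<psi>: "continuous_on {0..} \<psi>" "\<psi> 0 \<in> orthant"
  obtains \<eta> where "continuous_on {0..} \<eta>" "\<eta> 0 = 0" "\<And>t. t \<ge> 0 \<Longrightarrow> \<eta> t = reflection_step P \<psi> \<eta> t"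
proof -
  obtain u g where g: "0 \<le> g" "g < 1" and u: "\<And>i::'k. 1 \<le> u i" "\<And>i. (\<Sum>j\<in>UNIV. P $ i $ j * u j) \<le> g * u i"
    by (rule substochastic_contraction_weight[OF P]) blast
  have Pn: "0 \<le> P $ i $ j" for i j using P(1) by (auto simp: substochastic_def)
  define E where "E = rec_nat (\<lambda>_. 0) (\<lambda>_ \<eta>. reflection_step P \<psi> \<eta>)"
  have E0: "E 0 = (\<lambda>t. 0)" and ES: "E (Suc k) = reflection_step P \<psi> (E k)" for k by (simp_all add: E_def)
  have Ec: "continuous_on {0..} (E k)" for k
    by (induction k) (auto simp: ES E0 continuous_reflection_step \<psi>)
  have Ezero: "E k 0 = 0" for k
  proof (induction k)
    case (Suc k)
    have "push_level P \<psi> (E k) i 0 \<le> 0" for i using \<psi>(2) Suc by (simp add: push_level_def orthant_def)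
    then have "max 0 (push_level P \<psi> (E k) i 0) = 0" for i by (simp add: max_absorb1)
    then show ?case by (simp add: ES reflection_step_def running_max_def vec_eq_iff)
  qed (simp add: E0)
  define \<eta> where "\<eta> t = (\<Sum>k. E (Suc k) t - E k t)" for t
  have ulim: "uniform_limit {0..T} E \<eta> sequentially" if T: "T \<ge> 0" for T
  proof -
    have "bounded (E 1 ` {0..T})"
      using Ec[of 1] by (intro compact_imp_bounded compact_continuous_image continuous_on_subset[OF Ec]) auto
    then obtain c where "\<forall>x\<in>E 1 ` {0..T}. norm x \<le> c" unfolding bounded_iff by blast
    then have c: "norm (E 1 t) \<le> c" if "t \<in> {0..T}" for t using that by blast
    have c0: "0 \<le> c" using order_trans[OF norm_ge_zero c[of 0]] T by simp
    define D where "D = rec_nat (\<lambda>_. c) (\<lambda>_ d i. \<Sum>j\<in>UNIV. P $ j $ i * d j)"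
    have D0: "D 0 i = c" and DS: "D (Suc k) i = (\<Sum>j\<in>UNIV. P $ j $ i * D k j)" for i k by (simp_all add: D_def)
    have Dn: "0 \<le> D k i" for k i by (induction k arbitrary: i) (auto simp: D0 DS c0 Pn intro!: sum_nonneg mult_nonneg_nonneg)
    have ED: "\<bar>E (Suc k) t $ i - E k t $ i\<bar> \<le> D k i" if "t \<in> {0..T}" for k t i
      using that
    proof (induction k arbitrary: t i)
      case 0
      then show ?case using c[of t] component_le_norm_cart[of "E 1 t" i] by (simp add: E0 D0)
    next
      case (Suc k)
      have "\<bar>reflection_step P \<psi> (E (Suc k)) t $ i - reflection_step P \<psi> (E k) t $ i\<bar> \<le> (\<Sum>j\<in>UNIV. P $ j $ i * D k j)"
        by (rule reflection_step_lipschitz[OF P(1) \<psi>(1) Ec Ec]) (use Suc in auto)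
      then show ?case by (simp add: ES DS)
    qed
    define U where "U = (\<Sum>i\<in>UNIV. u i * c)"
    have DU: "(\<Sum>i\<in>UNIV. u i * D k i) \<le> g ^ k * U" for k
    proof (induction k)
      case 0 show ?case by (simp add: D0 U_def)
    next
      case (Suc k)
      have "(\<Sum>i\<in>UNIV. u i * D (Suc k) i) \<le> g * (\<Sum>i\<in>UNIV. u i * D k i) + 0 * (\<Sum>i\<in>UNIV. u i)"
        by (rule contraction_weight_sum_bound[where P=P]) (use Dn u DS in auto)
      also have "\<dots> \<le> g * (g ^ k * U)" using mult_left_mono[OF Suc g(1)] by simp
      finally show ?case by (simp add: mult_ac)
    qed
    have "norm (E (Suc k) t - E k t) \<le> g ^ k * U" if "t \<in> {0..T}" for k t
    proof -
      have "norm (E (Suc k) t - E k t) \<le> (\<Sum>i\<in>UNIV. \<bar>(E (Suc k) t - E k t) $ i\<bar>)" by (rule norm_le_l1_cart)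
      also have "\<dots> \<le> (\<Sum>i\<in>UNIV. u i * D k i)"
      proof (rule sum_mono)
        fix i
        have "\<bar>(E (Suc k) t - E k t) $ i\<bar> \<le> D k i" using ED[OF that] by simp
        also have "\<dots> \<le> u i * D k i" using mult_right_mono[OF u(1)[of i] Dn[of k i]] by simp
        finally show "\<bar>(E (Suc k) t - E k t) $ i\<bar> \<le> u i * D k i" .
      qed
      finally show ?thesis using DU[of k] by linarith
    qed
    moreover have "summable (\<lambda>k. g ^ k * U)" using g by (intro summable_mult2 summable_geometric) simp
    ultimately have "uniform_limit {0..T} (\<lambda>n t. \<Sum>k<n. E (Suc k) t - E k t) \<eta> sequentially"
      unfolding \<eta>_def by (intro Weierstrass_m_test)
    moreover have "(\<lambda>n t. \<Sum>k<n. E (Suc k) t - E k t) = E"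
    proof (intro ext)
      show "(\<Sum>k<n. E (Suc k) t - E k t) = E n t" for n t
        using sum_lessThan_telescope[of "\<lambda>k. E k t" n] by (simp add: E0)
    qed
    ultimately show ?thesis by simp
  qed
  have \<eta>c: "continuous_on {0..T} \<eta>" if "T \<ge> 0" for T
    by (rule uniform_limit_theorem[OF _ ulim[OF that]]) (auto intro!: always_eventually continuous_on_subset[OF Ec])
  have cont: "continuous_on {0..} \<eta>"
    by (rule continuous_on_atLeast_0[OF \<eta>c])
  have pt: "(\<lambda>k. E k t) \<longlonglongrightarrow> \<eta> t" if "t \<ge> 0" for t
    using tendsto_uniform_limitI[OF ulim[OF that], of t] that by simp
  have "\<eta> t = reflection_step P \<psi> \<eta> t" if t: "t \<ge> 0" for t
  proof (rule LIMSEQ_unique)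
    show "(\<lambda>k. E (Suc k) t) \<longlonglongrightarrow> \<eta> t" by (rule LIMSEQ_Suc[OF pt[OF t]])
    show "(\<lambda>k. E (Suc k) t) \<longlonglongrightarrow> reflection_step P \<psi> \<eta> t"
    proof (rule vec_tendstoI, rule LIMSEQ_I)
      fix i and e :: real assume e: "e > 0"
      define C where "C = (\<Sum>j\<in>UNIV. P $ j $ i)"
      have C: "0 \<le> C" unfolding C_def by (intro sum_nonneg Pn)
      have "\<forall>\<^sub>F k in sequentially. \<forall>s\<in>{0..t}. dist (E k s) (\<eta> s) < e / (C + 1)"
        using ulim[OF t] e C by (simp add: uniform_limit_iff)
      then obtain N where N: "\<And>k s. k \<ge> N \<Longrightarrow> s \<in> {0..t} \<Longrightarrow> dist (E k s) (\<eta> s) < e / (C + 1)"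
        unfolding eventually_sequentially by blast
      have "norm (E (Suc k) t $ i - reflection_step P \<psi> \<eta> t $ i) < e" if "k \<ge> N" for k
      proof -
        have "\<bar>E k s $ j - \<eta> s $ j\<bar> \<le> e / (C + 1)" if "s \<in> {0..t}" for s j
          using N[OF \<open>k \<ge> N\<close> that] component_le_norm_cart[of "E k s - \<eta> s" j] by (simp add: dist_norm)
        then have "\<bar>E (Suc k) t $ i - reflection_step P \<psi> \<eta> t $ i\<bar> \<le> (\<Sum>j\<in>UNIV. P $ j $ i * (e / (C + 1)))"
          unfolding ES by (intro reflection_step_lipschitz P \<psi> Ec cont t)
        also have "\<dots> = C * (e / (C + 1))" unfolding C_def by (rule sum_distrib_right[symmetric])
        also have "\<dots> < e" using C e by (simp add: field_simps)
        finally show ?thesis by simp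
      qed
      then show "\<exists>no. \<forall>k\<ge>no. norm (E (Suc k) t $ i - reflection_step P \<psi> \<eta> t $ i) < e" by blast
    qed
  qed
  moreover have "\<eta> 0 = 0" using LIMSEQ_unique[OF pt[of 0]] Ezero by simp
  ultimately show thesis using that cont by blast
qed

lemma skorohod_problem_exists:
  fixes P :: "real^'k^'k::finite"
  assumes P: "substochastic P" "spectral_radius P < 1"
    and \<psi>: "continuous_on {0..} (path_of \<psi>)" "path_of \<psi> 0 \<in> orthant"
  shows "\<exists>\<phi> \<eta>. skorohod_problem (reflection_matrix P) \<psi> \<phi> \<eta>"
proof -
  obtain \<eta> where \<eta>: "continuous_on {0..} \<eta>" "\<eta> 0 = 0"
      "\<And>t. t \<ge> 0 \<Longrightarrow> \<eta> t = reflection_step P (path_of \<psi>) \<eta> t"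
    using reflection_fixpoint_exists[OF P \<psi>] by blast
  define \<phi> where "\<phi> t = path_of \<psi> t + reflection_matrix P *v \<eta> t" for t
  have \<phi>c: "continuous_on {0..} \<phi>"
    unfolding \<phi>_def
    by (intro continuous_on_add \<psi>(1) continuous_on_compose2[OF matrix_vector_mult_linear_continuous_on \<eta>(1)]) auto
  define h where "h i = push_level P (path_of \<psi>) \<eta> i" for i
  have hc: "continuous_on {0..} (h i)" for i unfolding h_def by (intro continuous_push_level \<psi> \<eta>(1))
  have \<eta>h: "\<eta> t $ i = running_max (h i) t" if "t \<ge> 0" for t i
    by (subst \<eta>(3)[OF that]) (simp add: reflection_step_def h_def)
  have \<phi>h: "\<phi> t $ i = \<eta> t $ i - h i t" for t i
    unfolding \<phi>_def h_def vector_add_component by (rule push_level_reflection)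
  have p\<eta>: "path_of (to_skorohod \<eta>) t = \<eta> t" and p\<phi>: "path_of (to_skorohod \<phi>) t = \<phi> t" if "t \<ge> 0" for t
    using that cadlag_continuous[OF \<eta>(1)] cadlag_continuous[OF \<phi>c] by (simp_all add: path_of_to_skorohod)
  have "skorohod_problem (reflection_matrix P) \<psi> (to_skorohod \<phi>) (to_skorohod \<eta>)"
    unfolding skorohod_problem_def
  proof (intro conjI allI impI)
    fix t :: real assume t: "t \<ge> 0"
    show "path_of (to_skorohod \<phi>) t = path_of \<psi> t + reflection_matrix P *v path_of (to_skorohod \<eta>) t"
      using t by (simp add: p\<eta> p\<phi> \<phi>_def)
    have "h i t \<le> \<eta> t $ i" for i
      using running_max_upper[OF hc t, of t i] t by (simp add: \<eta>h)
    then show "path_of (to_skorohod \<phi>) t \<in> orthant" using t by (simp add: p\<phi> orthant_def \<phi>h)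
  next
    fix i
    show "path_of (to_skorohod \<eta>) 0 $ i = 0" by (simp add: p\<eta> \<eta>(2))
    show "mono_on {0..} (\<lambda>t. path_of (to_skorohod \<eta>) t $ i)"
      by (intro mono_onI) (simp add: p\<eta> \<eta>h running_max_mono[OF hc])
    define F where "F t = path_of (to_skorohod \<eta>) t $ i" for t
    define A where "A = {s. path_of (to_skorohod \<phi>) s $ i \<noteq> 0}"
    have Fpos: "F t = running_max (h i) (max 0 t)" for t
      using path_of_nonpos[of t "to_skorohod \<eta>"] by (cases "t \<le> 0") (simp_all add: F_def p\<eta> \<eta>h max_def)
    have Apos: "s \<in> A \<longleftrightarrow> \<phi> (max 0 s) $ i \<noteq> 0" for s
      using path_of_nonpos[of s "to_skorohod \<phi>"] by (cases "s \<le> 0") (simp_all add: A_def p\<phi> max_def)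
    have c0: "continuous_on UNIV (\<lambda>t. max (0::real) t)" by (intro continuous_intros)
    have "continuous_on UNIV (\<lambda>s. \<phi> (max 0 s) $ i)"
      by (intro continuous_on_component continuous_on_compose2[OF \<phi>c c0]) auto
    moreover have "A = {s. \<phi> (max 0 s) $ i \<noteq> 0}" using Apos by auto
    ultimately have "open A" using open_Collect_neq[of "\<lambda>s. \<phi> (max 0 s) $ i" "\<lambda>_. 0"] by simp
    have Fmono: "F s \<le> F t" if "s \<le> t" for s t
      unfolding Fpos using that by (intro running_max_mono[OF hc]) auto
    have "continuous_on UNIV F"
      unfolding Fpos by (intro continuous_on_compose2[OF running_max_continuous[OF hc] c0]) auto
    then have Frc: "continuous (at_right a) F" for a
      by (meson UNIV_I continuous_at_imp_continuous_at_within continuous_on_eq_continuous_at open_UNIV)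
    have Fconst: "F a = F b" if ab: "a \<le> b" "{a..b} \<subseteq> A" for a b
    proof (rule ccontr)
      assume "F a \<noteq> F b"
      then have lt: "F a < F b" using Fmono[OF ab(1)] by simp
      obtain s where s: "s \<in> {0..max 0 b}" "F b = max 0 (h i s)"
        using running_max_attained[OF hc, of "max 0 b" i] unfolding Fpos by auto
      have "0 \<le> F a" unfolding Fpos using running_max_upper[OF hc, of "max 0 a" 0 i] by simp
      then have hs: "F b = h i s" "0 < F b" using s(2) lt by (auto simp: max_def split: if_splits)
      have "\<not> s \<le> max 0 a"
      proof
        assume "s \<le> max 0 a"
        then have "F b \<le> F a" using running_max_upper[OF hc, of "max 0 a" s i] s unfolding Fpos by auto
        then show False using lt by simp
      qed
      then have sab: "s \<in> {a..b}" "s > 0" using s(1) by (auto simp: max_def split: if_splits)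
      have "F s \<le> F b" using sab by (intro Fmono) auto
      moreover have "h i s \<le> F s" using running_max_upper[OF hc, of s s i] sab unfolding Fpos by simp
      ultimately have "\<phi> s $ i = 0" using hs sab by (simp add: \<phi>h \<eta>h Fpos max_def split: if_splits)
      then show False using ab(2) sab Apos[of s] by auto
    qed
    define I where "I = {(a, b). a \<in> \<rat> \<and> b \<in> \<rat> \<and> a \<le> b \<and> {a..b} \<subseteq> A}"
    have "countable I" by (rule countable_subset[of _ "\<rat> \<times> \<rat>"]) (auto simp: I_def countable_rat)
    have null: "{fst p<..snd p} \<in> null_sets (interval_measure F)" if "p \<in> I" for p
      using that Fconst Fmono Frc unfolding I_def null_sets_def
      by (auto simp: emeasure_interval_measure_Ioc)
    have "A \<subseteq> (\<Union>p\<in>I. {fst p<..snd p})"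
    proof
      fix s assume "s \<in> A"
      then obtain e where e: "e > 0" "ball s e \<subseteq> A" using \<open>open A\<close> open_contains_ball by blast
      obtain a where a: "a \<in> \<rat>" "s - e < a" "a < s" using Rats_dense_in_real[of "s - e" s] e by auto
      obtain b where b: "b \<in> \<rat>" "s < b" "b < s + e" using Rats_dense_in_real[of s "s + e"] e by auto
      have "{a..b} \<subseteq> ball s e" using a b by (auto simp: dist_real_def)
      then have "(a, b) \<in> I" using a b e by (auto simp: I_def)
      moreover have "s \<in> {a<..b}" using a b by simp
      ultimately show "s \<in> (\<Union>p\<in>I. {fst p<..snd p})" by force
    qed
    moreover have "(\<Union>p\<in>I. {fst p<..snd p}) \<in> null_sets (interval_measure F)"
      using \<open>countable I\<close> null by (rule null_sets_UN')
    moreover have "{0..} \<inter> A \<in> sets (interval_measure F)" using \<open>open A\<close> by simp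
    ultimately have "{0..} \<inter> A \<in> null_sets (interval_measure F)"
      by (meson Int_lower2 null_sets_subset order_trans)
    then have "(\<integral>\<^sup>+s. indicator ({0..} \<inter> A) s \<partial>interval_measure F) = 0"
      by (simp add: null_sets_def)
    then show "(\<integral>\<^sup>+s\<in>{0..}. indicator {s. path_of (to_skorohod \<phi>) s $ i \<noteq> 0} s
            \<partial>interval_measure (\<lambda>t. path_of (to_skorohod \<eta>) t $ i)) = 0"
      unfolding A_def F_def by (simp add: indicator_inter_arith mult.commute)
  qed
  then show ?thesis by blast
qed

lemma skorohod_map_solves:
  fixes P :: "real^'k^'k::finite"
  assumes P: "substochastic P" "spectral_radius P < 1"
    and \<psi>: "continuous_on {0..} (path_of \<psi>)" "path_of \<psi> 0 \<in> orthant"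
  shows "\<exists>\<eta>. skorohod_problem (reflection_matrix P) \<psi> (skorohod_map (reflection_matrix P) \<psi>) \<eta>"
proof -
  obtain \<phi> \<eta> where sp: "skorohod_problem (reflection_matrix P) \<psi> \<phi> \<eta>"
    using skorohod_problem_exists[OF assms] by blast
  have "\<phi>' = \<phi>" if sp': "skorohod_problem (reflection_matrix P) \<psi> \<phi>' \<eta>'" for \<phi>' \<eta>'
    unfolding skorohod_eq_iff
  proof (intro allI impI)
    fix t :: real assume t: "t \<ge> 0"
    obtain u g where g: "0 \<le> g" "g < 1" "\<And>i::'k. 1 \<le> u i" "\<And>i. (\<Sum>j\<in>UNIV. P $ i $ j * u j) \<le> g * u i"
      by (rule substochastic_contraction_weight[OF P]) blast
    have "\<bar>path_of \<eta>' t $ i - path_of \<eta> t $ i\<bar> \<le> (\<Sum>j\<in>UNIV. u j) / (1 - g) * 0" for i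
      by (rule reflected_lipschitz[OF P(1) g skorohod_problem_reflected[OF sp'] skorohod_problem_reflected[OF sp]])
        (use t in auto)
    then have "path_of \<eta>' t = path_of \<eta> t" by (simp add: vec_eq_iff)
    then show "path_of \<phi>' t = path_of \<phi> t" using sp sp' t unfolding skorohod_problem_def by metis
  qed
  then have "skorohod_map (reflection_matrix P) \<psi> = \<phi>"
    unfolding skorohod_map_def using sp by (intro the_equality) blast+
  then show ?thesis using sp by blast
qed

lemma reflected_scale:
  assumes "reflected P T \<psi> \<eta>" "c > 0"
  shows "reflected P T (\<lambda>t. c *\<^sub>R \<psi> t) (\<lambda>t. c *\<^sub>R \<eta> t)"
proof -
  have pl: "push_level P (\<lambda>t. c *\<^sub>R \<psi> t) (\<lambda>t. c *\<^sub>R \<eta> t) i s = c * push_level P \<psi> \<eta> i s" for i s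
    by (simp add: push_level_def right_diff_distrib sum_distrib_left mult_ac)
  show ?thesis
    unfolding reflected_def
  proof (intro allI conjI ballI impI)
    fix i show "0 \<le> (c *\<^sub>R \<eta> 0) $ i" using assms by (simp add: reflected_def)
    show "mono_on {0..T} (\<lambda>t. (c *\<^sub>R \<eta> t) $ i)" using assms by (auto simp: reflected_def mono_on_def intro!: mult_left_mono)
    fix t assume t: "t \<in> {0..T}"
    show "push_level P (\<lambda>t. c *\<^sub>R \<psi> t) (\<lambda>t. c *\<^sub>R \<eta> t) i t \<le> (c *\<^sub>R \<eta> t) $ i"
      unfolding pl using assms t by (auto simp: reflected_def)
    fix e :: real assume "e > 0"
    then have "e / c > 0" using assms by simp
    then obtain s where s: "s \<in> {0..t}" "\<eta> t $ i \<le> max 0 (push_level P \<psi> \<eta> i s) + e / c"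
      using assms t unfolding reflected_def by blast
    then have "c * \<eta> t $ i \<le> c * (max 0 (push_level P \<psi> \<eta> i s) + e / c)" using assms by (intro mult_left_mono) auto
    also have "\<dots> = max 0 (c * push_level P \<psi> \<eta> i s) + e" using assms by (simp add: distrib_left max_mult_distrib_left)
    finally show "\<exists>s\<in>{0..t}. (c *\<^sub>R \<eta> t) $ i \<le> max 0 (push_level P (\<lambda>t. c *\<^sub>R \<psi> t) (\<lambda>t. c *\<^sub>R \<eta> t) i s) + e"
      unfolding pl using s(1) by auto
  qed
qed

lemma reflected_zero: "reflected P T (\<lambda>_. 0) (\<lambda>_. 0)"
  unfolding reflected_def by (auto simp: push_level_def intro!: mono_onI)

lemma reflected_cong:
  assumes "\<And>t. t \<in> {0..T} \<Longrightarrow> \<psi> t = \<psi>' t" "reflected P T \<psi> \<eta>"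
  shows "reflected P T \<psi>' \<eta>"
proof -
  have "push_level P \<psi>' \<eta> i t = push_level P \<psi> \<eta> i t" if "t \<in> {0..T}" for i t
    using assms(1)[OF that] by (simp add: push_level_def)
  then show ?thesis using assms(2) unfolding reflected_def by (auto 4 4)
qed

definition reflection_lipschitz :: "real^'k^'k::finite \<Rightarrow> real \<Rightarrow> bool" where
  "reflection_lipschitz P c \<longleftrightarrow> 0 < c \<and> (\<forall>T \<psi> \<eta> \<psi>' \<eta>' d. reflected P T \<psi> \<eta> \<longrightarrow> reflected P T \<psi>' \<eta>' \<longrightarrow>
     (\<forall>s\<in>{0..T}. norm (\<psi> s - \<psi>' s) \<le> d) \<longrightarrow>
     (\<forall>t\<in>{0..T}. norm (\<eta> t - \<eta>' t) \<le> c * d \<and>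
        norm ((\<psi> t + reflection_matrix P *v \<eta> t) - (\<psi>' t + reflection_matrix P *v \<eta>' t)) \<le> c * d))"

lemma reflection_lipschitzD:
  assumes "reflection_lipschitz P c" "reflected P T \<psi> \<eta>" "reflected P T \<psi>' \<eta>'"
    "\<And>s. s \<in> {0..T} \<Longrightarrow> norm (\<psi> s - \<psi>' s) \<le> d" "t \<in> {0..T}"
  shows "norm (\<eta> t - \<eta>' t) \<le> c * d"
    "norm ((\<psi> t + reflection_matrix P *v \<eta> t) - (\<psi>' t + reflection_matrix P *v \<eta>' t)) \<le> c * d"
  using assms unfolding reflection_lipschitz_def by blast+

lemma reflection_lipschitz_exists:
  fixes P :: "real^'k^'k::finite"
  assumes P: "substochastic P" "spectral_radius P < 1"
  shows "\<exists>c. reflection_lipschitz P c"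
proof -
  obtain u g where g: "0 \<le> g" "g < 1" "\<And>i::'k. 1 \<le> u i" "\<And>i. (\<Sum>j\<in>UNIV. P $ i $ j * u j) \<le> g * u i"
    by (rule substochastic_contraction_weight[OF P]) blast
  define b where "b = real CARD('k) * ((\<Sum>j\<in>UNIV. u j) / (1 - g))"
  have u0: "0 \<le> u j" for j using g(3)[of j] by linarith
  have b: "b \<ge> 0" unfolding b_def using g u0 by (intro mult_nonneg_nonneg divide_nonneg_nonneg sum_nonneg) auto
  obtain B where B: "B > 0" "\<And>x. norm (reflection_matrix P *v x) \<le> B * norm x"
    using linear_bounded_pos[OF matrix_vector_mul_linear[of "reflection_matrix P"]] by auto
  define c where "c = 1 + b + B * b"
  have c: "c > 0" "b \<le> c" "1 + B * b \<le> c" using b B by (auto simp: c_def intro: add_pos_nonneg)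
  have main: "norm (\<eta> t - \<eta>' t) \<le> c * d \<and>
       norm ((\<psi> t + reflection_matrix P *v \<eta> t) - (\<psi>' t + reflection_matrix P *v \<eta>' t)) \<le> c * d"
    if r: "reflected P T \<psi> \<eta>" "reflected P T \<psi>' \<eta>'"
    and \<psi>: "\<And>s. s \<in> {0..T} \<Longrightarrow> norm (\<psi> s - \<psi>' s) \<le> d" and t: "t \<in> {0..T}" for T \<psi> \<eta> \<psi>' \<eta>' d t
  proof -
    have d0: "0 \<le> d" using order_trans[OF norm_ge_zero \<psi>[OF t]] .
    have "\<bar>\<psi> s $ i - \<psi>' s $ i\<bar> \<le> d" if "s \<in> {0..T}" for s i
      using component_le_norm_cart[of "\<psi> s - \<psi>' s" i] \<psi>[OF that] by simp
    then have "\<bar>\<eta> t $ i - \<eta>' t $ i\<bar> \<le> (\<Sum>j\<in>UNIV. u j) / (1 - g) * d" for i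
      by (rule reflected_lipschitz[OF P(1) g r _ t])
    then have "(\<Sum>i\<in>UNIV. \<bar>(\<eta> t - \<eta>' t) $ i\<bar>) \<le> (\<Sum>i\<in>(UNIV::'k set). (\<Sum>j\<in>UNIV. u j) / (1 - g) * d)"
      by (intro sum_mono) simp
    then have \<eta>: "norm (\<eta> t - \<eta>' t) \<le> b * d"
      using norm_le_l1_cart[of "\<eta> t - \<eta>' t"] by (simp add: b_def)
    have "norm ((\<psi> t + reflection_matrix P *v \<eta> t) - (\<psi>' t + reflection_matrix P *v \<eta>' t))
        = norm ((\<psi> t - \<psi>' t) + reflection_matrix P *v (\<eta> t - \<eta>' t))"
      by (simp add: matrix_vector_mult_diff_distrib algebra_simps)
    also have "\<dots> \<le> d + B * (b * d)"
      using \<psi>[OF t] order_trans[OF B(2)[of "\<eta> t - \<eta>' t"] mult_left_mono[OF \<eta> less_imp_le[OF B(1)]]]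
      by (intro norm_triangle_le add_mono)
    also have "\<dots> = (1 + B * b) * d" by (simp add: distrib_right)
    finally show ?thesis using \<eta> mult_right_mono[OF c(2) d0] mult_right_mono[OF c(3) d0] by linarith
  qed
  have "reflection_lipschitz P c"
    unfolding reflection_lipschitz_def using c(1) main by (intro conjI allI impI ballI) auto
  then show ?thesis by blast
qed

section \<open>Integrals and uniform limits\<close>

lemma set_integrable_bounded:
  fixes f :: "real \<Rightarrow> 'a::euclidean_space"
  assumes "f \<in> borel_measurable borel" "A \<in> sets borel" "A \<subseteq> {a..b}" "\<And>s. s \<in> A \<Longrightarrow> norm (f s) \<le> B"
  shows "set_integrable lborel A f"
  unfolding set_integrable_def
proof (rule integrableI_bounded_set[where A=A and B=B])
  show "emeasure lborel A < \<infinity>"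
    using emeasure_mono[OF assms(3), of lborel] assms(2) by (cases "a \<le> b") (auto simp: less_top[symmetric] top_unique emeasure_lborel_Icc_eq split: if_splits)
qed (use assms in \<open>auto simp: indicator_def\<close>)

lemma set_integral_split_Icc:
  fixes f :: "real \<Rightarrow> 'a::euclidean_space"
  assumes f: "f \<in> borel_measurable borel" "\<And>s. s \<in> {0..t} \<Longrightarrow> norm (f s) \<le> B" and "0 \<le> a" "a \<le> t"
  shows "(LBINT s:{0..t}. f s) = (LBINT s:{0..a}. f s) + (LBINT s:{a<..t}. f s)"
proof -
  have "{0..t} = {0..a} \<union> {a<..t}" using assms by auto
  then have "(LBINT s:{0..t}. f s) = (LBINT s:{0..a} \<union> {a<..t}. f s)" by simp
  also have "\<dots> = (LBINT s:{0..a}. f s) + (LBINT s:{a<..t}. f s)"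
    using assms by (intro set_integral_Un set_integrable_bounded[where a=0 and b=t and B=B]) auto
  finally show ?thesis .
qed

lemma norm_set_integral_Ioc_le:
  fixes f :: "real \<Rightarrow> 'a::euclidean_space"
  assumes "f \<in> borel_measurable borel" "\<And>s. s \<in> {a<..b} \<Longrightarrow> norm (f s) \<le> B" "a \<le> b"
  shows "norm (LBINT s:{a<..b}. f s) \<le> B * (b - a)"
proof -
  have i: "set_integrable lborel {a<..b} f" using assms by (intro set_integrable_bounded[where a=a and b=b and B=B]) auto
  have "norm (LBINT s:{a<..b}. f s) \<le> (LBINT s:{a<..b}. norm (f s))"
    by (rule set_integral_norm_bound[OF i])
  also have "\<dots> \<le> (LBINT s:{a<..b}. B)"
    using assms(2,3) i by (intro set_integral_mono set_integrable_norm) (auto intro!: set_integrable_bounded[where a=a and b=b and B="\<bar>B\<bar>"])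
  also have "\<dots> = B * (b - a)" using assms(3) by (simp add: set_integral_const)
  finally show ?thesis .
qed

lemma set_integral_singleton: "(LBINT s:{a::real}. f s) = (0 :: 'a::euclidean_space)"
  unfolding set_lebesgue_integral_def
  by (rule integral_eq_zero_AE, rule AE_mp[OF AE_lborel_singleton[of a]]) (auto simp: indicator_def)

lemma norm_set_integral_Icc_le:
  fixes f :: "real \<Rightarrow> 'a::euclidean_space"
  assumes "f \<in> borel_measurable borel" "\<And>s. s \<in> {0..t} \<Longrightarrow> norm (f s) \<le> B" "0 \<le> t"
  shows "norm (LBINT s:{0..t}. f s) \<le> B * t"
proof -
  have "norm (LBINT s:{0<..t}. f s) \<le> B * (t - 0)"
    using assms by (intro norm_set_integral_Ioc_le) auto
  then show ?thesis
    using set_integral_split_Icc[OF assms(1,2), of t 0] assms(3) by (simp add: set_integral_singleton)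
qed

lemma set_integral_continuous:
  fixes f :: "real \<Rightarrow> 'a::euclidean_space"
  assumes f: "f \<in> borel_measurable borel" "\<And>s. s \<in> {0..T} \<Longrightarrow> norm (f s) \<le> B"
  shows "continuous_on {0..T} (\<lambda>t. LBINT s:{0..t}. f s)"
proof -
  have 1: "dist (LBINT s:{0..t}. f s) (LBINT s:{0..a}. f s) \<le> \<bar>B\<bar> * dist t a" if "0 \<le> a" "a \<le> t" "t \<le> T" for a t
  proof -
    have "(LBINT s:{0..t}. f s) - (LBINT s:{0..a}. f s) = (LBINT s:{a<..t}. f s)"
      using set_integral_split_Icc[of f t B a] f that by simp
    moreover have "norm (LBINT s:{a<..t}. f s) \<le> \<bar>B\<bar> * (t - a)"
      using f that by (intro norm_set_integral_Ioc_le) (auto intro: order_trans[OF _ abs_ge_self])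
    ultimately show ?thesis using that by (simp add: dist_norm)
  qed
  have "\<bar>B\<bar>-lipschitz_on {0..T} (\<lambda>t. LBINT s:{0..t}. f s)"
  proof (rule lipschitz_onI)
    fix x y assume "x \<in> {0..T}" "y \<in> {0..T}"
    then show "dist (LBINT s:{0..x}. f s) (LBINT s:{0..y}. f s) \<le> \<bar>B\<bar> * dist x y"
      using 1[of x y] 1[of y x] by (cases "x \<le> y") (auto simp: dist_commute)
  qed simp
  then show ?thesis by (rule lipschitz_on_continuous_on)
qed

text \<open>
  The crude factor 2 saves the differentiation: the supremum of \<open>f s * exp (- 2 L s)\<close> is at most
  \<open>c\<close> plus half of itself.
\<close>

lemma gronwall_bounded:
  fixes f :: "real \<Rightarrow> real"
  assumes f: "f \<in> borel_measurable borel" "\<And>s. s \<in> {0..T} \<Longrightarrow> \<bar>f s\<bar> \<le> B"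
    and L: "L > 0" and c: "c \<ge> 0"
    and le: "\<And>t. t \<in> {0..T} \<Longrightarrow> f t \<le> c + L * (LBINT s:{0..t}. f s)"
    and t: "t \<in> {0..T}"
  shows "f t \<le> 2 * c * exp (2 * L * t)"
proof -
  define h where "h s = f s * exp (- (2 * L * s))" for s
  define m where "m = Sup (h ` {0..T})"
  have T: "T \<ge> 0" using t by simp
  have "h s \<le> B" if "s \<in> {0..T}" for s
  proof -
    have "h s \<le> \<bar>f s\<bar> * exp (- (2 * L * s))" unfolding h_def by (intro mult_right_mono) auto
    also have "\<dots> \<le> \<bar>f s\<bar> * 1" using that L by (intro mult_left_mono) auto
    finally show ?thesis using f(2)[OF that] by simp
  qed
  then have hm: "h s \<le> m" if "s \<in> {0..T}" for s
    unfolding m_def using that by (intro cSup_upper bdd_aboveI2[where M=B]) auto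
  define m' where "m' = max 0 m"
  have fm: "f s \<le> m' * exp (2 * L * s)" if "s \<in> {0..T}" for s
  proof -
    have "f s = h s * exp (2 * L * s)" by (simp add: h_def mult.assoc exp_add[symmetric])
    also have "\<dots> \<le> m' * exp (2 * L * s)" using hm[OF that] by (intro mult_right_mono) (auto simp: m'_def)
    finally show ?thesis .
  qed
  have "h s \<le> c + m' / 2" if s: "s \<in> {0..T}" for s
  proof -
    have s0: "0 \<le> s" using s by simp
    have "(LBINT r:{0..s}. f r) \<le> (LBINT r:{0..s}. m' * exp (2 * L * r))"
    proof (rule set_integral_mono)
      show "set_integrable lborel {0..s} f"
        using f s by (intro set_integrable_bounded[where a=0 and b=s and B=B]) auto
      show "set_integrable lborel {0..s} (\<lambda>r. m' * exp (2 * L * r))"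
        by (intro borel_integrable_compact[folded set_integrable_def] continuous_intros) auto
    qed (use fm s in auto)
    also have "(LBINT r:{0..s}. m' * exp (2 * L * r)) = m' / (2 * L) * exp (2 * L * s) - m' / (2 * L) * exp (2 * L * 0)"
    proof -
      have "((\<lambda>r. m' / (2 * L) * exp (2 * L * r)) has_real_derivative m' * exp (2 * L * x)) (at x)" for x
        using L by (auto intro!: derivative_eq_intros simp: field_simps)
      moreover have "isCont (\<lambda>r. m' * exp (2 * L * r)) x" for x by (intro continuous_intros)
      ultimately show ?thesis
        unfolding set_lebesgue_integral_def real_scaleR_def mult.commute[of "indicator _ _"]
        by (intro integral_FTC_Icc_real s0)
    qed
    also have "\<dots> \<le> m' / (2 * L) * exp (2 * L * s)" using L by (simp add: m'_def)
    finally have "L * (LBINT r:{0..s}. f r) \<le> L * (m' / (2 * L) * exp (2 * L * s))" using L by (intro mult_left_mono) auto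
    then have "f s \<le> c + m' / 2 * exp (2 * L * s)" using le[OF s] L by simp
    then have "h s \<le> (c + m' / 2 * exp (2 * L * s)) * exp (- (2 * L * s))"
      unfolding h_def by (intro mult_right_mono) auto
    also have "\<dots> = c * exp (- (2 * L * s)) + m' / 2"
      by (simp add: distrib_right mult.assoc exp_add[symmetric])
    also have "\<dots> \<le> c * 1 + m' / 2" using c s0 L by (intro add_mono mult_left_mono) auto
    finally show ?thesis by simp
  qed
  then have "m \<le> c + m' / 2" unfolding m_def using T by (intro cSup_least) auto
  then have "m' \<le> 2 * c" using c by (auto simp: m'_def max_def split: if_splits)
  then have "m' * exp (2 * L * t) \<le> 2 * c * exp (2 * L * t)" by (intro mult_right_mono) auto
  then show ?thesis using fm[OF t] by linarith
qed

lemma uniform_limit_compose_time_change: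
  fixes f :: "real \<Rightarrow> 'a::metric_space"
  assumes lim: "\<And>T. T \<ge> 0 \<Longrightarrow> uniform_limit {0..T} fk f F"
    and f: "continuous_on {0..} f"
    and g: "uniform_limit S gk g F" "\<And>k t. t \<in> S \<Longrightarrow> 0 \<le> gk k t" "\<And>t. t \<in> S \<Longrightarrow> 0 \<le> g t \<and> g t \<le> B"
  shows "uniform_limit S (\<lambda>k t. fk k (gk k t)) (\<lambda>t. f (g t)) F"
  unfolding uniform_limit_iff
proof (intro allI impI)
  fix e :: real assume e: "e > 0"
  have "uniformly_continuous_on {0..\<bar>B\<bar>+1} f"
    by (intro compact_uniformly_continuous continuous_on_subset[OF f]) auto
  then obtain d where d: "d > 0" "\<forall>x\<in>{0..\<bar>B\<bar>+1}. \<forall>y\<in>{0..\<bar>B\<bar>+1}. dist y x < d \<longrightarrow> dist (f y) (f x) < e/2"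
    unfolding uniformly_continuous_on_def using half_gt_zero[OF e] by blast
  have "\<forall>\<^sub>F k in F. \<forall>t\<in>S. dist (gk k t) (g t) < min d 1"
    by (rule uniform_limitD[OF g(1)]) (use d(1) in simp)
  moreover have "\<forall>\<^sub>F k in F. \<forall>t\<in>{0..\<bar>B\<bar>+1}. dist (fk k t) (f t) < e/2"
    by (rule uniform_limitD[OF lim]) (use e in auto)
  ultimately show "\<forall>\<^sub>F k in F. \<forall>t\<in>S. dist (fk k (gk k t)) (f (g t)) < e"
  proof eventually_elim
    case (elim k)
    show ?case
    proof
      fix t assume t: "t \<in> S"
      have 1: "dist (gk k t) (g t) < d" "dist (gk k t) (g t) < 1" using elim(1) t by auto
      have "g t \<in> {0..\<bar>B\<bar>+1}" "gk k t \<in> {0..\<bar>B\<bar>+1}" using g(2,3)[OF t] 1(2) by (auto simp: dist_real_def)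
      then have "dist (fk k (gk k t)) (f (gk k t)) < e/2" "dist (f (gk k t)) (f (g t)) < e/2"
        using elim(2) d(2) 1(1) by auto
      then show "dist (fk k (gk k t)) (f (g t)) < e"
        using dist_triangle[of "fk k (gk k t)" "f (g t)" "f (gk k t)"] by linarith
    qed
  qed
qed

lemma set_integral_sum:
  fixes f :: "'i \<Rightarrow> 'a \<Rightarrow> 'b::{banach, second_countable_topology}"
  assumes "finite I" "\<And>j. j \<in> I \<Longrightarrow> set_integrable M A (f j)"
  shows "set_integrable M A (\<lambda>s. \<Sum>j\<in>I. f j s)"
    and "(LINT s:A|M. \<Sum>j\<in>I. f j s) = (\<Sum>j\<in>I. LINT s:A|M. f j s)"
  using assms by (induction I rule: finite_induct) (auto simp: set_integrable_def set_lebesgue_integral_def scaleR_add_right)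

lemma uniform_limit_eventually_small:
  fixes S :: "'i \<Rightarrow> 'a \<Rightarrow> 'b::real_normed_vector"
  assumes lim: "uniform_limit A S w F" and w: "\<And>t. t \<in> A \<Longrightarrow> norm (w t) \<le> c"
    and \<rho>: "filterlim \<rho> at_top F" and e: "e > (0::real)"
  shows "\<forall>\<^sub>F k in F. \<forall>t\<in>A. norm (S k t) \<le> e * \<rho> k"
proof -
  have "\<forall>\<^sub>F k in F. \<forall>t\<in>A. dist (S k t) (w t) < 1" by (rule uniform_limitD[OF lim]) simp
  moreover have "\<forall>\<^sub>F k in F. (\<bar>c\<bar> + 1) / e \<le> \<rho> k" using \<rho> by (simp add: filterlim_at_top)
  ultimately show ?thesis
  proof eventually_elim
    case (elim k)
    show ?case
    proof
      fix t assume t: "t \<in> A"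
      have "norm (S k t) \<le> norm (w t) + dist (S k t) (w t)"
        unfolding dist_norm by (metis add.commute norm_triangle_sub)
      also have "\<dots> \<le> \<bar>c\<bar> + 1" using w[OF t] elim(1) t by (intro add_mono) (auto intro: less_imp_le)
      also have "\<dots> \<le> e * \<rho> k" using elim(2) e by (simp add: pos_divide_le_eq mult.commute)
      finally show "norm (S k t) \<le> e * \<rho> k" .
    qed
  qed
qed

lemma uniform_limit_sum_finite:
  fixes f :: "'j \<Rightarrow> 'i \<Rightarrow> 'a \<Rightarrow> 'b::real_normed_vector"
  assumes "finite I" "\<And>j. j \<in> I \<Longrightarrow> uniform_limit A (f j) (g j) F"
  shows "uniform_limit A (\<lambda>k t. \<Sum>j\<in>I. f j k t) (\<lambda>t. \<Sum>j\<in>I. g j t) F"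
  using assms by (induction I rule: finite_induct) (auto intro: uniform_limit_add uniform_limit_const)

lemma uniform_limit_mult_const:
  fixes f :: "'i \<Rightarrow> 'a \<Rightarrow> real"
  shows "uniform_limit A f g F \<Longrightarrow> uniform_limit A (\<lambda>k t. c * f k t) (\<lambda>t. c * g t) F"
  by (rule bounded_linear.uniform_limit[OF bounded_linear_mult_right])

lemma set_integral_Icc_Ico:
  fixes f :: "real \<Rightarrow> 'a::euclidean_space"
  shows "(LBINT s:{a..b}. f s) = (LBINT s:{a..<b}. f s)"
  by (rule set_integral_discrete_difference[where X="{b}"]) auto

section \<open>Pathwise convergence of the networks\<close>

text \<open>
  One trajectory for each of the network indices \<open>n 0, n 1, \<dots>\<close>, which tend to infinity but need not
  be distinct; the trajectories may come from different outcomes.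
\<close>

locale critical_networks =
  fixes P :: "real^'k^'k::finite" and n :: "nat \<Rightarrow> nat"
    and lam mu :: "nat \<Rightarrow> real^'k \<Rightarrow> real^'k"
    and NA ND :: "nat \<Rightarrow> 'k \<Rightarrow> real skorohod"
    and Phi :: "nat \<Rightarrow> 'k \<Rightarrow> 'k \<Rightarrow> nat \<Rightarrow> nat"
    and Q :: "nat \<Rightarrow> (real^'k) skorohod"
    and lam_lim mu_lim a :: "real^'k \<Rightarrow> real^'k"
    and X0 :: "real^'k" and WA WD :: "(real^'k) skorohod" and WPhi :: "(real^'k^'k) skorohod"
    and X :: "(real^'k) skorohod" and C L :: real
  assumes P: "substochastic P" "spectral_radius P < 1"
    and n_lim: "filterlim n at_top sequentially" and n_ge_1: "\<And>k. n k \<ge> 1"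
    and rates_measurable: "\<And>m. m \<ge> 1 \<Longrightarrow> lam m \<in> borel_measurable (restrict_space borel orthant)"
      "\<And>m. m \<ge> 1 \<Longrightarrow> mu m \<in> borel_measurable (restrict_space borel orthant)"
    and rates_orthant: "\<And>m x. m \<ge> 1 \<Longrightarrow> x \<in> orthant \<Longrightarrow> lam m x \<in> orthant \<and> mu m x \<in> orthant"
    and NA_0: "\<And>k i. path_of (NA k i) 0 = 0" and ND_0: "\<And>k i. path_of (ND k i) 0 = 0"
    and ND_Nats: "\<And>k i t. t \<ge> 0 \<Longrightarrow> path_of (ND k i) t \<in> \<nat>"
    and Phi_0: "\<And>k i j. Phi k i j 0 = 0" and Phi_sum: "\<And>k i m. (\<Sum>j\<in>UNIV. Phi k i j m) \<le> m"
    and Q_Nats: "\<And>k t i. t \<ge> 0 \<Longrightarrow> path_of (Q k) t $ i \<in> \<nat>"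
    and dynamics: "\<And>k. queue_equation (lam (n k)) (mu (n k)) (NA k) (ND k) (Phi k) (Q k)"
    and C: "C > 0"
    and growth: "\<And>m x i. m \<ge> 1 \<Longrightarrow> x \<in> orthant \<Longrightarrow> lam m x $ i \<le> C * (real m + norm x)"
      "\<And>m x i. m \<ge> 1 \<Longrightarrow> x \<in> orthant \<Longrightarrow> mu m x $ i \<le> C * (real m + norm x)"
    and fluid_continuous: "\<And>i. continuous_on orthant (\<lambda>x. lam_lim x $ i)"
      "\<And>i. continuous_on orthant (\<lambda>x. mu_lim x $ i)"
    and fluid_lam: "\<And>i K. compact K \<Longrightarrow> K \<subseteq> orthant \<Longrightarrow>
          uniform_limit K (\<lambda>m x. lam m (real m *\<^sub>R x) $ i / real m) (\<lambda>x. lam_lim x $ i) sequentially"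
    and fluid_mu: "\<And>i K. compact K \<Longrightarrow> K \<subseteq> orthant \<Longrightarrow>
          uniform_limit K (\<lambda>m x. mu m (real m *\<^sub>R x) $ i / real m) (\<lambda>x. mu_lim x $ i) sequentially"
    and traffic: "\<And>x. x \<in> orthant \<Longrightarrow> lam_lim x - reflection_matrix P *v mu_lim x = 0"
    and a_lipschitz: "L-lipschitz_on orthant a"
    and drift: "\<And>K. compact K \<Longrightarrow> K \<subseteq> orthant \<Longrightarrow>
          uniform_limit K
            (\<lambda>m x. (lam m (sqrt (real m) *\<^sub>R x) - reflection_matrix P *v mu m (sqrt (real m) *\<^sub>R x))
                     /\<^sub>R sqrt (real m))
            a sequentially"
    and initial: "(\<lambda>k. path_of (Q k) 0 /\<^sub>R sqrt (real (n k))) \<longlonglongrightarrow> X0"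
    and primitives: "(\<lambda>k. scaled_counting (n k) (NA k)) \<longlonglongrightarrow> WA" "(\<lambda>k. scaled_counting (n k) (ND k)) \<longlonglongrightarrow> WD"
      "(\<lambda>k. scaled_routing (n k) P (Phi k)) \<longlonglongrightarrow> WPhi"
    and W_continuous: "continuous_on {0..} (path_of WA)" "continuous_on {0..} (path_of WD)" "continuous_on {0..} (path_of WPhi)"
    and X_orthant: "\<And>t. t \<ge> 0 \<Longrightarrow> path_of X t \<in> orthant"
    and X_solution: "\<And>t. t \<ge> 0 \<Longrightarrow> path_of X t =
            path_of (skorohod_map (reflection_matrix P) (to_skorohod (\<lambda>u.
              X0 + (LBINT s:{0..u}. a (path_of X s)) + limit_noise P (lam_lim 0) (mu_lim 0) WA WD WPhi u))) t"
begin

definition q where "q k t = path_of (Q k) t"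
definition r where "r k = real (n k)"
definition arr where "arr k i t = (LBINT s:{0..t}. lam (n k) (q k s) $ i)"
definition busy where "busy k i t = (LBINT s:{0..t}. mu (n k) (q k s) $ i * indicator {s. q k s $ i > 0} s)"
definition idle where "idle k t = (\<chi> i. LBINT s:{0..t}. mu (n k) (q k s) $ i * indicator {s. q k s $ i = 0} s)"
definition dep where "dep k i t = path_of (ND k i) (busy k i t)"
definition scaledA where "scaledA k = path_of (scaled_counting (n k) (NA k))"
definition scaledD where "scaledD k = path_of (scaled_counting (n k) (ND k))"
definition scaledPhi where "scaledPhi k = path_of (scaled_routing (n k) P (Phi k))"

definition noise where
  "noise k t = (\<chi> i. scaledA k (arr k i t / r k) $ i + (\<Sum>j\<in>UNIV. scaledPhi k (dep k j t / r k) $ j $ i)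
     - (\<Sum>j\<in>UNIV. ((if i = j then 1 else 0) - P $ j $ i) * scaledD k (busy k j t / r k) $ j))"

definition net_rate where "net_rate k x = lam (n k) x - reflection_matrix P *v mu (n k) x"

definition flow where
  "flow k t = q k 0 + sqrt (r k) *\<^sub>R noise k t + (LBINT s:{0..t}. net_rate k (q k s))"

lemma r_pos: "r k > 0"
  using n_ge_1[of k] by (simp add: r_def)

lemma q_orthant: "q k t \<in> orthant"
proof -
  have "q k t \<in> orthant" if "t \<ge> 0" for t
    using Q_Nats[OF that, of k] by (auto simp: q_def orthant_def Nats_altdef2)
  then show ?thesis using path_of_nonpos[of t "Q k"] by (cases "t \<ge> 0") (auto simp: q_def)
qed

lemma q_nonneg: "0 \<le> q k t $ i" using q_orthant[of k t] by (simp add: orthant_def)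

lemma q_measurable [measurable]: "q k \<in> borel_measurable borel"
  unfolding q_def by (rule path_of_borel)

lemma compose_q_measurable:
  assumes "f \<in> borel_measurable (restrict_space borel orthant)"
  shows "(\<lambda>s. f (q k s)) \<in> borel_measurable borel"
  by (rule measurable_compose[OF measurable_restrict_space2 assms]) (use q_orthant in auto)

lemma rates_measurable_q [measurable]:
  "(\<lambda>s. lam (n k) (q k s)) \<in> borel_measurable borel" "(\<lambda>s. mu (n k) (q k s)) \<in> borel_measurable borel"
  using rates_measurable[OF n_ge_1] by (auto intro: compose_q_measurable)

lemma net_rate_measurable_q [measurable]: "(\<lambda>s. net_rate k (q k s)) \<in> borel_measurable borel"
  unfolding net_rate_def
  by (intro borel_measurable_diff rates_measurable_q measurable_compose[OF rates_measurable_q(2)]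
    borel_measurable_continuous_onI matrix_vector_mult_linear_continuous_on)

lemma rate_nonneg: "0 \<le> lam (n k) (q k s) $ i" "0 \<le> mu (n k) (q k s) $ i"
  using rates_orthant[OF n_ge_1 q_orthant] by (auto simp: orthant_def)

lemma P_bounds: "0 \<le> P $ j $ i" "P $ j $ i \<le> 1"
  using P(1) substochastic_entry_le_1 by (auto simp: substochastic_def)

lemma rates_bounded:
  obtains B where "B \<ge> 0" "\<And>s i. s \<in> {0..T} \<Longrightarrow> \<bar>lam (n k) (q k s) $ i\<bar> \<le> B"
    "\<And>s i. s \<in> {0..T} \<Longrightarrow> \<bar>mu (n k) (q k s) $ i\<bar> \<le> B" "\<And>s. s \<in> {0..T} \<Longrightarrow> norm (net_rate k (q k s)) \<le> B"
proof -
  have "bounded (q k ` {0..T})" unfolding q_def by (intro cadlag_bounded path_of_cadlag)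
  then obtain b where "\<forall>x\<in>q k ` {0..T}. norm x \<le> b" unfolding bounded_iff by blast
  then have b: "norm (q k s) \<le> b" if "s \<in> {0..T}" for s using that by blast
  define B where "B = C * (r k + \<bar>b\<bar>)"
  have B: "B \<ge> 0" using C r_pos[of k] by (simp add: B_def)
  have le: "C * (real (n k) + norm (q k s)) \<le> B" if "s \<in> {0..T}" for s
    using b[OF that] C unfolding B_def r_def by (intro mult_left_mono add_left_mono) auto
  have 1: "\<bar>lam (n k) (q k s) $ i\<bar> \<le> B" "\<bar>mu (n k) (q k s) $ i\<bar> \<le> B" if "s \<in> {0..T}" for s i
    using growth[OF n_ge_1[of k] q_orthant[of k s], of i] rate_nonneg[of k s i] le[OF that] by auto
  define N where "N = real CARD('k)"
  have 2: "norm (net_rate k (q k s)) \<le> N * (2 * B + N * B)" if s: "s \<in> {0..T}" for s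
  proof -
    have "norm (net_rate k (q k s)) \<le> (\<Sum>i\<in>UNIV. \<bar>net_rate k (q k s) $ i\<bar>)" by (rule norm_le_l1_cart)
    also have "\<dots> \<le> (\<Sum>i\<in>(UNIV::'k set). 2 * B + N * B)"
    proof (rule sum_mono)
      fix i
      have "\<bar>\<Sum>j\<in>UNIV. P $ j $ i * mu (n k) (q k s) $ j\<bar> \<le> (\<Sum>j\<in>UNIV. \<bar>P $ j $ i * mu (n k) (q k s) $ j\<bar>)" by (rule sum_abs)
      also have "\<dots> \<le> (\<Sum>j\<in>(UNIV::'k set). B)"
      proof (rule sum_mono)
        show "\<bar>P $ j $ i * mu (n k) (q k s) $ j\<bar> \<le> B" for j
          using P_bounds[of j i] mult_mono[of "P $ j $ i" 1 "\<bar>mu (n k) (q k s) $ j\<bar>" B] 1(2)[OF s, of j] B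
          by (simp add: abs_mult)
      qed
      finally have "\<bar>\<Sum>j\<in>UNIV. P $ j $ i * mu (n k) (q k s) $ j\<bar> \<le> N * B" by (simp add: N_def)
      then show "\<bar>net_rate k (q k s) $ i\<bar> \<le> 2 * B + N * B"
        using 1[OF s, of i] unfolding net_rate_def by (simp add: reflection_matrix_nth)
    qed
    also have "\<dots> = N * (2 * B + N * B)" by (simp add: N_def)
    finally show ?thesis .
  qed
  define B' where "B' = B + N * (2 * B + N * B)"
  have "0 \<le> N * (2 * B + N * B)" using B by (simp add: N_def)
  then have "B \<le> B'" "N * (2 * B + N * B) \<le> B'" using B by (auto simp: B'_def)
  then show thesis
    using B order_trans[OF 1(1)] order_trans[OF 1(2)] order_trans[OF 2] by (intro that[of B']) auto
qed

lemma rates_nth_measurable [measurable]: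
  "(\<lambda>s. lam (n k) (q k s) $ i) \<in> borel_measurable borel" "(\<lambda>s. mu (n k) (q k s) $ i) \<in> borel_measurable borel"
  "(\<lambda>s. q k s $ i) \<in> borel_measurable borel"
  by (rule measurable_compose[OF rates_measurable_q(1)], simp)
     (rule measurable_compose[OF rates_measurable_q(2)], simp, rule measurable_compose[OF q_measurable], simp)

lemma indicator_q_measurable [measurable]:
  "(\<lambda>s. mu (n k) (q k s) $ i * indicator {s. q k s $ i > 0} s) \<in> borel_measurable borel"
  "(\<lambda>s. mu (n k) (q k s) $ i * indicator {s. q k s $ i = 0} s) \<in> borel_measurable borel"
proof -
  have "{s\<in>space borel. q k s $ i > 0} \<in> sets borel" "{s\<in>space borel. q k s $ i = 0} \<in> sets borel" by measurable
  then show "(\<lambda>s. mu (n k) (q k s) $ i * indicator {s. q k s $ i > 0} s) \<in> borel_measurable borel"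
    "(\<lambda>s. mu (n k) (q k s) $ i * indicator {s. q k s $ i = 0} s) \<in> borel_measurable borel"
    by (auto intro!: borel_measurable_times rates_nth_measurable borel_measurable_indicator)
qed

lemma rates_integrable:
  "set_integrable lborel {0..t} (\<lambda>s. lam (n k) (q k s) $ i)"
  "set_integrable lborel {0..t} (\<lambda>s. mu (n k) (q k s) $ i)"
  "set_integrable lborel {0..t} (\<lambda>s. mu (n k) (q k s) $ i * indicator {s. q k s $ i > 0} s)"
  "set_integrable lborel {0..t} (\<lambda>s. mu (n k) (q k s) $ i * indicator {s. q k s $ i = 0} s)"
  "set_integrable lborel {0..t} (\<lambda>s. net_rate k (q k s))"
proof -
  obtain B where B: "B \<ge> 0" "\<And>s i. s \<in> {0..t} \<Longrightarrow> \<bar>lam (n k) (q k s) $ i\<bar> \<le> B"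
    "\<And>s i. s \<in> {0..t} \<Longrightarrow> \<bar>mu (n k) (q k s) $ i\<bar> \<le> B" "\<And>s. s \<in> {0..t} \<Longrightarrow> norm (net_rate k (q k s)) \<le> B"
    using rates_bounded[of t k] by blast
  show "set_integrable lborel {0..t} (\<lambda>s. lam (n k) (q k s) $ i)"
    "set_integrable lborel {0..t} (\<lambda>s. mu (n k) (q k s) $ i)"
    "set_integrable lborel {0..t} (\<lambda>s. mu (n k) (q k s) $ i * indicator {s. q k s $ i > 0} s)"
    "set_integrable lborel {0..t} (\<lambda>s. mu (n k) (q k s) $ i * indicator {s. q k s $ i = 0} s)"
    "set_integrable lborel {0..t} (\<lambda>s. net_rate k (q k s))"
    using B by (auto intro!: set_integrable_bounded[where a=0 and b=t and B=B] simp: indicator_def)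
qed

lemma service_split: "(LBINT s:{0..t}. mu (n k) (q k s) $ i) = busy k i t + idle k t $ i"
proof -
  have "(LBINT s:{0..t}. mu (n k) (q k s) $ i)
      = (LBINT s:{0..t}. mu (n k) (q k s) $ i * indicator {s. q k s $ i > 0} s + mu (n k) (q k s) $ i * indicator {s. q k s $ i = 0} s)"
  proof (rule set_lebesgue_integral_cong)
    show "\<forall>s. s \<in> {0..t} \<longrightarrow> mu (n k) (q k s) $ i =
       mu (n k) (q k s) $ i * indicator {s. q k s $ i > 0} s + mu (n k) (q k s) $ i * indicator {s. q k s $ i = 0} s"
      using q_nonneg[of k _ i] by (auto simp: indicator_def less_le)
  qed simp
  also have "\<dots> = busy k i t + idle k t $ i"
    using rates_integrable by (simp add: set_integral_add busy_def idle_def)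
  finally show ?thesis .
qed

lemma net_rate_integral:
  "(LBINT s:{0..t}. net_rate k (q k s)) $ i =
     arr k i t - ((busy k i t + idle k t $ i) - (\<Sum>j\<in>UNIV. P $ j $ i * (busy k j t + idle k t $ j)))"
proof -
  have "(LBINT s:{0..t}. net_rate k (q k s)) $ i = (LBINT s:{0..t}. net_rate k (q k s) $ i)"
  proof -
    have "(LBINT s:{0..t}. net_rate k (q k s)) $ i = (\<integral>s. (indicator {0..t} s *\<^sub>R net_rate k (q k s)) $ i \<partial>lborel)"
      unfolding set_lebesgue_integral_def
      using rates_integrable(5)[of t k, unfolded set_integrable_def]
      by (intro integral_bounded_linear[symmetric] bounded_linear_vec_nth)
    then show ?thesis by (simp add: set_lebesgue_integral_def)
  qed
  also have "\<dots> = (LBINT s:{0..t}. lam (n k) (q k s) $ i - (mu (n k) (q k s) $ i - (\<Sum>j\<in>UNIV. P $ j $ i * mu (n k) (q k s) $ j)))"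
    by (simp add: net_rate_def reflection_matrix_nth)
  also have "\<dots> = arr k i t - ((LBINT s:{0..t}. mu (n k) (q k s) $ i) - (LBINT s:{0..t}. \<Sum>j\<in>UNIV. P $ j $ i * mu (n k) (q k s) $ j))"
  proof -
    have "set_integrable lborel {0..t} (\<lambda>s. \<Sum>j\<in>UNIV. P $ j $ i * mu (n k) (q k s) $ j)"
      by (intro set_integral_sum(1) set_integrable_mult_right rates_integrable) auto
    then show ?thesis using rates_integrable by (simp add: set_integral_diff arr_def)
  qed
  also have "(LBINT s:{0..t}. \<Sum>j\<in>UNIV. P $ j $ i * mu (n k) (q k s) $ j) = (\<Sum>j\<in>UNIV. P $ j $ i * (LBINT s:{0..t}. mu (n k) (q k s) $ j))"
    by (subst set_integral_sum(2)) (auto intro!: set_integrable_mult_right rates_integrable)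
  finally show ?thesis by (simp add: service_split)
qed

lemma times_nonneg: "0 \<le> arr k i t" "0 \<le> busy k i t" "0 \<le> idle k t $ i"
  unfolding arr_def busy_def idle_def vec_lambda_beta set_lebesgue_integral_def
  using rate_nonneg by (auto intro!: integral_nonneg_AE simp: indicator_def)

lemma dep_Nats: "dep k i t \<in> \<nat>" and dep_nonneg: "0 \<le> dep k i t"
proof -
  show 1: "dep k i t \<in> \<nat>" unfolding dep_def by (rule ND_Nats[OF times_nonneg(2)])
  show "0 \<le> dep k i t" using 1 by (auto simp: Nats_altdef2)
qed

lemma scaled_eq:
  assumes "t \<ge> 0"
  shows "scaledA k t $ i = (path_of (NA k i) (r k * t) - r k * t) / sqrt (r k)"
    "scaledD k t $ i = (path_of (ND k i) (r k * t) - r k * t) / sqrt (r k)"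
    "scaledPhi k t $ j $ i = (real (Phi k j i (nat \<lfloor>r k * t\<rfloor>)) - P $ j $ i * (r k * t)) / sqrt (r k)"
  unfolding scaledA_def scaledD_def scaledPhi_def r_def
  by (simp_all only: path_of_scaled_counting[OF n_ge_1 assms] path_of_scaled_routing[OF n_ge_1 assms] mult.assoc)

lemma unscale:
  "path_of (NA k i) (arr k i t) = arr k i t + sqrt (r k) * scaledA k (arr k i t / r k) $ i"
  "dep k i t = busy k i t + sqrt (r k) * scaledD k (busy k i t / r k) $ i"
  "real (Phi k j i (nat \<lfloor>dep k j t\<rfloor>)) = P $ j $ i * dep k j t + sqrt (r k) * scaledPhi k (dep k j t / r k) $ j $ i"
proof -
  have r: "sqrt (r k) \<noteq> 0" "r k * (x / r k) = x" "0 \<le> r k" for x using r_pos[of k] by auto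
  note nn = divide_nonneg_nonneg[OF times_nonneg(1) r(3)] divide_nonneg_nonneg[OF times_nonneg(2) r(3)]
     divide_nonneg_nonneg[OF dep_nonneg r(3)]
  show "path_of (NA k i) (arr k i t) = arr k i t + sqrt (r k) * scaledA k (arr k i t / r k) $ i"
    unfolding scaled_eq(1)[OF nn(1)] r(2) using r(1) by simp
  show "dep k i t = busy k i t + sqrt (r k) * scaledD k (busy k i t / r k) $ i"
    unfolding scaled_eq(2)[OF nn(2)] r(2) dep_def using r(1) by simp
  show "real (Phi k j i (nat \<lfloor>dep k j t\<rfloor>)) = P $ j $ i * dep k j t + sqrt (r k) * scaledPhi k (dep k j t / r k) $ j $ i"
    unfolding scaled_eq(3)[OF nn(3)] r(2) using r(1) by simp
qed

lemma q_dynamics: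
  assumes "t \<ge> 0"
  shows "q k t $ i = q k 0 $ i + path_of (NA k i) (arr k i t) + (\<Sum>j\<in>UNIV. real (Phi k j i (nat \<lfloor>dep k j t\<rfloor>))) - dep k i t"
  using dynamics[of k, unfolded queue_equation_def, rule_format, OF assms, of i]
  unfolding arrivals_def internal_arrivals_def departures_def q_def arr_def dep_def busy_def .

lemma flow_reflection:
  assumes "t \<ge> 0"
  shows "q k t = flow k t + reflection_matrix P *v idle k t"
proof -
  have "q k t $ i = (flow k t + reflection_matrix P *v idle k t) $ i" for i
  proof -
    let ?s = "sqrt (r k)"
    define A where "A = scaledA k (arr k i t / r k) $ i"
    define D where "D j = scaledD k (busy k j t / r k) $ j" for j
    define F where "F j = scaledPhi k (dep k j t / r k) $ j $ i" for j
    have dep: "dep k j t = busy k j t + ?s * D j" for j unfolding D_def by (rule unscale(2))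
    have "(\<Sum>j\<in>UNIV. ((if i = j then 1 else 0) - P $ j $ i) * D j) = D i - (\<Sum>j\<in>UNIV. P $ j $ i * D j)"
      by (rule sum_reflection_coeff)
    then have "(flow k t + reflection_matrix P *v idle k t) $ i
        = q k 0 $ i + ?s * (A + (\<Sum>j\<in>UNIV. F j) - (D i - (\<Sum>j\<in>UNIV. P $ j $ i * D j))) + arr k i t
          - ((busy k i t + idle k t $ i) - (\<Sum>j\<in>UNIV. P $ j $ i * (busy k j t + idle k t $ j)))
          + (idle k t $ i - (\<Sum>j\<in>UNIV. P $ j $ i * idle k t $ j))"
      by (simp add: flow_def noise_def net_rate_integral reflection_matrix_nth A_def D_def F_def)
    also have "\<dots> = q k 0 $ i + (arr k i t + ?s * A) + (\<Sum>j\<in>UNIV. P $ j $ i * (busy k j t + ?s * D j) + ?s * F j) - (busy k i t + ?s * D i)"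
      by (simp add: distrib_left right_diff_distrib sum.distrib sum_distrib_left sum_distrib_right mult_ac)
    also have "\<dots> = q k t $ i"
      using q_dynamics[OF assms, of k i]
      by (simp add: unscale(1) unscale(3) dep[symmetric] A_def F_def)
    finally show ?thesis by simp
  qed
  then show ?thesis unfolding vec_eq_iff by blast
qed

lemma flow_reflected: "reflected P T (flow k) (idle k)"
proof -
  define f where "f i s = mu (n k) (q k s) $ i * indicator {s. q k s $ i = 0} s" for i s
  obtain B where B: "B \<ge> 0" "\<And>s i. s \<in> {0..T} \<Longrightarrow> \<bar>mu (n k) (q k s) $ i\<bar> \<le> B"
    by (rule rates_bounded[of T k]) (rule that, assumption+)
  have fm: "f i \<in> borel_measurable borel" for i unfolding f_def by measurable
  have fB: "norm (f i s) \<le> B" if "s \<in> {0..T}" for i s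
    using B that by (auto simp: f_def indicator_def)
  have idle: "idle k t $ i = (LBINT s:{0..t}. f i s)" for t i by (simp add: idle_def f_def)
  have level: "push_level P (flow k) (idle k) i t = idle k t $ i - q k t $ i" if "t \<ge> 0" for i t
    using push_level_reflection[of "flow k" t i P "idle k"] flow_reflection[OF that, of k] by simp
  have inc: "idle k t $ i \<le> idle k s $ i + B * (b - s)"
    if "0 \<le> s" "s \<le> b" "b \<le> t" "t \<le> T" "\<forall>u\<in>{b<..t}. q k u $ i \<noteq> 0" for i s b t
  proof -
    have "(LBINT s:{0..t}. f i s) = (LBINT s:{0..b}. f i s) + (LBINT s:{b<..t}. f i s)"
      by (rule set_integral_split_Icc[where B=B]) (use that fm fB in auto)
    moreover have "(LBINT s:{0..b}. f i s) = (LBINT s:{0..s}. f i s) + (LBINT s:{s<..b}. f i s)"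
      by (rule set_integral_split_Icc[where B=B]) (use that fm fB in auto)
    moreover have "norm (LBINT s:{b<..t}. f i s) \<le> 0 * (t - b)"
      by (rule norm_set_integral_Ioc_le) (use that fm in \<open>auto simp: f_def\<close>)
    moreover have "norm (LBINT s:{s<..b}. f i s) \<le> B * (b - s)"
      by (rule norm_set_integral_Ioc_le) (use that fm fB in auto)
    ultimately show ?thesis by (simp add: idle)
  qed
  show ?thesis
  proof (rule reflectedI)
    show "idle k 0 $ i = 0" for i by (simp add: idle set_integral_singleton)
    show "mono_on {0..T} (\<lambda>t. idle k t $ i)" for i
    proof (rule mono_onI)
      fix s t :: real assume st: "s \<in> {0..T}" "t \<in> {0..T}" "s \<le> t"
      have "(LBINT s:{0..t}. f i s) = (LBINT s:{0..s}. f i s) + (LBINT s:{s<..t}. f i s)"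
        by (rule set_integral_split_Icc[where B=B]) (use st fm fB in auto)
      moreover have "0 \<le> (LBINT s:{s<..t}. f i s)"
        unfolding set_lebesgue_integral_def f_def using rate_nonneg(2) by (auto intro!: integral_nonneg_AE simp: indicator_def)
      ultimately show "idle k s $ i \<le> idle k t $ i" by (simp add: idle)
    qed
    show "push_level P (flow k) (idle k) i t \<le> idle k t $ i" if "t \<in> {0..T}" for i t
      using level[of t i] q_nonneg[of k t i] that by simp
  next
    fix i a t assume "0 \<le> a" "a \<le> t" "t \<le> T" "\<forall>s\<in>{a<..t}. push_level P (flow k) (idle k) i s \<noteq> idle k s $ i"
    then show "idle k t $ i \<le> idle k a $ i" using inc[of a a t i] level by auto
  next
    fix i b t and e :: real
    assume *: "0 < b" "b \<le> t" "t \<le> T" "\<forall>s\<in>{b..t}. push_level P (flow k) (idle k) i s \<noteq> idle k s $ i" "e > 0"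
    define s where "s = max 0 (b - e / (B + 1))"
    have s: "0 \<le> s" "s < b" "b - s \<le> e / (B + 1)" using * B(1) by (auto simp: s_def)
    have "B * (b - s) \<le> B * (e / (B + 1))" using s B(1) by (intro mult_left_mono)
    also have "\<dots> \<le> e" using B(1) *(5) by (simp add: field_simps)
    finally have "idle k t $ i \<le> idle k s $ i + e" using inc[of s b t i] level s * by auto
    then show "\<exists>a\<in>{0..<b}. idle k t $ i \<le> idle k a $ i + e" using s by auto
  qed
qed

lemma r_lim: "filterlim r at_top sequentially"
  unfolding r_def by (rule filterlim_compose[OF filterlim_real_sequentially n_lim])

lemma sqrt_r_lim: "filterlim (\<lambda>k. sqrt (r k)) at_top sequentially"
  by (rule filterlim_compose[OF sqrt_at_top r_lim])

lemma scaled_uniform_limits: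
  "uniform_limit {0..T} scaledA (path_of WA) sequentially"
  "uniform_limit {0..T} scaledD (path_of WD) sequentially"
  "uniform_limit {0..T} scaledPhi (path_of WPhi) sequentially"
  unfolding scaledA_def scaledD_def scaledPhi_def
  by (intro skorohod_limit_imp_uniform_limit primitives W_continuous)+

lemma scaled_small:
  assumes "e > 0"
  shows "\<forall>\<^sub>F k in sequentially. \<forall>t\<in>{0..B}. norm (scaledA k t) \<le> e * sqrt (r k)"
    "\<forall>\<^sub>F k in sequentially. \<forall>t\<in>{0..B}. norm (scaledD k t) \<le> e * sqrt (r k)"
    "\<forall>\<^sub>F k in sequentially. \<forall>t\<in>{0..B}. norm (scaledPhi k t) \<le> e * sqrt (r k)"
proof -
  have bdd: "\<exists>c. \<forall>t\<in>{0..B}. norm (w t) \<le> c" if "continuous_on {0..} w" for w :: "real \<Rightarrow> 'b::real_normed_vector"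
  proof -
    have "bounded (w ` {0..B})"
      by (intro compact_imp_bounded compact_continuous_image continuous_on_subset[OF that]) auto
    then show ?thesis unfolding bounded_iff by blast
  qed
  obtain a b c where "\<forall>t\<in>{0..B}. norm (path_of WA t) \<le> a" "\<forall>t\<in>{0..B}. norm (path_of WD t) \<le> b"
      "\<forall>t\<in>{0..B}. norm (path_of WPhi t) \<le> c"
    using bdd[OF W_continuous(1)] bdd[OF W_continuous(2)] bdd[OF W_continuous(3)] by blast
  then show "\<forall>\<^sub>F k in sequentially. \<forall>t\<in>{0..B}. norm (scaledA k t) \<le> e * sqrt (r k)"
    "\<forall>\<^sub>F k in sequentially. \<forall>t\<in>{0..B}. norm (scaledD k t) \<le> e * sqrt (r k)"
    "\<forall>\<^sub>F k in sequentially. \<forall>t\<in>{0..B}. norm (scaledPhi k t) \<le> e * sqrt (r k)"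
    by (auto intro!: uniform_limit_eventually_small[OF scaled_uniform_limits(1) _ sqrt_r_lim assms]
      uniform_limit_eventually_small[OF scaled_uniform_limits(2) _ sqrt_r_lim assms]
      uniform_limit_eventually_small[OF scaled_uniform_limits(3) _ sqrt_r_lim assms])
qed

lemma initial_small:
  assumes "e > 0"
  shows "\<forall>\<^sub>F k in sequentially. norm (q k 0) \<le> e * r k"
proof -
  have "(\<lambda>k. norm (q k 0 /\<^sub>R sqrt (r k))) \<longlonglongrightarrow> norm X0"
    using tendsto_norm[OF initial] by (simp add: q_def r_def)
  then have "\<forall>\<^sub>F k in sequentially. norm (q k 0 /\<^sub>R sqrt (r k)) < norm X0 + 1"
    by (rule order_tendstoD(2)) simp
  moreover have "\<forall>\<^sub>F k in sequentially. (norm X0 + 1) / e \<le> sqrt (r k)"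
    using sqrt_r_lim by (simp add: filterlim_at_top)
  ultimately show ?thesis
  proof eventually_elim
    case (elim k)
    have s: "sqrt (r k) > 0" using r_pos by simp
    have "norm (q k 0) < (norm X0 + 1) * sqrt (r k)"
      using elim(1) s by (simp add: field_simps abs_of_pos)
    also have "\<dots> \<le> e * sqrt (r k) * sqrt (r k)"
      using elim(2) s assms by (intro mult_right_mono) (auto simp: pos_divide_le_eq mult.commute)
    finally show ?case using r_pos[of k] by (simp add: mult.assoc)
  qed
qed

lemma q_sum_le:
  assumes "t \<ge> 0"
  shows "(\<Sum>i\<in>UNIV. q k t $ i) \<le> (\<Sum>i\<in>UNIV. q k 0 $ i) + (\<Sum>i\<in>UNIV. path_of (NA k i) (arr k i t))"
proof -
  have "(\<Sum>i\<in>UNIV. \<Sum>j\<in>UNIV. real (Phi k j i (nat \<lfloor>dep k j t\<rfloor>))) = (\<Sum>j\<in>UNIV. real (\<Sum>i\<in>UNIV. Phi k j i (nat \<lfloor>dep k j t\<rfloor>)))"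
    by (subst sum.swap) simp
  also have "\<dots> \<le> (\<Sum>j\<in>UNIV. dep k j t)"
  proof (rule sum_mono)
    fix j
    have "real (\<Sum>i\<in>UNIV. Phi k j i (nat \<lfloor>dep k j t\<rfloor>)) \<le> real (nat \<lfloor>dep k j t\<rfloor>)"
      using Phi_sum by (simp only: of_nat_le_iff)
    also have "\<dots> = dep k j t" using dep_Nats[of k j t] by (auto simp: Nats_def)
    finally show "real (\<Sum>i\<in>UNIV. Phi k j i (nat \<lfloor>dep k j t\<rfloor>)) \<le> dep k j t" .
  qed
  finally show ?thesis
    by (simp only: q_dynamics[OF assms] sum.distrib sum_subtractf)
qed

lemma arr_mono: "s \<le> t \<Longrightarrow> arr k i s \<le> arr k i t"
  unfolding arr_def set_lebesgue_integral_def
  by (intro integral_mono rates_integrable(1)[unfolded set_integrable_def])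
    (use rate_nonneg in \<open>auto simp: indicator_def\<close>)

definition total_arr where "total_arr k t = (\<Sum>i\<in>UNIV. arr k i t) / r k"

lemma arr_le_total: "arr k i t / r k \<le> total_arr k t"
  unfolding total_arr_def using r_pos[of k] times_nonneg(1)
  by (intro divide_right_mono member_le_sum) auto

lemma q_le_total_arr:
  assumes t: "t \<ge> 0" and small: "\<forall>t\<in>{0..B}. norm (scaledA k t) \<le> 1 * sqrt (r k)"
    and q0: "(\<Sum>i\<in>UNIV. q k 0 $ i) \<le> r k" and B: "total_arr k t \<le> B"
  shows "norm (q k t) \<le> r k * (1 + real CARD('k) + total_arr k t)"
proof -
  have "path_of (NA k i) (arr k i t) \<le> arr k i t + r k" for i
  proof -
    have "arr k i t / r k \<in> {0..B}" using arr_le_total[of k i t] B times_nonneg(1) r_pos[of k] by auto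
    then have "scaledA k (arr k i t / r k) $ i \<le> sqrt (r k)"
      using small component_le_norm_cart[of "scaledA k (arr k i t / r k)" i] by fastforce
    then have "sqrt (r k) * scaledA k (arr k i t / r k) $ i \<le> sqrt (r k) * sqrt (r k)"
      using r_pos[of k] by (intro mult_left_mono) auto
    then show ?thesis using unscale(1)[of k i t] r_pos[of k] by simp
  qed
  then have "(\<Sum>i\<in>UNIV. path_of (NA k i) (arr k i t)) \<le> (\<Sum>i\<in>(UNIV::'k set). arr k i t + r k)" by (intro sum_mono)
  moreover have "norm (q k t) \<le> (\<Sum>i\<in>UNIV. q k t $ i)"
    using norm_le_l1_cart[of "q k t"] q_nonneg[of k t] by simp
  ultimately have "norm (q k t) \<le> r k + ((\<Sum>i\<in>UNIV. arr k i t) + real CARD('k) * r k)"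
    using q_sum_le[OF t, of k] q0 by (simp add: sum.distrib)
  also have "\<dots> = r k * (1 + real CARD('k) + total_arr k t)"
    using r_pos[of k] by (simp add: total_arr_def field_simps)
  finally show ?thesis .
qed

text \<open>
  The noise is controlled only at times up to \<open>B\<close>, so Gronwall's inequality is applied up to the
  first instant at which \<open>total_arr k\<close> reaches \<open>B\<close>.
\<close>

lemma total_arr_bound:
  fixes T :: real
  defines "N \<equiv> real CARD('k)"
  defines "B \<equiv> 2 * (2 + N) * exp (2 * (N * C) * T)"
  assumes small: "\<forall>t\<in>{0..B}. norm (scaledA k t) \<le> 1 * sqrt (r k)"
    and q0: "(\<Sum>i\<in>UNIV. q k 0 $ i) \<le> r k" and t: "t \<in> {0..T}"
  shows "total_arr k t \<le> B"
proof (rule ccontr)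
  assume gt: "\<not> total_arr k t \<le> B"
  have N: "N \<ge> 1" unfolding N_def by (simp add: Suc_leI)
  have NC: "N * C > 0" using N C by simp
  obtain b where b: "b \<ge> 0" "\<And>s i. s \<in> {0..T} \<Longrightarrow> \<bar>lam (n k) (q k s) $ i\<bar> \<le> b"
    by (rule rates_bounded[of T k]) (rule that, assumption+)
  have cont: "continuous_on {0..T} (total_arr k)"
    unfolding total_arr_def arr_def
    by (intro continuous_intros set_integral_continuous[where B=b]) (use b r_pos[of k] in auto)
  have mono: "total_arr k s \<le> total_arr k s'" if "s \<le> s'" for s s'
    unfolding total_arr_def using r_pos[of k] that by (intro divide_right_mono sum_mono arr_mono) auto
  have "arr k i 0 = 0" for i by (simp add: arr_def set_integral_singleton)
  then have "total_arr k 0 = 0" by (simp add: total_arr_def)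
  moreover have "0 \<le> B" using N by (simp add: B_def)
  ultimately have "\<exists>s\<ge>0. s \<le> t \<and> total_arr k s = B"
    using gt t by (intro IVT' continuous_on_subset[OF cont]) auto
  then obtain \<tau> where \<tau>: "0 \<le> \<tau>" "\<tau> \<le> t" "total_arr k \<tau> = B" by blast
  define f where "f s = 2 + N + total_arr k s" for s
  have q: "norm (q k s) \<le> r k * (1 + N + total_arr k s)" if "s \<in> {0..\<tau>}" for s
    unfolding N_def by (rule q_le_total_arr[OF _ small q0]) (use that mono[of s \<tau>] \<tau> in auto)
  have nonneg: "0 \<le> total_arr k s" for s
    unfolding total_arr_def using times_nonneg(1) r_pos[of k] by (intro divide_nonneg_pos sum_nonneg)
  have fm: "f \<in> borel_measurable borel"
    using mono by (intro borel_measurable_mono) (auto simp: f_def mono_def)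
  have fB: "\<bar>f s\<bar> \<le> 2 + N + B" if "s \<in> {0..\<tau>}" for s
    using mono[of s \<tau>] that \<tau> nonneg[of s] N by (auto simp: f_def)
  have "f \<tau> \<le> 2 * (2 + N) * exp (2 * (N * C) * \<tau>)"
  proof (rule gronwall_bounded[OF fm fB NC])
    show "f s \<le> 2 + N + N * C * (LBINT u:{0..s}. f u)" if s: "s \<in> {0..\<tau>}" for s
    proof -
      have "arr k i s \<le> r k * (C * (LBINT u:{0..s}. f u))" for i
      proof -
        have fi: "set_integrable lborel {0..s} f"
          using fm fB s by (intro set_integrable_bounded[where a=0 and b=s and B="2 + N + B"]) auto
        have "arr k i s \<le> (LBINT u:{0..s}. (r k * C) * f u)"
          unfolding arr_def
        proof (rule set_integral_mono)
          show "lam (n k) (q k u) $ i \<le> (r k * C) * f u" if "u \<in> {0..s}" for u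
          proof -
            have "lam (n k) (q k u) $ i \<le> C * (r k + norm (q k u))"
              using growth(1)[OF n_ge_1[of k] q_orthant[of k u], of i] by (simp add: r_def)
            also have "\<dots> \<le> C * (r k + r k * (1 + N + total_arr k u))"
              using q[of u] that s C by (intro mult_left_mono add_left_mono) auto
            finally show ?thesis by (simp add: f_def algebra_simps)
          qed
        qed (use rates_integrable fi in auto)
        then show ?thesis by (simp add: mult.assoc)
      qed
      then have "(\<Sum>i\<in>UNIV. arr k i s) \<le> (\<Sum>i\<in>(UNIV::'k set). r k * (C * (LBINT u:{0..s}. f u)))" by (rule sum_mono)
      then have "total_arr k s \<le> N * C * (LBINT u:{0..s}. f u)"
        unfolding total_arr_def using r_pos[of k] by (simp add: N_def pos_divide_le_eq mult_ac)
      then show ?thesis by (simp add: f_def)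
    qed
  qed (use \<tau> N in auto)
  also have "\<dots> \<le> B"
  proof -
    have "2 * (N * C) * \<tau> \<le> 2 * (N * C) * T" using NC \<tau> t by (intro mult_left_mono) auto
    then show ?thesis unfolding B_def using N by (intro mult_left_mono) auto
  qed
  finally show False using \<tau>(3) N by (simp add: f_def)
qed

lemma uniform_bounds:
  assumes T: "T \<ge> 0"
  obtains B where "B \<ge> 0" "\<forall>\<^sub>F k in sequentially. \<forall>t\<in>{0..T}. norm (q k t) \<le> B * r k \<and>
     (\<forall>i. arr k i t / r k \<le> B \<and> busy k i t / r k \<le> B \<and> dep k i t / r k \<le> B)"
proof -
  define N where "N = real CARD('k)"
  define B1 where "B1 = 2 * (2 + N) * exp (2 * (N * C) * T)"
  define B2 where "B2 = C * (2 + N + B1) * T"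
  have N: "N \<ge> 1" unfolding N_def by (simp add: Suc_leI)
  have B1: "B1 \<ge> 0" unfolding B1_def using N by simp
  have B2: "B2 \<ge> 0" unfolding B2_def using N B1 C T by simp
  define B where "B = 2 + N + B1 + B2"
  have "\<forall>\<^sub>F k in sequentially. norm (q k 0) \<le> 1 / N * r k"
    using N by (intro initial_small) auto
  moreover have "\<forall>\<^sub>F k in sequentially. \<forall>t\<in>{0..B1}. norm (scaledA k t) \<le> 1 * sqrt (r k)"
    by (rule scaled_small(1)) simp
  moreover have "\<forall>\<^sub>F k in sequentially. \<forall>t\<in>{0..B2}. norm (scaledD k t) \<le> 1 * sqrt (r k)"
    by (rule scaled_small(2)) simp
  ultimately have "\<forall>\<^sub>F k in sequentially. \<forall>t\<in>{0..T}. norm (q k t) \<le> B * r k \<and>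
     (\<forall>i. arr k i t / r k \<le> B \<and> busy k i t / r k \<le> B \<and> dep k i t / r k \<le> B)"
  proof eventually_elim
    case (elim k)
    have "(\<Sum>i\<in>UNIV. q k 0 $ i) \<le> (\<Sum>i\<in>(UNIV::'k set). norm (q k 0))"
      using component_le_norm_cart[of "q k 0"] by (intro sum_mono) (auto intro: order_trans[OF abs_ge_self])
    also have "\<dots> \<le> r k" using elim(1) N by (simp add: N_def field_simps)
    finally have q0: "(\<Sum>i\<in>UNIV. q k 0 $ i) \<le> r k" .
    have G: "total_arr k t \<le> B1" if "t \<in> {0..T}" for t
      unfolding B1_def N_def by (rule total_arr_bound[OF elim(2)[unfolded B1_def N_def] q0 that])
    have q: "norm (q k t) \<le> r k * (1 + N + B1)" if "t \<in> {0..T}" for t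
    proof -
      have "norm (q k t) \<le> r k * (1 + N + total_arr k t)"
        unfolding N_def by (rule q_le_total_arr[OF _ elim(2) q0 G[OF that]]) (use that in auto)
      also have "\<dots> \<le> r k * (1 + N + B1)" using G[OF that] r_pos[of k] by (intro mult_left_mono) auto
      finally show ?thesis .
    qed
    have mu: "mu (n k) (q k s) $ i \<le> C * (2 + N + B1) * r k" if "s \<in> {0..T}" for s i
    proof -
      have "mu (n k) (q k s) $ i \<le> C * (r k + norm (q k s))"
        using growth(2)[OF n_ge_1[of k] q_orthant[of k s], of i] by (simp add: r_def)
      also have "\<dots> \<le> C * (r k + r k * (1 + N + B1))"
        using q[OF that] C by (intro mult_left_mono add_left_mono) auto
      finally show ?thesis by (simp add: algebra_simps)
    qed
    have busy: "busy k i t / r k \<le> B2" if t: "t \<in> {0..T}" for i t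
    proof -
      have c: "0 \<le> C * (2 + N + B1) * r k" using C N B1 r_pos[of k] by simp
      have "norm (busy k i t) \<le> (C * (2 + N + B1) * r k) * t"
        unfolding busy_def
        by (rule norm_set_integral_Icc_le[OF indicator_q_measurable(1)])
          (use t mu rate_nonneg(2) c in \<open>auto simp: indicator_def\<close>)
      also have "\<dots> \<le> (C * (2 + N + B1) * r k) * T" using t c by (intro mult_left_mono) auto
      finally show ?thesis using r_pos[of k] times_nonneg(2)[of k i t] by (simp add: B2_def pos_divide_le_eq mult_ac)
    qed
    have dep: "dep k i t / r k \<le> B2 + 1" if t: "t \<in> {0..T}" for i t
    proof -
      have "busy k i t / r k \<in> {0..B2}" using busy[OF t] times_nonneg(2) r_pos[of k] by auto
      then have "scaledD k (busy k i t / r k) $ i \<le> sqrt (r k)"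
        using elim(3) component_le_norm_cart[of "scaledD k (busy k i t / r k)" i] by fastforce
      then have "sqrt (r k) * scaledD k (busy k i t / r k) $ i \<le> sqrt (r k) * sqrt (r k)"
        using r_pos[of k] by (intro mult_left_mono) auto
      then have "dep k i t \<le> busy k i t + r k" using unscale(2)[of k i t] r_pos[of k] by simp
      then have "dep k i t / r k \<le> (busy k i t + r k) / r k" using r_pos[of k] by (intro divide_right_mono) auto
      also have "\<dots> \<le> B2 + 1" using busy[OF t, of i] r_pos[of k] by (simp add: add_divide_distrib)
      finally show ?thesis .
    qed
    show ?case
    proof (intro ballI conjI allI)
      fix t i assume t: "t \<in> {0..T}"
      have "r k * (1 + N + B1) \<le> r k * B" using r_pos[of k] B2 by (intro mult_left_mono) (auto simp: B_def)
      then show "norm (q k t) \<le> B * r k" using q[OF t] by (simp add: mult.commute)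
      show "arr k i t / r k \<le> B" using arr_le_total[of k i t] G[OF t] B2 N by (simp add: B_def)
      show "busy k i t / r k \<le> B" using busy[OF t, of i] B1 N by (simp add: B_def)
      show "dep k i t / r k \<le> B" using dep[OF t, of i] B1 N by (simp add: B_def)
    qed
  qed
  moreover have "B \<ge> 0" using B1 B2 N by (simp add: B_def)
  ultimately show thesis by (intro that)
qed

lemma compact_orthant_cball: "compact (orthant \<inter> cball 0 B :: (real^'k) set)"
proof -
  have *: "(orthant :: (real^'k) set) = (\<Inter>i. {x. 0 \<le> x $ i})" by (auto simp: orthant_def)
  moreover have "closed {x :: real^'k. 0 \<le> x $ i}" for i
    by (intro closed_Collect_le continuous_intros)
  ultimately have "closed (orthant :: (real^'k) set)" unfolding * by (intro closed_INT ballI)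
  then show ?thesis by (intro closed_Int_compact) auto
qed

lemma noise_bound:
  assumes "\<forall>t\<in>{0..B}. norm (scaledA k t) \<le> c" "\<forall>t\<in>{0..B}. norm (scaledD k t) \<le> c" "\<forall>t\<in>{0..B}. norm (scaledPhi k t) \<le> c"
    and b: "\<And>i. arr k i t / r k \<le> B" "\<And>i. busy k i t / r k \<le> B" "\<And>i. dep k i t / r k \<le> B"
  shows "norm (noise k t) \<le> real CARD('k) * (2 * (1 + real CARD('k))) * c"
proof -
  have A: "\<bar>scaledA k (arr k i t / r k) $ i\<bar> \<le> c" for i
  proof -
    have "norm (scaledA k (arr k i t / r k)) \<le> c"
      using assms(1) b(1)[of i] times_nonneg(1)[of k i t] r_pos[of k] by simp
    then show ?thesis using component_le_norm_cart order_trans by blast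
  qed
  have D: "\<bar>scaledD k (busy k i t / r k) $ i\<bar> \<le> c" for i
  proof -
    have "norm (scaledD k (busy k i t / r k)) \<le> c"
      using assms(2) b(2)[of i] times_nonneg(2)[of k i t] r_pos[of k] by simp
    then show ?thesis using component_le_norm_cart order_trans by blast
  qed
  have F: "\<bar>scaledPhi k (dep k j t / r k) $ j $ i\<bar> \<le> c" for i j
  proof -
    have "norm (scaledPhi k (dep k j t / r k)) \<le> c"
      using assms(3) b(3)[of j] dep_nonneg[of k j t] r_pos[of k] by simp
    then show ?thesis
      using component_le_norm_cart[of "scaledPhi k (dep k j t / r k) $ j" i] Finite_Cartesian_Product.norm_nth_le[of "scaledPhi k (dep k j t / r k)" j]
      by linarith
  qed
  have c0: "0 \<le> c" using A[of undefined] by linarith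
  have comp: "\<bar>noise k t $ i\<bar> \<le> 2 * (1 + real CARD('k)) * c" for i
  proof -
    have "\<bar>\<Sum>j\<in>UNIV. scaledPhi k (dep k j t / r k) $ j $ i\<bar> \<le> (\<Sum>j\<in>(UNIV::'k set). c)"
      using F by (intro order_trans[OF sum_abs] sum_mono) auto
    moreover have "\<bar>\<Sum>j\<in>UNIV. P $ j $ i * scaledD k (busy k j t / r k) $ j\<bar> \<le> (\<Sum>j\<in>(UNIV::'k set). c)"
    proof (intro order_trans[OF sum_abs] sum_mono)
      fix j show "\<bar>P $ j $ i * scaledD k (busy k j t / r k) $ j\<bar> \<le> c"
        using mult_mono[of "P $ j $ i" 1 "\<bar>scaledD k (busy k j t / r k) $ j\<bar>" c] P_bounds[of j i] D[of j] c0
        by (simp add: abs_mult)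
    qed
    ultimately show ?thesis
      using A[of i] D[of i] unfolding noise_def vec_lambda_beta sum_reflection_coeff
      by (simp add: algebra_simps)
  qed
  have "norm (noise k t) \<le> (\<Sum>i\<in>UNIV. \<bar>noise k t $ i\<bar>)" by (rule norm_le_l1_cart)
  also have "\<dots> \<le> (\<Sum>i\<in>(UNIV::'k set). 2 * (1 + real CARD('k)) * c)" using comp by (intro sum_mono)
  finally show ?thesis by simp
qed

lemma fluid_net_rate:
  assumes "compact K" "K \<subseteq> orthant"
  shows "uniform_limit K (\<lambda>k x. net_rate k (r k *\<^sub>R x) $ i / r k) (\<lambda>_. 0) sequentially"
proof -
  have "uniform_limit K (\<lambda>m x. lam m (real m *\<^sub>R x) $ i / real m
      - (mu m (real m *\<^sub>R x) $ i / real m - (\<Sum>j\<in>UNIV. P $ j $ i * (mu m (real m *\<^sub>R x) $ j / real m))))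
    (\<lambda>x. lam_lim x $ i - (mu_lim x $ i - (\<Sum>j\<in>UNIV. P $ j $ i * mu_lim x $ j))) sequentially"
    by (intro uniform_limit_minus uniform_limit_sum_finite uniform_limit_mult_const fluid_lam fluid_mu assms finite)
  moreover have "lam_lim x $ i - (mu_lim x $ i - (\<Sum>j\<in>UNIV. P $ j $ i * mu_lim x $ j)) = 0" if "x \<in> K" for x
    using arg_cong[OF traffic[of x], of "\<lambda>v. v $ i"] assms that by (auto simp: reflection_matrix_nth)
  ultimately have "uniform_limit K (\<lambda>m x. lam m (real m *\<^sub>R x) $ i / real m
      - (mu m (real m *\<^sub>R x) $ i / real m - (\<Sum>j\<in>UNIV. P $ j $ i * (mu m (real m *\<^sub>R x) $ j / real m)))) (\<lambda>_. 0) sequentially"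
    by (subst uniform_limit_cong'[where g="\<lambda>m x. lam m (real m *\<^sub>R x) $ i / real m
      - (mu m (real m *\<^sub>R x) $ i / real m - (\<Sum>j\<in>UNIV. P $ j $ i * (mu m (real m *\<^sub>R x) $ j / real m)))"
      and i="\<lambda>x. lam_lim x $ i - (mu_lim x $ i - (\<Sum>j\<in>UNIV. P $ j $ i * mu_lim x $ j))"]) auto
  from filterlim_compose[OF this n_lim]
  show ?thesis
    by (simp add: net_rate_def r_def reflection_matrix_nth diff_divide_distrib sum_divide_distrib mult.assoc)
qed

lemma fluid_rates:
  assumes "compact K" "K \<subseteq> orthant"
  shows "uniform_limit K (\<lambda>k x. lam (n k) (r k *\<^sub>R x) $ i / r k) (\<lambda>x. lam_lim x $ i) sequentially"
    "uniform_limit K (\<lambda>k x. mu (n k) (r k *\<^sub>R x) $ i / r k) (\<lambda>x. mu_lim x $ i) sequentially"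
  unfolding r_def
  by (rule filterlim_compose[OF fluid_lam[OF assms] n_lim], rule filterlim_compose[OF fluid_mu[OF assms] n_lim])

lemma flow_small:
  assumes T: "T \<ge> 0" and e: "e > 0"
  shows "\<forall>\<^sub>F k in sequentially. \<forall>t\<in>{0..T}. norm (flow k t) \<le> e * r k"
proof -
  define N where "N = real CARD('k)"
  have N: "N \<ge> 1" unfolding N_def by (simp add: Suc_leI)
  obtain B where B: "B \<ge> 0" "\<forall>\<^sub>F k in sequentially. \<forall>t\<in>{0..T}. norm (q k t) \<le> B * r k \<and>
     (\<forall>i. arr k i t / r k \<le> B \<and> busy k i t / r k \<le> B \<and> dep k i t / r k \<le> B)"
    by (rule uniform_bounds[OF T])
  define e1 where "e1 = e / 3 / (N * (2 * (1 + N)))"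
  have e1: "e1 > 0" unfolding e1_def using e N by simp
  define e2 where "e2 = e / 3 / (N * (T + 1))"
  have e2: "e2 > 0" unfolding e2_def using e N T by simp
  have K: "compact (orthant \<inter> cball 0 B :: (real^'k) set)" by (rule compact_orthant_cball)
  have "\<forall>\<^sub>F k in sequentially. \<forall>i. \<forall>x\<in>orthant \<inter> cball 0 B. dist (net_rate k (r k *\<^sub>R x) $ i / r k) 0 < e2"
    by (intro eventually_all_finite uniform_limitD[OF fluid_net_rate[OF K]] e2) auto
  moreover have "\<forall>\<^sub>F k in sequentially. norm (q k 0) \<le> e / 3 * r k" using e by (intro initial_small) auto
  ultimately show ?thesis
    using B(2) scaled_small[OF e1, of B]
  proof eventually_elim
    case (elim k)
    show ?case
    proof
      fix t assume t: "t \<in> {0..T}"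
      have s: "sqrt (r k) * sqrt (r k) = r k" using r_pos[of k] by simp
      have "norm (noise k t) \<le> N * (2 * (1 + N)) * (e1 * sqrt (r k))"
        unfolding N_def by (rule noise_bound[OF elim(4,5,6)]) (use elim(3) t in auto)
      also have "\<dots> = e / 3 * sqrt (r k)" using N by (simp add: e1_def)
      finally have "sqrt (r k) * norm (noise k t) \<le> sqrt (r k) * (e / 3 * sqrt (r k))"
        using r_pos[of k] by (intro mult_left_mono) auto
      then have noise: "norm (sqrt (r k) *\<^sub>R noise k t) \<le> e / 3 * r k"
        using r_pos[of k] s by (simp add: mult.left_commute)
      have rate: "norm (net_rate k (q k u)) \<le> N * (e2 * r k)" if u: "u \<in> {0..t}" for u
      proof -
        have "norm (q k u) \<le> B * r k" using elim(3) u t by auto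
        then have "norm (q k u /\<^sub>R r k) \<le> B" using r_pos[of k] by (simp add: field_simps)
        moreover have "q k u /\<^sub>R r k \<in> orthant" using q_nonneg[of k u] r_pos[of k] by (auto simp: orthant_def)
        ultimately have "dist (net_rate k (r k *\<^sub>R (q k u /\<^sub>R r k)) $ i / r k) 0 < e2" for i
          using elim(1) by (metis IntI mem_cball_0)
        moreover have "r k *\<^sub>R (q k u /\<^sub>R r k) = q k u" using r_pos[of k] by simp
        ultimately have "\<bar>net_rate k (q k u) $ i\<bar> / r k < e2" for i
          using r_pos[of k] by (simp only: dist_norm diff_0_right real_norm_def abs_divide abs_of_pos)
        then have "\<bar>net_rate k (q k u) $ i\<bar> \<le> e2 * r k" for i
          using r_pos[of k] by (simp add: field_simps less_imp_le)
        then have "(\<Sum>i\<in>UNIV. \<bar>net_rate k (q k u) $ i\<bar>) \<le> (\<Sum>i\<in>(UNIV::'k set). e2 * r k)" by (intro sum_mono)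
        then show ?thesis using norm_le_l1_cart[of "net_rate k (q k u)"] by (simp add: N_def)
      qed
      have "norm (LBINT s:{0..t}. net_rate k (q k s)) \<le> N * (e2 * r k) * t"
        by (rule norm_set_integral_Icc_le) (use rate t in auto)
      also have "\<dots> \<le> N * (e2 * r k) * (T + 1)"
        using t N e2 r_pos[of k] by (intro mult_left_mono) auto
      also have "\<dots> = e2 * (N * (T + 1)) * r k" by (simp add: mult_ac)
      also have "e2 * (N * (T + 1)) = e / 3"
      proof -
        have "N * (T + 1) \<noteq> 0" using N T by auto
        then show ?thesis unfolding e2_def by (rule nonzero_eq_divide_eq[THEN iffD1]) simp
      qed
      finally have int: "norm (LBINT s:{0..t}. net_rate k (q k s)) \<le> e / 3 * r k" .
      have "norm (flow k t) \<le> e / 3 * r k + e / 3 * r k + e / 3 * r k"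
        unfolding flow_def by (intro norm_triangle_le add_mono elim(2) noise int)
      then show "norm (flow k t) \<le> e * r k" by simp
    qed
  qed
qed

lemma idle_and_queue_small:
  assumes T: "T \<ge> 0" and e: "e > 0"
  shows "\<forall>\<^sub>F k in sequentially. \<forall>t\<in>{0..T}. norm (idle k t) \<le> e * r k \<and> norm (q k t) \<le> e * r k"
proof -
  obtain c where lip: "reflection_lipschitz P c" using reflection_lipschitz_exists[OF P] by blast
  then have c: "c > 0" by (simp add: reflection_lipschitz_def)
  have "\<forall>\<^sub>F k in sequentially. \<forall>t\<in>{0..T}. norm (flow k t) \<le> e / c * r k"
    using T e c by (intro flow_small) auto
  then show ?thesis
  proof eventually_elim
    case (elim k)
    show ?case
    proof
      fix t assume t: "t \<in> {0..T}"
      have f: "norm (flow k s - 0) \<le> e / c * r k" if "s \<in> {0..T}" for s using elim that by simp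
      have "norm (idle k t - 0) \<le> c * (e / c * r k)"
        "norm ((flow k t + reflection_matrix P *v idle k t) - (0 + reflection_matrix P *v 0)) \<le> c * (e / c * r k)"
        by (rule reflection_lipschitzD[OF lip flow_reflected reflected_zero f t]; assumption)+
      then show "norm (idle k t) \<le> e * r k \<and> norm (q k t) \<le> e * r k"
        using flow_reflection[of t k] t c by simp
    qed
  qed
qed

lemma zero_orthant: "0 \<in> orthant" by (simp add: orthant_def)

lemma fluid_rates_nonneg: "0 \<le> lam_lim 0 $ i" "0 \<le> mu_lim 0 $ i"
proof -
  have K: "compact {0 :: real^'k}" "{0 :: real^'k} \<subseteq> orthant" using zero_orthant by auto
  have "(\<lambda>k. lam (n k) (r k *\<^sub>R 0) $ i / r k) \<longlonglongrightarrow> lam_lim 0 $ i"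
    by (rule tendsto_uniform_limitI[OF fluid_rates(1)[OF K]]) simp
  then show "0 \<le> lam_lim 0 $ i"
    by (rule tendsto_lowerbound)
      (use rates_orthant[OF n_ge_1 zero_orthant] r_pos in \<open>auto simp: orthant_def less_imp_le\<close>)
  have "(\<lambda>k. mu (n k) (r k *\<^sub>R 0) $ i / r k) \<longlonglongrightarrow> mu_lim 0 $ i"
    by (rule tendsto_uniform_limitI[OF fluid_rates(2)[OF K]]) simp
  then show "0 \<le> mu_lim 0 $ i"
    by (rule tendsto_lowerbound)
      (use rates_orthant[OF n_ge_1 zero_orthant] r_pos in \<open>auto simp: orthant_def less_imp_le\<close>)
qed

lemma rate_along_queue:
  assumes lim: "\<And>K. compact K \<Longrightarrow> K \<subseteq> orthant \<Longrightarrow>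
      uniform_limit K (\<lambda>k x. f k (r k *\<^sub>R x) $ i / r k) (\<lambda>x. F x $ i) sequentially"
    and F: "continuous_on orthant (\<lambda>x. F x $ i)" and T: "T \<ge> 0" and e: "e > (0::real)"
  shows "\<forall>\<^sub>F k in sequentially. \<forall>s\<in>{0..T}. \<bar>f k (q k s) $ i - r k * F 0 $ i\<bar> \<le> e * r k"
proof -
  have "\<forall>e>0. \<exists>d>0. \<forall>x\<in>orthant. dist x 0 < d \<longrightarrow> dist (F x $ i) (F 0 $ i) < e"
    using F zero_orthant unfolding continuous_on_iff by blast
  then obtain d where d: "d > 0" "\<And>x. x \<in> orthant \<Longrightarrow> dist x 0 < d \<Longrightarrow> dist (F x $ i) (F 0 $ i) < e/2"
    using half_gt_zero[OF e] by blast
  define b where "b = min 1 (d/2)"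
  have b: "b > 0" "b < d" using d(1) by (auto simp: b_def)
  have "\<forall>\<^sub>F k in sequentially. \<forall>x\<in>orthant \<inter> cball 0 b. dist (f k (r k *\<^sub>R x) $ i / r k) (F x $ i) < e/2"
    by (rule uniform_limitD[OF lim[OF compact_orthant_cball]]) (use e in auto)
  moreover have "\<forall>\<^sub>F k in sequentially. \<forall>t\<in>{0..T}. norm (idle k t) \<le> b * r k \<and> norm (q k t) \<le> b * r k"
    by (rule idle_and_queue_small[OF T b(1)])
  ultimately show ?thesis
  proof eventually_elim
    case (elim k)
    show ?case
    proof
      fix s assume s: "s \<in> {0..T}"
      define x where "x = q k s /\<^sub>R r k"
      have qx: "q k s = r k *\<^sub>R x" using r_pos[of k] by (simp add: x_def)
      have "norm (q k s) \<le> b * r k" using elim(2) s by blast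
      then have "norm x \<le> b" using r_pos[of k] by (simp add: x_def field_simps)
      moreover have xo: "x \<in> orthant" using q_nonneg[of k s] r_pos[of k] by (auto simp: orthant_def x_def)
      ultimately have "dist (f k (r k *\<^sub>R x) $ i / r k) (F x $ i) < e/2" "dist (F x $ i) (F 0 $ i) < e/2"
        using elim(1) d(2)[OF xo] b(2) by auto
      then have "\<bar>f k (q k s) $ i / r k - F 0 $ i\<bar> < e" unfolding qx dist_real_def by linarith
      then have "\<bar>f k (q k s) $ i / r k - F 0 $ i\<bar> * r k \<le> e * r k" using r_pos[of k] by (intro mult_right_mono) auto
      moreover have "\<bar>f k (q k s) $ i / r k - F 0 $ i\<bar> * r k = \<bar>(f k (q k s) $ i / r k - F 0 $ i) * r k\<bar>"
        using r_pos[of k] by (simp add: abs_mult)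
      moreover have "(f k (q k s) $ i / r k - F 0 $ i) * r k = f k (q k s) $ i - r k * F 0 $ i"
        using r_pos[of k] by (simp add: field_simps)
      ultimately show "\<bar>f k (q k s) $ i - r k * F 0 $ i\<bar> \<le> e * r k" by simp
    qed
  qed
qed

lemma rate_integral_limit:
  assumes lim: "\<And>K. compact K \<Longrightarrow> K \<subseteq> orthant \<Longrightarrow>
      uniform_limit K (\<lambda>k x. f k (r k *\<^sub>R x) $ i / r k) (\<lambda>x. F x $ i) sequentially"
    and F: "continuous_on orthant (\<lambda>x. F x $ i)" and T: "T \<ge> 0"
    and meas: "\<And>k. (\<lambda>s. f k (q k s) $ i) \<in> borel_measurable borel"
    and int: "\<And>k t. set_integrable lborel {0..t} (\<lambda>s. f k (q k s) $ i)"
  shows "uniform_limit {0..T} (\<lambda>k t. (LBINT s:{0..t}. f k (q k s) $ i) / r k) (\<lambda>t. F 0 $ i * t) sequentially"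
  unfolding uniform_limit_iff
proof (intro allI impI)
  fix e :: real assume e: "e > 0"
  define e' where "e' = e / (2 * (T + 1))"
  have e': "e' > 0" using e T by (simp add: e'_def)
  have "e' * T < e"
  proof -
    have "e' * T \<le> e' * (T + 1)" using e' by (intro mult_left_mono) auto
    also have "\<dots> = e / 2" using T unfolding e'_def by (simp add: field_simps add_nonneg_eq_0_iff)
    finally show ?thesis using e by simp
  qed
  have "\<forall>\<^sub>F k in sequentially. \<forall>s\<in>{0..T}. \<bar>f k (q k s) $ i - r k * F 0 $ i\<bar> \<le> e' * r k"
    by (rule rate_along_queue[OF lim F T e'])
  then show "\<forall>\<^sub>F k in sequentially. \<forall>t\<in>{0..T}. dist ((LBINT s:{0..t}. f k (q k s) $ i) / r k) (F 0 $ i * t) < e"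
  proof eventually_elim
    case (elim k)
    show ?case
    proof
      fix t assume t: "t \<in> {0..T}"
      have c: "set_integrable lborel {0..t} (\<lambda>s. r k * F 0 $ i)"
        by (rule set_integrable_bounded[where a=0 and b=t and B="\<bar>r k * F 0 $ i\<bar>"]) auto
      have "(LBINT s:{0..t}. f k (q k s) $ i - r k * F 0 $ i) = (LBINT s:{0..t}. f k (q k s) $ i) - r k * F 0 $ i * t"
        using t by (subst set_integral_diff(2)[OF int c]) (simp add: set_integral_const)
      moreover have "norm (LBINT s:{0..t}. f k (q k s) $ i - r k * F 0 $ i) \<le> (e' * r k) * t"
        by (rule norm_set_integral_Icc_le) (use meas elim t in auto)
      moreover have "(e' * r k) * t \<le> (e' * r k) * T" using t e' r_pos[of k] by (intro mult_left_mono) auto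
      ultimately have "\<bar>(LBINT s:{0..t}. f k (q k s) $ i) - r k * F 0 $ i * t\<bar> \<le> e' * T * r k"
        by (simp add: mult_ac)
      then have "\<bar>(LBINT s:{0..t}. f k (q k s) $ i) - r k * F 0 $ i * t\<bar> / r k \<le> e' * T"
        using r_pos[of k] by (simp add: pos_divide_le_eq)
      moreover have "(LBINT s:{0..t}. f k (q k s) $ i) / r k - F 0 $ i * t = ((LBINT s:{0..t}. f k (q k s) $ i) - r k * F 0 $ i * t) / r k"
        using r_pos[of k] by (simp add: diff_divide_distrib)
      then have "\<bar>(LBINT s:{0..t}. f k (q k s) $ i) - r k * F 0 $ i * t\<bar> / r k
          = \<bar>(LBINT s:{0..t}. f k (q k s) $ i) / r k - F 0 $ i * t\<bar>"
        using r_pos[of k] by (simp only: abs_divide abs_of_pos)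
      ultimately show "dist ((LBINT s:{0..t}. f k (q k s) $ i) / r k) (F 0 $ i * t) < e"
        using \<open>e' * T < e\<close> by (simp add: dist_real_def)
    qed
  qed
qed

lemma times_limit:
  assumes T: "T \<ge> 0"
  shows arr_limit: "uniform_limit {0..T} (\<lambda>k t. arr k i t / r k) (\<lambda>t. lam_lim 0 $ i * t) sequentially"
    and busy_limit: "uniform_limit {0..T} (\<lambda>k t. busy k i t / r k) (\<lambda>t. mu_lim 0 $ i * t) sequentially"
    and dep_limit: "uniform_limit {0..T} (\<lambda>k t. dep k i t / r k) (\<lambda>t. mu_lim 0 $ i * t) sequentially"
proof -
  show "uniform_limit {0..T} (\<lambda>k t. arr k i t / r k) (\<lambda>t. lam_lim 0 $ i * t) sequentially"
    unfolding arr_def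
    by (rule rate_integral_limit[OF fluid_rates(1) fluid_continuous(1) T rates_nth_measurable(1) rates_integrable(1)])
  have small: "uniform_limit {0..T} f (\<lambda>_. 0) sequentially"
    if "\<And>e. e > 0 \<Longrightarrow> \<forall>\<^sub>F k in sequentially. \<forall>t\<in>{0..T}. \<bar>f k t\<bar> \<le> e" for f :: "nat \<Rightarrow> real \<Rightarrow> real"
    unfolding uniform_limit_iff
  proof (intro allI impI)
    fix e :: real assume "e > 0"
    then show "\<forall>\<^sub>F k in sequentially. \<forall>t\<in>{0..T}. dist (f k t) 0 < e"
      using that[of "e/2"] by (auto elim!: eventually_mono simp: dist_real_def)
  qed
  have idle: "uniform_limit {0..T} (\<lambda>k t. idle k t $ i / r k) (\<lambda>_. 0) sequentially"
  proof (rule small)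
    fix e :: real assume "e > 0"
    from idle_and_queue_small[OF T this]
    show "\<forall>\<^sub>F k in sequentially. \<forall>t\<in>{0..T}. \<bar>idle k t $ i / r k\<bar> \<le> e"
    proof eventually_elim
      case (elim k)
      have "\<bar>idle k t $ i\<bar> \<le> e * r k" if "t \<in> {0..T}" for t
        using elim that component_le_norm_cart[of "idle k t" i] by fastforce
      then show ?case using r_pos[of k] by (auto simp: abs_divide pos_divide_le_eq)
    qed
  qed
  have "uniform_limit {0..T} (\<lambda>k t. (LBINT s:{0..t}. mu (n k) (q k s) $ i) / r k) (\<lambda>t. mu_lim 0 $ i * t) sequentially"
    by (rule rate_integral_limit[OF fluid_rates(2) fluid_continuous(2) T rates_nth_measurable(2) rates_integrable(2)])
  from uniform_limit_minus[OF this idle]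
  show busy: "uniform_limit {0..T} (\<lambda>k t. busy k i t / r k) (\<lambda>t. mu_lim 0 $ i * t) sequentially"
    by (simp add: service_split diff_divide_distrib[symmetric])
  obtain B where B: "B \<ge> 0" "\<forall>\<^sub>F k in sequentially. \<forall>t\<in>{0..T}. norm (q k t) \<le> B * r k \<and>
     (\<forall>i. arr k i t / r k \<le> B \<and> busy k i t / r k \<le> B \<and> dep k i t / r k \<le> B)"
    by (rule uniform_bounds[OF T])
  have "uniform_limit {0..T} (\<lambda>k t. sqrt (r k) * scaledD k (busy k i t / r k) $ i / r k) (\<lambda>_. 0) sequentially"
  proof (rule small)
    fix e :: real assume "e > 0"
    from scaled_small(2)[OF this, of B] B(2)
    show "\<forall>\<^sub>F k in sequentially. \<forall>t\<in>{0..T}. \<bar>sqrt (r k) * scaledD k (busy k i t / r k) $ i / r k\<bar> \<le> e"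
    proof eventually_elim
      case (elim k)
      show ?case
      proof
        fix t assume t: "t \<in> {0..T}"
        have "busy k i t / r k \<in> {0..B}" using elim(2) t times_nonneg(2)[of k i t] r_pos[of k] by auto
        then have "\<bar>scaledD k (busy k i t / r k) $ i\<bar> \<le> e * sqrt (r k)"
          using elim(1) component_le_norm_cart[of "scaledD k (busy k i t / r k)" i] by fastforce
        then have "sqrt (r k) * \<bar>scaledD k (busy k i t / r k) $ i\<bar> \<le> sqrt (r k) * (e * sqrt (r k))"
          using r_pos[of k] by (intro mult_left_mono) auto
        also have "\<dots> = e * r k" using r_pos[of k] by simp
        finally show "\<bar>sqrt (r k) * scaledD k (busy k i t / r k) $ i / r k\<bar> \<le> e"
          using r_pos[of k] by (simp add: abs_divide abs_mult pos_divide_le_eq)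
      qed
    qed
  qed
  from uniform_limit_add[OF busy this]
  show "uniform_limit {0..T} (\<lambda>k t. dep k i t / r k) (\<lambda>t. mu_lim 0 $ i * t) sequentially"
    by (simp add: unscale(2) add_divide_distrib[symmetric])
qed

lemma noise_limit:
  assumes T: "T \<ge> 0"
  shows "uniform_limit {0..T} (\<lambda>k t. noise k t $ i)
    (\<lambda>t. limit_noise P (lam_lim 0) (mu_lim 0) WA WD WPhi t $ i) sequentially"
proof -
  have b: "0 \<le> c * t \<and> c * t \<le> c * T" if "0 \<le> c" "t \<in> {0..T}" for c t :: real
    using that by (auto intro: mult_left_mono)
  have A: "uniform_limit {0..T} (\<lambda>k t. scaledA k (arr k i t / r k)) (\<lambda>t. path_of WA (lam_lim 0 $ i * t)) sequentially"
    by (rule uniform_limit_compose_time_change[OF scaled_uniform_limits(1) W_continuous(1) arr_limit[OF T] _ b[OF fluid_rates_nonneg(1)]])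
      (use times_nonneg(1) r_pos in \<open>auto intro!: divide_nonneg_pos\<close>)
  have D: "uniform_limit {0..T} (\<lambda>k t. scaledD k (busy k j t / r k)) (\<lambda>t. path_of WD (mu_lim 0 $ j * t)) sequentially" for j
    by (rule uniform_limit_compose_time_change[OF scaled_uniform_limits(2) W_continuous(2) busy_limit[OF T] _ b[OF fluid_rates_nonneg(2)]])
      (use times_nonneg(2) r_pos in \<open>auto intro!: divide_nonneg_pos\<close>)
  have F: "uniform_limit {0..T} (\<lambda>k t. scaledPhi k (dep k j t / r k)) (\<lambda>t. path_of WPhi (mu_lim 0 $ j * t)) sequentially" for j
    by (rule uniform_limit_compose_time_change[OF scaled_uniform_limits(3) W_continuous(3) dep_limit[OF T] _ b[OF fluid_rates_nonneg(2)]])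
      (use dep_nonneg r_pos in \<open>auto intro!: divide_nonneg_pos\<close>)
  note nth = bounded_linear.uniform_limit[OF bounded_linear_vec_nth]
  show ?thesis
    unfolding noise_def limit_noise_def vec_lambda_beta
    by (intro uniform_limit_add uniform_limit_minus uniform_limit_sum_finite uniform_limit_mult_const nth A D F finite)
qed

lemma norm_noise_diff_small:
  assumes T: "T \<ge> 0" and e: "e > 0"
  shows "\<forall>\<^sub>F k in sequentially. \<forall>t\<in>{0..T}.
    norm (noise k t - limit_noise P (lam_lim 0) (mu_lim 0) WA WD WPhi t) \<le> e"
proof -
  define N where "N = real CARD('k)"
  have N: "N > 0" unfolding N_def by simp
  have "\<forall>\<^sub>F k in sequentially. \<forall>i. \<forall>t\<in>{0..T}. dist (noise k t $ i) (limit_noise P (lam_lim 0) (mu_lim 0) WA WD WPhi t $ i) < e / N"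
    by (intro eventually_all_finite uniform_limitD[OF noise_limit[OF T]]) (use e N in auto)
  then show ?thesis
  proof eventually_elim
    case (elim k)
    show ?case
    proof
      fix t assume t: "t \<in> {0..T}"
      let ?v = "noise k t - limit_noise P (lam_lim 0) (mu_lim 0) WA WD WPhi t"
      have "norm ?v \<le> (\<Sum>i\<in>UNIV. \<bar>?v $ i\<bar>)" by (rule norm_le_l1_cart)
      also have "\<dots> \<le> (\<Sum>i\<in>(UNIV::'k set). e / N)"
        using elim t by (intro sum_mono) (auto simp: dist_real_def intro: less_imp_le)
      also have "\<dots> = e" using N by (simp add: N_def)
      finally show "norm ?v \<le> e" .
    qed
  qed
qed

definition x where "x = path_of X"
definition Mlim where "Mlim = limit_noise P (lam_lim 0) (mu_lim 0) WA WD WPhi"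
definition driver where "driver t = X0 + (LBINT s:{0..t}. a (x s)) + Mlim t"
definition Xs where "Xs k t = q k t /\<^sub>R sqrt (r k)"

lemma x_orthant: "x t \<in> orthant"
proof (cases "t \<ge> 0")
  case True
  then show ?thesis unfolding x_def by (rule X_orthant)
next
  case False
  have "x t = x 0" unfolding x_def by (rule path_of_nonpos) (use False in simp)
  then show ?thesis unfolding x_def using X_orthant[of 0] by simp
qed

lemma L_nonneg: "0 \<le> L" using a_lipschitz by (rule lipschitz_on_nonneg)

lemma a_x_measurable [measurable]: "(\<lambda>s. a (x s)) \<in> borel_measurable borel"
proof -
  have a: "a \<in> borel_measurable (restrict_space borel orthant)"
    by (rule borel_measurable_continuous_on_restrict, rule lipschitz_on_continuous_on[OF a_lipschitz])
  have "x \<in> borel_measurable borel" unfolding x_def by (rule path_of_borel)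
  then have "x \<in> measurable borel (restrict_space borel orthant)"
    by (rule measurable_restrict_space2[rotated]) (use x_orthant in auto)
  from measurable_compose[OF this a] show ?thesis .
qed

lemma x_bounded: obtains b where "b \<ge> 0" "\<And>s. s \<in> {0..T} \<Longrightarrow> norm (x s) \<le> b"
proof -
  have "bounded (x ` {0..T})" unfolding x_def by (intro cadlag_bounded path_of_cadlag)
  then obtain b where b: "\<forall>y\<in>x ` {0..T}. norm y \<le> b" unfolding bounded_iff by blast
  show thesis
  proof (rule that[of "\<bar>b\<bar>"])
    show "norm (x s) \<le> \<bar>b\<bar>" if "s \<in> {0..T}" for s using b that by (auto intro: order_trans[OF _ abs_ge_self])
  qed simp
qed

lemma a_x_bounded: obtains B where "B \<ge> 0" "\<And>s. s \<in> {0..T} \<Longrightarrow> norm (a (x s)) \<le> B"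
proof -
  obtain b where b: "b \<ge> 0" "\<And>s. s \<in> {0..T} \<Longrightarrow> norm (x s) \<le> b" by (rule x_bounded[where T=T]) (rule that, assumption+)
  show thesis
  proof (rule that[of "norm (a 0) + L * b"])
    show "norm (a (x s)) \<le> norm (a 0) + L * b" if "s \<in> {0..T}" for s
    proof -
      have "norm (a (x s) - a 0) \<le> L * norm (x s)"
        using lipschitz_onD[OF a_lipschitz x_orthant zero_orthant, of s] by (simp add: dist_norm)
      also have "\<dots> \<le> L * b" using b(2)[OF that] L_nonneg by (intro mult_left_mono)
      finally show ?thesis using norm_triangle_sub[of "a (x s)" "a 0"] by linarith
    qed
  qed (use b L_nonneg in simp)
qed

lemma Mlim_continuous: "continuous_on {0..} Mlim"
proof -
  have c: "continuous_on {0..} (\<lambda>t. w (c * t))" if "continuous_on {0..} w" "0 \<le> c" for w :: "real \<Rightarrow> 'c::topological_space" and c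
    by (rule continuous_on_compose2[OF that(1)]) (use that(2) in \<open>auto intro!: continuous_intros\<close>)
  show ?thesis
    unfolding Mlim_def limit_noise_def
    by (intro continuous_on_vec_lambda continuous_on_add continuous_on_diff continuous_on_sum continuous_on_mult
      continuous_on_const continuous_on_component c W_continuous fluid_rates_nonneg)
qed

lemma Mlim_0: "Mlim 0 = 0"
proof -
  have "Mlim 0 $ i = 0" for i
  proof -
    have "arr k j 0 = 0" "busy k j 0 = 0" for k j by (simp_all add: arr_def busy_def set_integral_singleton)
    moreover from this have "dep k j 0 = 0" for k j by (simp add: dep_def ND_0)
    ultimately have "noise k 0 $ i = 0" for k
      using scaled_eq[of 0 k] by (simp add: noise_def NA_0 ND_0 Phi_0)
    moreover have "(\<lambda>k. noise k 0 $ i) \<longlonglongrightarrow> Mlim 0 $ i"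
      unfolding Mlim_def by (rule tendsto_uniform_limitI[OF noise_limit[of 0]]) auto
    ultimately show ?thesis by (simp add: LIMSEQ_const_iff)
  qed
  then show ?thesis by (simp add: vec_eq_iff)
qed

lemma driver_continuous: "continuous_on {0..} driver"
proof -
  have "continuous_on {0..} (\<lambda>t. LBINT s:{0..t}. a (x s))"
  proof (rule continuous_on_atLeast_0)
    fix T :: real
    obtain B where "B \<ge> 0" "\<And>s. s \<in> {0..T} \<Longrightarrow> norm (a (x s)) \<le> B" by (rule a_x_bounded[where T=T]) (rule that, assumption+)
    then show "continuous_on {0..T} (\<lambda>t. LBINT s:{0..t}. a (x s))"
      by (intro set_integral_continuous[OF a_x_measurable])
  qed
  then show ?thesis unfolding driver_def by (intro continuous_on_add continuous_on_const Mlim_continuous)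
qed

lemma driver_0: "driver 0 = X0" "X0 \<in> orthant"
proof -
  show "driver 0 = X0" by (simp add: driver_def Mlim_0 set_integral_singleton)
  have "0 \<le> X0 $ i" for i
  proof (rule tendsto_lowerbound[OF tendsto_vec_nth[OF initial]])
    show "\<forall>\<^sub>F k in sequentially. 0 \<le> (path_of (Q k) 0 /\<^sub>R sqrt (real (n k))) $ i"
      using q_nonneg[of _ 0 i] by (auto simp: q_def intro!: always_eventually)
  qed simp
  then show "X0 \<in> orthant" by (simp add: orthant_def)
qed

lemma limit_reflected:
  obtains \<eta> where "\<And>T. reflected P T driver \<eta>" "\<And>t. t \<ge> 0 \<Longrightarrow> x t = driver t + reflection_matrix P *v \<eta> t"
proof -
  have p: "path_of (to_skorohod driver) t = driver t" if "t \<ge> 0" for t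
    using that cadlag_continuous[OF driver_continuous] by (simp add: path_of_to_skorohod)
  have "continuous_on {0..} (path_of (to_skorohod driver))"
    by (rule continuous_on_eq[OF driver_continuous]) (simp add: p)
  moreover have "path_of (to_skorohod driver) 0 \<in> orthant" using p[of 0] driver_0 by simp
  ultimately obtain \<eta> where sp: "skorohod_problem (reflection_matrix P) (to_skorohod driver)
      (skorohod_map (reflection_matrix P) (to_skorohod driver)) \<eta>"
    using skorohod_map_solves[OF P] by blast
  have "x t = path_of (skorohod_map (reflection_matrix P) (to_skorohod driver)) t" if "t \<ge> 0" for t
    using X_solution[OF that] unfolding x_def driver_def Mlim_def .
  then have "x t = driver t + reflection_matrix P *v path_of \<eta> t" if "t \<ge> 0" for t
    using sp that p[OF that] unfolding skorohod_problem_def by metis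
  moreover have "reflected P T driver (path_of \<eta>)" for T
    by (rule reflected_cong[OF _ skorohod_problem_reflected[OF sp]]) (simp add: p)
  ultimately show thesis by (intro that)
qed

lemma drift_limit:
  assumes "compact K" "K \<subseteq> orthant"
  shows "uniform_limit K (\<lambda>k y. net_rate k (sqrt (r k) *\<^sub>R y) /\<^sub>R sqrt (r k)) a sequentially"
  unfolding net_rate_def r_def by (rule filterlim_compose[OF drift[OF assms] n_lim])

lemma Xs_reflected:
  "reflected P T (\<lambda>t. inverse (sqrt (r k)) *\<^sub>R flow k t) (\<lambda>t. inverse (sqrt (r k)) *\<^sub>R idle k t)"
  "t \<ge> 0 \<Longrightarrow> Xs k t = inverse (sqrt (r k)) *\<^sub>R flow k t + reflection_matrix P *v (inverse (sqrt (r k)) *\<^sub>R idle k t)"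
proof -
  show "reflected P T (\<lambda>t. inverse (sqrt (r k)) *\<^sub>R flow k t) (\<lambda>t. inverse (sqrt (r k)) *\<^sub>R idle k t)"
    by (rule reflected_scale[OF flow_reflected]) (use r_pos[of k] in simp)
  show "Xs k t = inverse (sqrt (r k)) *\<^sub>R flow k t + reflection_matrix P *v (inverse (sqrt (r k)) *\<^sub>R idle k t)" if "t \<ge> 0"
    using flow_reflection[OF that, of k] linear_scale[OF matrix_vector_mul_linear[of "reflection_matrix P"], of "inverse (sqrt (r k))" "idle k t"]
    by (simp add: Xs_def scaleR_add_right)
qed

text \<open>
  The half-open interval in \<open>h\<tau>\<close> matters: the queue may jump out of the ball at the time \<open>\<tau>\<close>, but
  the integrals do not see this.
\<close>

lemma distance_bound:
  assumes lip: "reflection_lipschitz P c" and \<tau>: "\<tau> \<in> {0..T}" and \<epsilon>: "\<epsilon> \<ge> 0"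
    and h0: "norm (q k 0 /\<^sub>R sqrt (r k) - X0) \<le> \<epsilon>"
    and hn: "\<And>t. t \<in> {0..T} \<Longrightarrow> norm (noise k t - Mlim t) \<le> \<epsilon>"
    and hd: "\<And>y. y \<in> orthant \<inter> cball 0 \<rho> \<Longrightarrow> norm (net_rate k (sqrt (r k) *\<^sub>R y) /\<^sub>R sqrt (r k) - a y) \<le> \<epsilon>"
    and h\<tau>: "\<And>s. s \<in> {0..<\<tau>} \<Longrightarrow> norm (Xs k s) \<le> \<rho>" and t: "t \<in> {0..\<tau>}"
  shows "norm (Xs k t - x t) \<le> 2 * (c * ((2 + T) * \<epsilon>)) * exp (2 * (c * (L + 1)) * t)"
proof -
  obtain \<eta> where \<eta>: "\<And>T. reflected P T driver \<eta>" "\<And>t. t \<ge> 0 \<Longrightarrow> x t = driver t + reflection_matrix P *v \<eta> t"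
    by (rule limit_reflected) (rule that, assumption+)
  have c: "c > 0" using lip by (simp add: reflection_lipschitz_def)
  have s0: "sqrt (r k) > 0" using r_pos by simp
  define d where "d s = norm (Xs k s - x s)" for s
  have [measurable]: "x \<in> borel_measurable borel" unfolding x_def by (rule path_of_borel)
  have dm: "d \<in> borel_measurable borel" unfolding d_def Xs_def by measurable
  obtain b where b: "b \<ge> 0" "\<And>s. s \<in> {0..T} \<Longrightarrow> norm (x s) \<le> b" by (rule x_bounded[where T=T]) (rule that, assumption+)
  have "bounded (q k ` {0..T})" unfolding q_def by (intro cadlag_bounded path_of_cadlag)
  then obtain b' where b': "\<forall>y\<in>q k ` {0..T}. norm y \<le> b'" unfolding bounded_iff by blast
  define B where "B = b' / sqrt (r k) + b"
  have dB: "\<bar>d s\<bar> \<le> B" if s: "s \<in> {0..T}" for s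
  proof -
    have "norm (q k s) / sqrt (r k) \<le> b' / sqrt (r k)" using b' s s0 by (intro divide_right_mono) auto
    then have "norm (Xs k s) \<le> b' / sqrt (r k)"
      using s0 by (simp add: Xs_def divide_inverse mult.commute)
    then show ?thesis using norm_triangle_ineq4[of "Xs k s" "x s"] b(2)[OF s] by (simp add: d_def B_def)
  qed
  obtain A where A: "A \<ge> 0" "\<And>s. s \<in> {0..T} \<Longrightarrow> norm (a (x s)) \<le> A" by (rule a_x_bounded[where T=T]) (rule that, assumption+)
  define g where "g s = net_rate k (q k s) /\<^sub>R sqrt (r k) - a (x s)" for s
  have gm: "g \<in> borel_measurable borel" unfolding g_def by measurable
  have gd: "norm (g s) \<le> \<epsilon> + (L + 1) * d s" if s: "s \<in> {0..<\<tau>}" for s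
  proof -
    have y: "Xs k s \<in> orthant" using q_nonneg[of k s] s0 by (auto simp: Xs_def orthant_def)
    have "sqrt (r k) *\<^sub>R Xs k s = q k s" using s0 by (simp add: Xs_def)
    then have "norm (net_rate k (q k s) /\<^sub>R sqrt (r k) - a (Xs k s)) \<le> \<epsilon>"
      using hd[of "Xs k s"] h\<tau>[OF s] y by simp
    moreover have "norm (a (Xs k s) - a (x s)) \<le> L * d s"
      using lipschitz_onD[OF a_lipschitz y x_orthant] by (simp add: dist_norm d_def)
    moreover have "g s = (net_rate k (q k s) /\<^sub>R sqrt (r k) - a (Xs k s)) + (a (Xs k s) - a (x s))" by (simp add: g_def)
    ultimately have "norm (g s) \<le> \<epsilon> + L * d s" by (simp only: norm_triangle_le add_mono)
    moreover have "0 \<le> d s" by (simp add: d_def)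
    ultimately show ?thesis by (simp add: distrib_right)
  qed
  have di: "set_integrable lborel S (\<lambda>s. \<epsilon> + (L + 1) * d s)" "set_integrable lborel S d" "set_integrable lborel S (\<lambda>s. \<epsilon>)"
    if "S \<in> sets borel" "S \<subseteq> {0..T}" for S
  proof -
    show "set_integrable lborel S d"
      using dm dB that by (intro set_integrable_bounded[where a=0 and b=T and B=B]) auto
    moreover show "set_integrable lborel S (\<lambda>s. \<epsilon>)"
      using that \<epsilon> by (intro set_integrable_bounded[where a=0 and b=T and B=\<epsilon>]) auto
    ultimately show "set_integrable lborel S (\<lambda>s. \<epsilon> + (L + 1) * d s)"
      by (intro set_integral_add(1) set_integrable_mult_right) auto
  qed
  have step: "d t \<le> c * ((2 + T) * \<epsilon>) + c * (L + 1) * (LBINT s:{0..t}. d s)" if t: "t \<in> {0..\<tau>}" for t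
  proof -
    define \<delta> where "\<delta> = (2 + T) * \<epsilon> + (L + 1) * (LBINT s:{0..t}. d s)"
    have "norm (inverse (sqrt (r k)) *\<^sub>R flow k u - driver u) \<le> \<delta>" if u: "u \<in> {0..t}" for u
    proof -
      have uT: "u \<in> {0..T}" "u \<le> \<tau>" "0 \<le> u" using u t \<tau> by auto
      obtain B where B: "norm (net_rate k (q k s)) \<le> B" if "s \<in> {0..T}" for s
        by (rule rates_bounded[of T k]) (rule that, assumption)
      have i1: "set_integrable lborel {0..u} (\<lambda>s. net_rate k (q k s) /\<^sub>R sqrt (r k))"
        using rates_integrable(5)[of u k] by (rule set_integrable_scaleR_right)
      have i2: "set_integrable lborel {0..u} (\<lambda>s. a (x s))"
        using A uT by (intro set_integrable_bounded[OF a_x_measurable, where a=0 and b=u and B=A]) auto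
      have gi: "set_integrable lborel {0..u} g" unfolding g_def by (rule set_integral_diff(1)[OF i1 i2])
      have "(LBINT s:{0..u}. g s) = inverse (sqrt (r k)) *\<^sub>R (LBINT s:{0..u}. net_rate k (q k s)) - (LBINT s:{0..u}. a (x s))"
        unfolding g_def by (subst set_integral_diff(2)[OF i1 i2]) simp
      moreover have "inverse (sqrt (r k)) *\<^sub>R flow k u = q k 0 /\<^sub>R sqrt (r k) + noise k u + inverse (sqrt (r k)) *\<^sub>R (LBINT s:{0..u}. net_rate k (q k s))"
        using s0 by (simp add: flow_def scaleR_add_right)
      ultimately have eq: "inverse (sqrt (r k)) *\<^sub>R flow k u - driver u
          = (q k 0 /\<^sub>R sqrt (r k) - X0) + (noise k u - Mlim u) + (LBINT s:{0..u}. g s)"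
        by (simp add: driver_def)
      have "norm (LBINT s:{0..u}. g s) = norm (LBINT s:{0..<u}. g s)" by (simp add: set_integral_Icc_Ico)
      also have "\<dots> \<le> (LBINT s:{0..<u}. norm (g s))"
        by (rule set_integral_norm_bound, rule set_integrable_subset[OF gi]) auto
      also have "\<dots> \<le> (LBINT s:{0..<u}. \<epsilon> + (L + 1) * d s)"
      proof (rule set_integral_mono)
        show "set_integrable lborel {0..<u} (\<lambda>s. norm (g s))"
          by (rule set_integrable_norm, rule set_integrable_subset[OF gi]) auto
        show "set_integrable lborel {0..<u} (\<lambda>s. \<epsilon> + (L + 1) * d s)" using uT by (intro di) auto
        show "norm (g s) \<le> \<epsilon> + (L + 1) * d s" if "s \<in> {0..<u}" for s using gd[of s] that uT by simp
      qed
      also have "\<dots> = (LBINT s:{0..u}. \<epsilon> + (L + 1) * d s)" by (simp add: set_integral_Icc_Ico)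
      also have "\<dots> \<le> (LBINT s:{0..t}. \<epsilon> + (L + 1) * d s)"
      proof -
        have n: "0 \<le> \<epsilon> + (L + 1) * d s" for s using \<epsilon> L_nonneg by (simp add: d_def)
        have "set_integrable lborel {0..u} (\<lambda>s. \<epsilon> + (L + 1) * d s)" "set_integrable lborel {0..t} (\<lambda>s. \<epsilon> + (L + 1) * d s)"
          using t \<tau> uT by (intro di; auto)+
        then show ?thesis
          unfolding set_lebesgue_integral_def set_integrable_def
          by (rule integral_mono) (use n u in \<open>auto simp: indicator_def\<close>)
      qed
      also have "\<dots> = \<epsilon> * t + (L + 1) * (LBINT s:{0..t}. d s)"
        using di(2,3)[of "{0..t}"] t \<tau> by (subst set_integral_add(2)) (auto simp: set_integral_const)
      also have "\<dots> \<le> \<epsilon> * T + (L + 1) * (LBINT s:{0..t}. d s)" using t \<tau> \<epsilon> by (intro add_right_mono mult_left_mono) auto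
      finally have "norm (LBINT s:{0..u}. g s) \<le> \<epsilon> * T + (L + 1) * (LBINT s:{0..t}. d s)" .
      then have "norm (inverse (sqrt (r k)) *\<^sub>R flow k u - driver u) \<le> \<epsilon> + \<epsilon> + (\<epsilon> * T + (L + 1) * (LBINT s:{0..t}. d s))"
        unfolding eq by (intro norm_triangle_le add_mono h0 hn uT)
      then show ?thesis by (simp add: \<delta>_def algebra_simps)
    qed
    then have "norm ((inverse (sqrt (r k)) *\<^sub>R flow k t + reflection_matrix P *v (inverse (sqrt (r k)) *\<^sub>R idle k t))
        - (driver t + reflection_matrix P *v \<eta> t)) \<le> c * \<delta>"
      by (rule reflection_lipschitzD(2)[OF lip Xs_reflected(1) \<eta>(1)]) (use t in auto)
    then have "d t \<le> c * \<delta>" using Xs_reflected(2)[of t k] \<eta>(2)[of t] t by (simp add: d_def)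
    then show ?thesis by (simp add: \<delta>_def algebra_simps)
  qed
  have "d t \<le> 2 * (c * ((2 + T) * \<epsilon>)) * exp (2 * (c * (L + 1)) * t)"
    by (rule gronwall_bounded[OF dm dB _ _ step t]) (use \<tau> c L_nonneg \<epsilon> in auto)
  then show ?thesis by (simp add: d_def)
qed

lemma Xs_limit:
  assumes T: "T \<ge> 0"
  shows "uniform_limit {0..T} Xs x sequentially"
  unfolding uniform_limit_iff
proof (intro allI impI)
  fix e :: real assume e: "e > 0"
  obtain c where lip: "reflection_lipschitz P c" using reflection_lipschitz_exists[OF P] by blast
  then have c: "c > 0" by (simp add: reflection_lipschitz_def)
  obtain b where b: "b \<ge> 0" "\<And>s. s \<in> {0..T} \<Longrightarrow> norm (x s) \<le> b" by (rule x_bounded[where T=T]) (rule that, assumption+)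
  define E where "E = exp (2 * (c * (L + 1)) * T)"
  define \<epsilon> where "\<epsilon> = min e 1 / (4 * c * (2 + T) * E)"
  have pos: "4 * c * (2 + T) * E > 0" using c T by (simp add: E_def)
  have \<epsilon>: "\<epsilon> > 0" unfolding \<epsilon>_def using pos e by simp
  have half: "2 * (c * ((2 + T) * \<epsilon>)) * E = min e 1 / 2"
  proof -
    have "\<epsilon> * (4 * c * (2 + T) * E) = min e 1"
      using nonzero_eq_divide_eq[OF less_imp_neq[OF pos, symmetric], of \<epsilon> "min e 1"] \<epsilon>_def by blast
    then show ?thesis by (simp add: mult_ac)
  qed
  have "(\<lambda>k. q k 0 /\<^sub>R sqrt (r k)) \<longlonglongrightarrow> X0" using initial by (simp add: q_def r_def)
  from tendstoD[OF this \<epsilon>]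
  have "\<forall>\<^sub>F k in sequentially. dist (q k 0 /\<^sub>R sqrt (r k)) X0 < \<epsilon>" .
  moreover have "\<forall>\<^sub>F k in sequentially. \<forall>t\<in>{0..T}. norm (noise k t - Mlim t) \<le> \<epsilon>"
    unfolding Mlim_def by (rule norm_noise_diff_small[OF T \<epsilon>])
  moreover have "\<forall>\<^sub>F k in sequentially. \<forall>y\<in>orthant \<inter> cball 0 (b + 1). dist (net_rate k (sqrt (r k) *\<^sub>R y) /\<^sub>R sqrt (r k)) (a y) < \<epsilon>"
    by (rule uniform_limitD[OF drift_limit[OF compact_orthant_cball] \<epsilon>]) auto
  ultimately show "\<forall>\<^sub>F k in sequentially. \<forall>t\<in>{0..T}. dist (Xs k t) (x t) < e"
  proof eventually_elim
    case (elim k)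
    have close: "norm (Xs k t - x t) \<le> min e 1 / 2"
      if \<tau>: "\<tau> \<in> {0..T}" "\<And>s. s \<in> {0..<\<tau>} \<Longrightarrow> norm (Xs k s) \<le> b + 1" "t \<in> {0..\<tau>}" for \<tau> t
    proof -
      have "norm (Xs k t - x t) \<le> 2 * (c * ((2 + T) * \<epsilon>)) * exp (2 * (c * (L + 1)) * t)"
        by (rule distance_bound[OF lip \<tau>(1) _ _ _ _ \<tau>(2,3), where \<epsilon>=\<epsilon>]) (use elim \<epsilon> in \<open>auto simp: dist_norm less_imp_le\<close>)
      also have "\<dots> \<le> 2 * (c * ((2 + T) * \<epsilon>)) * E"
        unfolding E_def using c T \<epsilon> L_nonneg \<tau> by (intro mult_left_mono) (auto intro!: mult_left_mono)
      finally show ?thesis using half by simp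
    qed
    define S where "S = {\<tau>\<in>{0..T}. \<forall>s\<in>{0..<\<tau>}. norm (Xs k s) \<le> b + 1}"
    define \<tau> where "\<tau> = Sup S"
    have S0: "0 \<in> S" using T by (simp add: S_def)
    have bdd: "bdd_above S" by (auto simp: S_def)
    have \<tau>0: "0 \<le> \<tau>" unfolding \<tau>_def by (rule cSup_upper[OF S0 bdd])
    have \<tau>T: "\<tau> \<le> T" unfolding \<tau>_def using S0 by (intro cSup_least) (auto simp: S_def)
    have S\<tau>: "norm (Xs k s) \<le> b + 1" if s: "s \<in> {0..<\<tau>}" for s
    proof -
      obtain u where "u \<in> S" "s < u" using less_cSupD[of S s] S0 s unfolding \<tau>_def by auto
      then show ?thesis using s by (auto simp: S_def)
    qed
    have near: "norm (Xs k t - x t) \<le> min e 1 / 2" if "t \<in> {0..\<tau>}" for t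
      by (rule close[of \<tau>]) (use \<tau>0 \<tau>T S\<tau> that in auto)
    have "\<tau> = T"
    proof (rule ccontr)
      assume "\<tau> \<noteq> T"
      then have lt: "\<tau> < T" using \<tau>T by simp
      have "norm (Xs k \<tau>) \<le> norm (x \<tau>) + norm (Xs k \<tau> - x \<tau>)" by (rule norm_triangle_sub)
      also have "\<dots> < b + 1" using near[of \<tau>] b(2)[of \<tau>] \<tau>0 \<tau>T by (auto simp: min_def split: if_splits)
      finally have lt1: "norm (Xs k \<tau>) < b + 1" .
      have "((\<lambda>s. norm (Xs k s)) \<longlongrightarrow> norm (Xs k \<tau>)) (at_right \<tau>)"
        unfolding Xs_def q_def by (intro tendsto_intros cadlag_at_right[OF path_of_cadlag] \<tau>0)
      then have "\<forall>\<^sub>F s in at_right \<tau>. norm (Xs k s) < b + 1" using lt1 by (rule order_tendstoD(2))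
      then obtain u where u: "u > \<tau>" "\<And>s. \<tau> < s \<Longrightarrow> s < u \<Longrightarrow> norm (Xs k s) < b + 1"
        unfolding eventually_at_right_field by blast
      have "norm (Xs k s) \<le> b + 1" if "s \<in> {0..<min u T}" for s
        using S\<tau>[of s] u(2)[of s] lt1 that by (cases s \<tau> rule: linorder_cases) (auto intro: less_imp_le)
      then have "min u T \<in> S" using u(1) lt \<tau>0 by (auto simp: S_def)
      then have "min u T \<le> \<tau>" unfolding \<tau>_def by (rule cSup_upper[OF _ bdd])
      then show False using u(1) lt by simp
    qed
    then show ?case using near e by (force simp: dist_norm min_def split: if_splits)
  qed
qed

lemma scaled_queue_limit: "(\<lambda>k. scaled_queue (n k) (Q k)) \<longlonglongrightarrow> X"
proof (rule uniform_limit_imp_skorohod_limit)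
  fix T :: real assume "T \<ge> 0"
  have "path_of (scaled_queue (n k) (Q k)) t = Xs k t" if "t \<in> {0..T}" for k t
    using that by (simp add: path_of_scaled_queue Xs_def q_def r_def)
  then show "uniform_limit {0..T} (\<lambda>k. path_of (scaled_queue (n k) (Q k))) (path_of X) sequentially"
    using Xs_limit[OF \<open>T \<ge> 0\<close>] unfolding x_def
    by (subst uniform_limit_cong'[where g=Xs and i="path_of X"]) auto
qed

end

section \<open>The limit theorem\<close>

lemma linear_growth:
  fixes lam mu :: "nat \<Rightarrow> real^'k::finite \<Rightarrow> real^'k"
  assumes nonneg: "\<And>m x. m \<ge> 1 \<Longrightarrow> x \<in> orthant \<Longrightarrow> lam m x \<in> orthant \<and> mu m x \<in> orthant"
    and bdd: "\<And>i. bdd_above ((\<lambda>(n, x). lam n (real n *\<^sub>R x) $ i / (real n * (1 + norm x))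
                                     + mu n (real n *\<^sub>R x) $ i / (real n * (1 + norm x)))
                            ` ({1..} \<times> orthant))"
  obtains C where "C > 0" "\<And>m x i. m \<ge> 1 \<Longrightarrow> x \<in> orthant \<Longrightarrow> lam m x $ i \<le> C * (real m + norm x)"
    "\<And>m x i. m \<ge> 1 \<Longrightarrow> x \<in> orthant \<Longrightarrow> mu m x $ i \<le> C * (real m + norm x)"
proof -
  have "\<forall>i. \<exists>b. \<forall>p\<in>{1..} \<times> orthant. (\<lambda>(n, x). lam n (real n *\<^sub>R x) $ i / (real n * (1 + norm x))
      + mu n (real n *\<^sub>R x) $ i / (real n * (1 + norm x))) p \<le> b"
    using bdd unfolding bdd_above_def by blast
  from choice[OF this] obtain b where b: "\<forall>i. \<forall>p\<in>{1..} \<times> orthant. (\<lambda>(n, x). lam n (real n *\<^sub>R x) $ i / (real n * (1 + norm x))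
      + mu n (real n *\<^sub>R x) $ i / (real n * (1 + norm x))) p \<le> b i" by blast
  define C where "C = 1 + (\<Sum>i\<in>UNIV. \<bar>b i\<bar>)"
  have C: "C > 0" "b i \<le> C" for i
  proof -
    have "0 \<le> (\<Sum>i\<in>UNIV. \<bar>b i\<bar>)" by (intro sum_nonneg) auto
    then show "C > 0" unfolding C_def by linarith
    have "\<bar>b i\<bar> \<le> (\<Sum>i\<in>UNIV. \<bar>b i\<bar>)" by (intro member_le_sum) auto
    then show "b i \<le> C" by (simp add: C_def)
  qed
  have "lam m x $ i \<le> C * (real m + norm x) \<and> mu m x $ i \<le> C * (real m + norm x)" if m: "m \<ge> 1" and x: "x \<in> orthant" for m x i
  proof -
    define y where "y = x /\<^sub>R real m"
    have y: "y \<in> orthant" using x by (simp add: y_def orthant_def)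
    have my: "real m *\<^sub>R y = x" using m by (simp add: y_def)
    have den: "real m * (1 + norm y) = real m + norm x" using m by (simp add: y_def field_simps)
    have pos: "real m + norm x > 0" using m by (intro add_pos_nonneg) auto
    have nn: "0 \<le> lam m x $ i" "0 \<le> mu m x $ i" using nonneg[OF m x] by (auto simp: orthant_def)
    have "lam m x $ i / (real m + norm x) + mu m x $ i / (real m + norm x) \<le> b i"
      using b[rule_format, of "(m, y)" i] m y by (simp add: my den)
    then have "(lam m x $ i + mu m x $ i) / (real m + norm x) \<le> C" using C(2)[of i] by (simp add: add_divide_distrib)
    then have "lam m x $ i + mu m x $ i \<le> C * (real m + norm x)" using pos by (simp add: pos_divide_le_eq)
    then show ?thesis using nn by linarith
  qed
  then show thesis using C(1) by (intro that[of C]) auto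
qed

lemma routing_sum_le:
  assumes "routing_process M Phi" "\<omega> \<in> space M"
  shows "(\<Sum>j\<in>UNIV. Phi i j \<omega> m) \<le> m"
proof -
  have z: "Phi i j \<omega> 0 = 0" and s: "(\<Sum>j\<in>UNIV. int (Phi i j \<omega> (Suc m)) - int (Phi i j \<omega> m)) \<le> 1" for j m
    using assms unfolding routing_process_def by blast+
  have "(\<Sum>j\<in>UNIV. int (Phi i j \<omega> m)) \<le> int m"
  proof (induction m)
    case (Suc m)
    then show ?case using s[of m] by (simp add: sum_subtractf)
  qed (simp add: z)
  then show ?thesis by (simp flip: of_nat_sum)
qed

lemma scaled_queue_measurable:
  assumes "n \<ge> 1 \<Longrightarrow> Q \<in> borel_measurable M"
  shows "(\<lambda>\<omega>. scaled_queue n (Q \<omega>)) \<in> borel_measurable M"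
proof (cases "n \<ge> 1")
  case True
  show ?thesis
    by (rule measurable_compose[OF assms[OF True] borel_measurable_continuous_onI[OF continuous_scaled_queue]])
next
  case False
  then have "n = 0" by simp
  then have "(\<lambda>\<omega>. scaled_queue n (Q \<omega>)) = (\<lambda>_. to_skorohod (\<lambda>_. 0))" by (simp add: scaled_queue_def)
  then show ?thesis by simp
qed

lemma metrizable_primitives:
  "metrizable_space (euclidean :: ('a::metric_space \<times> 'b::metric_space skorohod \<times> 'c::metric_space skorohod \<times> 'd::metric_space skorohod) topology)"
  unfolding prod_topology_euclidean[symmetric]
  by (simp only: metrizable_space_prod_topology metrizable_skorohod metrizable_space_euclidean simp_thms)

theorem theorem3p3:
  fixes M :: "'w measure"
    and J :: "'k::finite set"
    and P :: "real^'k^'k"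
    and lam mu :: "nat \<Rightarrow> real^'k \<Rightarrow> real^'k"
    and NA ND :: "nat \<Rightarrow> 'k \<Rightarrow> 'w \<Rightarrow> real skorohod"
    and Phi :: "nat \<Rightarrow> 'k \<Rightarrow> 'k \<Rightarrow> 'w \<Rightarrow> nat \<Rightarrow> nat"
    and Q :: "nat \<Rightarrow> 'w \<Rightarrow> (real^'k) skorohod"
    and lam_lim mu_lim a :: "real^'k \<Rightarrow> real^'k"
    and X0 :: "'w \<Rightarrow> real^'k"
    and WA WD :: "'w \<Rightarrow> (real^'k) skorohod"
    and WPhi :: "'w \<Rightarrow> (real^'k^'k) skorohod"
    and X :: "'w \<Rightarrow> (real^'k) skorohod"
  assumes "prob_space M"
    and "substochastic P"
    (* the network with index n *)
    and rates: "\<And>n. n \<ge> 1 \<Longrightarrow>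
          lam n \<in> borel_measurable (restrict_space borel orthant) \<and>
          mu n \<in> borel_measurable (restrict_space borel orthant) \<and>
          (\<forall>x\<in>orthant. lam n x \<in> orthant \<and> mu n x \<in> orthant \<and> (\<forall>i. i \<notin> J \<longrightarrow> lam n x $ i = 0))"
    and arrival_primitives: "\<And>n i. n \<ge> 1 \<Longrightarrow> counting_process M (NA n i)"
    and no_arrivals: "\<And>n i \<omega> t. n \<ge> 1 \<Longrightarrow> i \<notin> J \<Longrightarrow> \<omega> \<in> space M \<Longrightarrow> t \<ge> 0 \<Longrightarrow>
          path_of (NA n i \<omega>) t = of_int \<lfloor>t\<rfloor>"
    and service_primitives: "\<And>n i. n \<ge> 1 \<Longrightarrow> counting_process M (ND n i)"
    and routing_primitives: "\<And>n. n \<ge> 1 \<Longrightarrow> routing_process M (Phi n)"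
    and queue_measurable: "\<And>n. n \<ge> 1 \<Longrightarrow> Q n \<in> borel_measurable M"
    and queue_integer: "\<And>n \<omega> t i. n \<ge> 1 \<Longrightarrow> \<omega> \<in> space M \<Longrightarrow> t \<ge> 0 \<Longrightarrow>
          path_of (Q n \<omega>) t $ i \<in> \<nat>"
    and queue_dynamics: "\<And>n. n \<ge> 1 \<Longrightarrow> AE \<omega> in M.
          queue_equation (lam n) (mu n) (\<lambda>i. NA n i \<omega>) (\<lambda>i. ND n i \<omega>) (\<lambda>i j. Phi n i j \<omega>) (Q n \<omega>)"
    and A0: "\<And>n i. n \<ge> 1 \<Longrightarrow> i \<in> J \<Longrightarrow>
          AE \<omega> in M. Limsup at_top (\<lambda>t. ereal (path_of (NA n i \<omega>) t / t)) < \<infinity>"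
    and A1: "spectral_radius P < 1"
    and A2: "\<And>i. bdd_above ((\<lambda>(n, x). lam n (real n *\<^sub>R x) $ i / (real n * (1 + norm x))
                                     + mu n (real n *\<^sub>R x) $ i / (real n * (1 + norm x)))
                            ` ({1..} \<times> orthant))"
    and A3_continuous: "\<And>i. continuous_on orthant (\<lambda>x. lam_lim x $ i)"
          "\<And>i. continuous_on orthant (\<lambda>x. mu_lim x $ i)"
    and A3_lam: "\<And>i C. compact C \<Longrightarrow> C \<subseteq> orthant \<Longrightarrow>
          uniform_limit C (\<lambda>n x. lam n (real n *\<^sub>R x) $ i / real n) (\<lambda>x. lam_lim x $ i) sequentially"
    and A3_mu: "\<And>i C. compact C \<Longrightarrow> C \<subseteq> orthant \<Longrightarrow>
          uniform_limit C (\<lambda>n x. mu n (real n *\<^sub>R x) $ i / real n) (\<lambda>x. mu_lim x $ i) sequentially"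
    and A3_traffic: "\<And>x. x \<in> orthant \<Longrightarrow> lam_lim x - reflection_matrix P *v mu_lim x = 0"
    and A4_lipschitz: "\<exists>L. L-lipschitz_on orthant a"
    and A4_drift: "\<And>C. compact C \<Longrightarrow> C \<subseteq> orthant \<Longrightarrow>
          uniform_limit C
            (\<lambda>n x. (lam n (sqrt (real n) *\<^sub>R x) - reflection_matrix P *v mu n (sqrt (real n) *\<^sub>R x))
                     /\<^sub>R sqrt (real n))
            a sequentially"
    and A5: "converges_in_distribution M
          (\<lambda>n \<omega>. (path_of (Q n \<omega>) 0 /\<^sub>R sqrt (real n),
                  scaled_counting n (\<lambda>i. NA n i \<omega>),
                  scaled_counting n (\<lambda>i. ND n i \<omega>),
                  scaled_routing n P (\<lambda>i j. Phi n i j \<omega>)))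
          (\<lambda>\<omega>. (X0 \<omega>, WA \<omega>, WD \<omega>, WPhi \<omega>))"
    and A5_continuous: "\<And>\<omega>. \<omega> \<in> space M \<Longrightarrow> continuous_on {0..} (path_of (WA \<omega>)) \<and>
          continuous_on {0..} (path_of (WD \<omega>)) \<and> continuous_on {0..} (path_of (WPhi \<omega>))"
    (* the limit process *)
    and X_measurable: "X \<in> borel_measurable M"
    and X_solution: "AE \<omega> in M. (\<forall>t\<ge>0. path_of (X \<omega>) t \<in> orthant) \<and>
          (\<forall>t\<ge>0. path_of (X \<omega>) t =
            path_of (skorohod_map (reflection_matrix P) (to_skorohod (\<lambda>u.
              X0 \<omega> + (LBINT s:{0..u}. a (path_of (X \<omega>) s))
              + limit_noise P (lam_lim 0) (mu_lim 0) (WA \<omega>) (WD \<omega>) (WPhi \<omega>) u))) t)"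
  shows "converges_in_distribution M (\<lambda>n \<omega>. scaled_queue n (Q n \<omega>)) X"
proof (rule extended_continuous_mapping[OF \<open>prob_space M\<close> A5 metrizable_primitives, where good="\<lambda>n \<omega>.
    queue_equation (lam n) (mu n) (\<lambda>i. NA n i \<omega>) (\<lambda>i. ND n i \<omega>) (\<lambda>i j. Phi n i j \<omega>) (Q n \<omega>)"])
  show "(\<lambda>\<omega>. scaled_queue n (Q n \<omega>)) \<in> borel_measurable M" for n
    by (rule scaled_queue_measurable) (rule queue_measurable)
  show "X \<in> borel_measurable M" by (rule X_measurable)
  show "AE \<omega> in M. queue_equation (lam n) (mu n) (\<lambda>i. NA n i \<omega>) (\<lambda>i. ND n i \<omega>) (\<lambda>i j. Phi n i j \<omega>) (Q n \<omega>)"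
    if "n \<ge> 1" for n using queue_dynamics[OF that] .
  obtain L where L: "L-lipschitz_on orthant a" using A4_lipschitz by blast
  have orth: "lam m x \<in> orthant \<and> mu m x \<in> orthant" if "m \<ge> 1" "x \<in> orthant" for m x
    using rates[OF that(1)] that(2) by blast
  obtain C where C: "C > 0" "\<And>m x i. m \<ge> 1 \<Longrightarrow> x \<in> orthant \<Longrightarrow> lam m x $ i \<le> C * (real m + norm x)"
    "\<And>m x i. m \<ge> 1 \<Longrightarrow> x \<in> orthant \<Longrightarrow> mu m x $ i \<le> C * (real m + norm x)"
    by (rule linear_growth[OF orth A2]) (assumption | rule that)+
  show "AE \<omega> in M. \<forall>r \<omega>'. filterlim r at_top sequentially \<longrightarrow>
      (\<forall>k. 1 \<le> r k \<and> \<omega>' k \<in> space M \<and>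
        queue_equation (lam (r k)) (mu (r k)) (\<lambda>i. NA (r k) i (\<omega>' k)) (\<lambda>i. ND (r k) i (\<omega>' k)) (\<lambda>i j. Phi (r k) i j (\<omega>' k)) (Q (r k) (\<omega>' k))) \<longrightarrow>
      (\<lambda>k. (path_of (Q (r k) (\<omega>' k)) 0 /\<^sub>R sqrt (real (r k)),
            scaled_counting (r k) (\<lambda>i. NA (r k) i (\<omega>' k)),
            scaled_counting (r k) (\<lambda>i. ND (r k) i (\<omega>' k)),
            scaled_routing (r k) P (\<lambda>i j. Phi (r k) i j (\<omega>' k)))) \<longlonglongrightarrow> (X0 \<omega>, WA \<omega>, WD \<omega>, WPhi \<omega>) \<longrightarrow>
      (\<lambda>k. scaled_queue (r k) (Q (r k) (\<omega>' k))) \<longlonglongrightarrow> X \<omega>"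
    (is "AE \<omega> in M. \<forall>r \<omega>'. _ \<longrightarrow> ?networks r \<omega>' \<longrightarrow> ?primitives r \<omega>' \<omega> \<longrightarrow> _")
    using X_solution AE_space
  proof eventually_elim
    case (elim \<omega>)
    show ?case
    proof (intro allI impI)
      fix r :: "nat \<Rightarrow> nat" and \<omega>' :: "nat \<Rightarrow> 'w"
      assume r: "filterlim r at_top sequentially" and k: "?networks r \<omega>'" and lim: "?primitives r \<omega>' \<omega>"
      have r1: "r k \<ge> 1" and sp: "\<omega>' k \<in> space M" for k using k by auto
      have NA': "path_of (NA (r k) i (\<omega>' k)) 0 = 0" for k i
        using arrival_primitives[OF r1] sp unfolding counting_process_def by blast
      have ND': "path_of (ND (r k) i (\<omega>' k)) 0 = 0" "t \<ge> 0 \<Longrightarrow> path_of (ND (r k) i (\<omega>' k)) t \<in> \<nat>" for k i t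
        using service_primitives[OF r1] sp unfolding counting_process_def by blast+
      have Phi': "Phi (r k) i j (\<omega>' k) 0 = 0" for k i j
        using routing_primitives[OF r1] sp unfolding routing_process_def by blast
      note lims = tendsto_fst[OF lim] tendsto_fst[OF tendsto_snd[OF lim]]
        tendsto_fst[OF tendsto_snd[OF tendsto_snd[OF lim]]] tendsto_snd[OF tendsto_snd[OF tendsto_snd[OF lim]]]
      interpret critical_networks P r lam mu "\<lambda>k i. NA (r k) i (\<omega>' k)" "\<lambda>k i. ND (r k) i (\<omega>' k)"
        "\<lambda>k i j. Phi (r k) i j (\<omega>' k)" "\<lambda>k. Q (r k) (\<omega>' k)" lam_lim mu_lim a "X0 \<omega>" "WA \<omega>" "WD \<omega>" "WPhi \<omega>" "X \<omega>" C L
      proof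
        show "substochastic P" "spectral_radius P < 1" by fact+
        show "filterlim r at_top sequentially" by fact
        show "1 \<le> r k" for k by (rule r1)
        show "lam m \<in> borel_measurable (restrict_space borel orthant)" "mu m \<in> borel_measurable (restrict_space borel orthant)" if "m \<ge> 1" for m
          using rates[OF that] by blast+
        show "lam m x \<in> orthant \<and> mu m x \<in> orthant" if "m \<ge> 1" "x \<in> orthant" for m x by (rule orth[OF that])
        show "(\<Sum>j\<in>UNIV. Phi (r k) i j (\<omega>' k) m) \<le> m" for k i m
          by (rule routing_sum_le[OF routing_primitives[OF r1] sp])
        show "path_of (Q (r k) (\<omega>' k)) t $ i \<in> \<nat>" if "t \<ge> 0" for k t i by (rule queue_integer[OF r1 sp that])
        show "queue_equation (lam (r k)) (mu (r k)) (\<lambda>i. NA (r k) i (\<omega>' k)) (\<lambda>i. ND (r k) i (\<omega>' k)) (\<lambda>i j. Phi (r k) i j (\<omega>' k)) (Q (r k) (\<omega>' k))" for k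
          using k by blast
        show "path_of (X \<omega>) t \<in> orthant" if "t \<ge> 0" for t using elim that by blast
        show "path_of (X \<omega>) t = path_of (skorohod_map (reflection_matrix P) (to_skorohod (\<lambda>u.
              X0 \<omega> + (LBINT s:{0..u}. a (path_of (X \<omega>) s))
              + limit_noise P (lam_lim 0) (mu_lim 0) (WA \<omega>) (WD \<omega>) (WPhi \<omega>) u))) t" if "t \<ge> 0" for t
          using elim that by blast
        show "continuous_on {0..} (path_of (WA \<omega>))" "continuous_on {0..} (path_of (WD \<omega>))" "continuous_on {0..} (path_of (WPhi \<omega>))"
          using A5_continuous elim by blast+
      qed (use C L NA' ND' Phi' A3_continuous A3_lam A3_mu A3_traffic A4_drift lims in \<open>simp_all only: fst_conv snd_conv\<close>)
      show "(\<lambda>k. scaled_queue (r k) (Q (r k) (\<omega>' k))) \<longlonglongrightarrow> X \<omega>" by (rule scaled_queue_limit)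
    qed
  qed
qed

end
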